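(* Let $r_\lambda$ be a real resonance point of a line $\{H_r=H_0+rV:r\in\mathbb R\}$ regular at an essentially regular point $\lambda$. The idempotents $P_{\lambda\pm i0}(r_\lambda)$ are linear isomorphisms of the vector spaces $\Upsilon_{\lambda\mp i0}(r_\lambda)$ and $\Upsilon_{\lambda\pm i0}(r_\lambda)$; that is, $P_{\lambda+i0}(r_\lambda)$ restricts to a linear isomorphism of $\Upsilon_{\lambda-i0}(r_\lambda)$ onto $\Upsilon_{\lambda+i0}(r_\lambda)$ and $P_{\lambda-i0}(r_\lambda)$ restricts to a linear isomorphism of $\Upsilon_{\lambda+i0}(r_\lambda)$ onto $\Upsilon_{\lambda-i0}(r_\lambda)$.
   Context: Setting. $\mathcal H,\mathcal K$ are complex separable Hilbert spaces. $F:\mathcal H\to\mathcal K$ is a closed densely defined operator with trivial kernel and co-kernel. $\{H_r=H_0+rV:r\in\mathbb R\}$ is a line of self-adjoint operators on $\mathcal H$, $V=F^*JF$ self-adjoint with $J$ bounded self-adjoint on $\mathcal K$. Standing assumptions: all $H_r$ have a common dense domain $\mathcal D$, $\mathcal D\subset\operatorname{dom}(F)\cap\operatorname{dom}(V)$, $V$ is relatively compact with respect to each $H_r$, and for non-real $z$ the operator $T_z(H_r):=F(H_r-z)^{-1}F^*$ (densely defined on $\operatorname{dom}F^*$) extends to a compact operator on $\mathcal K$, also denoted $T_z(H_r)$. $\Lambda(H_r,F)$ is the set of real $\lambda$ for which the norm limits $T_{\lambda\pm i0}(H_r):=\lim_{y\to0^+}T_{\lambda\pm iy}(H_r)$ exist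 (assumed of full Lebesgue measure). It is assumed that $\lambda\in\Lambda(H_r,F)$ for some real $r$ (that is, the line is regular at $\lambda$); a real $r$ is non-resonant if $\lambda\in\Lambda(H_r,F)$, otherwise it is a real resonance point. For $z=\lambda\pm i0$ and non-resonant $s$ put $A_z(s)=T_z(H_s)J$; as a function of $s$ it extends meromorphically to $\mathbb C$, its real poles being the real resonance points. For such a pole $r_\lambda$: $\Upsilon^k_z(r_\lambda)=\{u\in\mathcal K:(1+(r_\lambda-s)A_z(s))^ku=0\}$ (independent of the non-resonant real $s$) and $\Upsilon_z(r_\lambda)=\bigcup_k\Upsilon_z^k(r_\lambda)$. $P_z(r_\lambda)=\frac1{2\pi i}\oint_{C(r_\lambda)}A_z(s)\,ds$, where $C(r_\lambda)$ is a small counter-clockwise circle around $r_\lambda$ enclosing no other poles; it is a finite-rank idempotent with range $\Upsilon_z(r_\lambda)$ (equal to the Riesz idempotent of $A_z(s)$ for the eigenvalue $(s-r_\lambda)^{-1}$, for any non-resonant real $s$). *)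

theory Defs
  imports "HOL-Complex_Analysis.Complex_Analysis"
begin

section \<open>Complex Hilbert spaces\<close>

class scaleC =
  fixes scaleC :: "complex \<Rightarrow> 'a \<Rightarrow> 'a"  (infixr \<open>*\<^sub>C\<close> 75)

class complex_normed_vector = real_normed_vector + scaleC +
  assumes scaleC_add_right: "c *\<^sub>C (x + y) = c *\<^sub>C x + c *\<^sub>C y"
    and scaleC_add_left: "(c + d) *\<^sub>C x = c *\<^sub>C x + d *\<^sub>C x"
    and scaleC_scaleC: "c *\<^sub>C (d *\<^sub>C x) = (c * d) *\<^sub>C x"
    and scaleC_of_real: "complex_of_real r *\<^sub>C x = r *\<^sub>R x"
    and norm_scaleC: "norm (c *\<^sub>C x) = cmod c * norm x"

text \<open>A complex Hilbert space carries the real inner product \<open>Re \<langle>x, y\<rangle>\<close>, so that norm, topology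
  and completeness are those of the underlying real Hilbert space.  The complex inner product is
  conjugate linear in its first argument.\<close>

class chilbert_space = complex_normed_vector + real_inner + banach +
  fixes cinner :: "'a \<Rightarrow> 'a \<Rightarrow> complex"
  assumes cinner_commute: "cinner x y = cnj (cinner y x)"
    and cinner_add_right: "cinner x (y + z) = cinner x y + cinner x z"
    and cinner_scaleC_right: "cinner x (c *\<^sub>C y) = c * cinner x y"
    and Re_cinner: "Re (cinner x y) = inner x y"

instantiation complex :: chilbert_space
begin

definition scaleC_complex :: "complex \<Rightarrow> complex \<Rightarrow> complex" where
  "scaleC_complex c x = c * x"

definition cinner_complex :: "complex \<Rightarrow> complex \<Rightarrow> complex" where
  "cinner_complex x y = cnj x * y"

instance
  by standard
    (auto simp: scaleC_complex_def cinner_complex_def algebra_simps norm_mult scaleR_conv_of_real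
      inner_complex_def)

end

lemma bounded_linear_scaleC: "bounded_linear (\<lambda>x :: 'a::complex_normed_vector. c *\<^sub>C x)"
proof (rule bounded_linear_intro[where K = "cmod c"])
  fix r and x :: 'a
  show "c *\<^sub>C (r *\<^sub>R x) = r *\<^sub>R (c *\<^sub>C x)"
    by (simp add: scaleC_scaleC mult.commute flip: scaleC_of_real)
qed (simp_all add: scaleC_add_right norm_scaleC mult.commute)

text \<open>Bounded operators are elements of \<open>'a \<Rightarrow>\<^sub>L 'b\<close> with the operator norm.  This type also contains
  operators that are only real linear; complex linearity is imposed by \<open>linear_op\<close> below.\<close>

instantiation blinfun :: (real_normed_vector, complex_normed_vector) complex_normed_vector
begin

lift_definition scaleC_blinfun :: "complex \<Rightarrow> ('a \<Rightarrow>\<^sub>L 'b) \<Rightarrow> ('a \<Rightarrow>\<^sub>L 'b)"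
  is "\<lambda>c f x. c *\<^sub>C f x"
  by (rule bounded_linear_compose[OF bounded_linear_scaleC])

instance
proof
  fix c d :: complex and r :: real and A B :: "'a \<Rightarrow>\<^sub>L 'b"
  show "c *\<^sub>C (A + B) = c *\<^sub>C A + c *\<^sub>C B"
    by transfer (simp add: scaleC_add_right)
  show "(c + d) *\<^sub>C A = c *\<^sub>C A + d *\<^sub>C A"
    by transfer (simp add: scaleC_add_left)
  show "c *\<^sub>C (d *\<^sub>C A) = (c * d) *\<^sub>C A"
    by transfer (simp add: scaleC_scaleC)
  show "complex_of_real r *\<^sub>C A = r *\<^sub>R A"
    by transfer (simp add: scaleC_of_real)
  show "norm (c *\<^sub>C A) = cmod c * norm A"
  proof transfer
    fix c :: complex and f :: "'a \<Rightarrow> 'b"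
    assume f: "bounded_linear f"
    have "onorm (\<lambda>x. c *\<^sub>C f x) = onorm (\<lambda>x. cmod c *\<^sub>R f x)"
      by (simp add: onorm_def norm_scaleC)
    then show "onorm (\<lambda>x. c *\<^sub>C f x) = cmod c * onorm f"
      using onorm_scaleR[OF f, of "cmod c"] by simp
  qed
qed

end


section \<open>Unbounded operators\<close>

text \<open>A (not necessarily bounded or everywhere defined) operator from \<open>'a\<close> to \<open>'b\<close> is identified with
  its graph.  The product \<open>G\<^sub>2 G\<^sub>1\<close> of operators, with its maximal domain, is the relational
  composition \<open>G\<^sub>1 O G\<^sub>2\<close>: the factor applied first is on the left.\<close>

definition linear_op :: "('a::complex_normed_vector \<times> 'b::complex_normed_vector) set \<Rightarrow> bool" where
  "linear_op G \<longleftrightarrow> single_valued G \<and> (0, 0) \<in> G \<and>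
     (\<forall>(x, y) \<in> G. \<forall>(x', y') \<in> G. (x + x', y + y') \<in> G) \<and>
     (\<forall>c. \<forall>(x, y) \<in> G. (c *\<^sub>C x, c *\<^sub>C y) \<in> G)"

definition densely_defined :: "('a::complex_normed_vector \<times> 'b::complex_normed_vector) set \<Rightarrow> bool" where
  "densely_defined G \<longleftrightarrow> closure (Domain G) = UNIV"

definition op_kernel :: "('a \<times> 'b::zero) set \<Rightarrow> 'a set" where
  "op_kernel G = {x. (x, 0) \<in> G}"

definition op_add :: "('a \<times> 'b::plus) set \<Rightarrow> ('a \<times> 'b) set \<Rightarrow> ('a \<times> 'b) set" where
  "op_add G G' = {(x, y + y') | x y y'. (x, y) \<in> G \<and> (x, y') \<in> G'}"

definition op_scale :: "complex \<Rightarrow> ('a \<times> 'b::scaleC) set \<Rightarrow> ('a \<times> 'b) set" where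
  "op_scale c G = {(x, c *\<^sub>C y) | x y. (x, y) \<in> G}"

definition op_graph :: "('a::real_normed_vector \<Rightarrow>\<^sub>L 'b::real_normed_vector) \<Rightarrow> ('a \<times> 'b) set" where
  "op_graph A = {(x, blinfun_apply A x) | x. True}"

definition op_adjoint :: "('a::chilbert_space \<times> 'b::chilbert_space) set \<Rightarrow> ('b \<times> 'a) set" where
  "op_adjoint G = {(u, w). \<forall>(x, y) \<in> G. cinner u y = cinner w x}"

definition self_adjoint :: "('a::chilbert_space \<times> 'a) set \<Rightarrow> bool" where
  "self_adjoint G \<longleftrightarrow> linear_op G \<and> densely_defined G \<and> op_adjoint G = G"

text \<open>The graph of \<open>(G - z)\<^sup>-\<^sup>1\<close>.\<close>

definition resolvent :: "('a::complex_normed_vector \<times> 'a) set \<Rightarrow> complex \<Rightarrow> ('a \<times> 'a) set" where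
  "resolvent G z = {(y - z *\<^sub>C x, x) | x y. (x, y) \<in> G}"

definition compact_op :: "('a::complex_normed_vector \<times> 'b::complex_normed_vector) set \<Rightarrow> bool" where
  "compact_op G \<longleftrightarrow> linear_op G \<and> Domain G = UNIV \<and> compact (closure (G `` cball 0 1))"

definition relatively_compact :: "('a::complex_normed_vector \<times> 'b::complex_normed_vector) set
    \<Rightarrow> ('a \<times> 'a) set \<Rightarrow> bool" where
  "relatively_compact V G \<longleftrightarrow> Domain G \<subseteq> Domain V \<and>
     (\<forall>z. Im z \<noteq> 0 \<longrightarrow> compact_op (resolvent G z O V))"


section \<open>Holomorphic and meromorphic functions with values in a complex normed space\<close>

definition vholomorphic_on :: "(complex \<Rightarrow> 'a::complex_normed_vector) \<Rightarrow> complex set \<Rightarrow> bool" where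
  "vholomorphic_on f S \<longleftrightarrow>
     (\<forall>s\<in>S. \<exists>D. ((\<lambda>w. inverse (w - s) *\<^sub>C (f w - f s)) \<longlongrightarrow> D) (at s within S))"

text \<open>Meromorphic on all of the complex plane.  The values at poles are irrelevant.\<close>

definition vmeromorphic :: "(complex \<Rightarrow> 'a::complex_normed_vector) \<Rightarrow> bool" where
  "vmeromorphic f \<longleftrightarrow>
     (\<forall>s. \<exists>n g \<epsilon>. 0 < \<epsilon> \<and> vholomorphic_on g (ball s \<epsilon>) \<and>
        (\<forall>w \<in> ball s \<epsilon> - {s}. (w - s) ^ n *\<^sub>C f w = g w))"

definition vcontour_integral :: "(real \<Rightarrow> complex) \<Rightarrow> (complex \<Rightarrow> 'a::complex_normed_vector) \<Rightarrow> 'a" where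
  "vcontour_integral \<gamma> f = integral {0..1} (\<lambda>t. vector_derivative \<gamma> (at t) *\<^sub>C f (\<gamma> t))"


section \<open>The sandwiched resolvent and its boundary values\<close>

definition sandwich_extends :: "('h::chilbert_space \<times> 'k::chilbert_space) set \<Rightarrow> ('h \<times> 'h) set
    \<Rightarrow> complex \<Rightarrow> ('k \<Rightarrow>\<^sub>L 'k) \<Rightarrow> bool" where
  "sandwich_extends F G z T \<longleftrightarrow>
     compact_op (op_graph T) \<and> op_adjoint F O resolvent G z O F \<subseteq> op_graph T"

definition sandwich :: "('h::chilbert_space \<times> 'k::chilbert_space) set \<Rightarrow> ('h \<times> 'h) set
    \<Rightarrow> complex \<Rightarrow> ('k \<Rightarrow>\<^sub>L 'k)" where
  "sandwich F G z = (THE T. sandwich_extends F G z T)"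

text \<open>A side \<open>\<sigma> = 1\<close> or \<open>\<sigma> = -1\<close> stands for the boundary point \<open>\<lambda> + i0\<close> or \<open>\<lambda> - i0\<close>.\<close>

definition Lambda :: "('h::chilbert_space \<times> 'k::chilbert_space) set \<Rightarrow> ('h \<times> 'h) set \<Rightarrow> real set" where
  "Lambda F G = {lam. \<forall>\<sigma>\<in>{1, -1}. \<exists>L. ((\<lambda>y. sandwich F G (Complex lam (\<sigma> * y))) \<longlongrightarrow> L) (at_right 0)}"

definition sandwich_bdry :: "('h::chilbert_space \<times> 'k::chilbert_space) set \<Rightarrow> ('h \<times> 'h) set
    \<Rightarrow> real \<Rightarrow> real \<Rightarrow> ('k \<Rightarrow>\<^sub>L 'k)" where
  "sandwich_bdry F G lam \<sigma> = Lim (at_right 0) (\<lambda>y. sandwich F G (Complex lam (\<sigma> * y)))"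


section \<open>Lines of self-adjoint operators\<close>

text \<open>The operator \<open>V = F\<^sup>* J F\<close>.\<close>

definition perturbation :: "('h::chilbert_space \<times> 'k::chilbert_space) set \<Rightarrow> ('k \<Rightarrow>\<^sub>L 'k)
    \<Rightarrow> ('h \<times> 'h) set" where
  "perturbation F J = F O op_graph J O op_adjoint F"

text \<open>The co-kernel of \<open>F\<close> is the orthogonal complement of its range, that is, the kernel of its adjoint.\<close>

locale resonance_line =
  fixes F :: "('h::{chilbert_space, second_countable_topology}
                \<times> 'k::{chilbert_space, second_countable_topology}) set"
    and J :: "'k \<Rightarrow>\<^sub>L 'k"
    and H :: "real \<Rightarrow> ('h \<times> 'h) set"
    and D :: "'h set"
  assumes F_linear: "linear_op F"
    and F_closed: "closed F"
    and F_dense: "densely_defined F"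
    and F_kernel: "op_kernel F = {0}"
    and F_cokernel: "op_kernel (op_adjoint F) = {0}"
    and J_self_adjoint: "self_adjoint (op_graph J)"
    and V_self_adjoint: "self_adjoint (perturbation F J)"
    and H_self_adjoint: "\<And>r. self_adjoint (H r)"
    and H_line: "\<And>r. H r = op_add (H 0) (op_scale (complex_of_real r) (perturbation F J))"
    and D_dense: "closure D = UNIV"
    and H_domain: "\<And>r. Domain (H r) = D"
    and D_subset: "D \<subseteq> Domain F \<inter> Domain (perturbation F J)"
    and V_relatively_compact: "\<And>r. relatively_compact (perturbation F J) (H r)"
    and sandwich_compact: "\<And>r z. Im z \<noteq> 0 \<Longrightarrow> \<exists>T. sandwich_extends F (H r) z T"
    and Lambda_full: "\<And>r. negligible (- Lambda F (H r))"

definition regular_at :: "('h::chilbert_space \<times> 'k::chilbert_space) set \<Rightarrow> (real \<Rightarrow> ('h \<times> 'h) set)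
    \<Rightarrow> real \<Rightarrow> bool" where
  "regular_at F H lam \<longleftrightarrow> (\<exists>r. lam \<in> Lambda F (H r))"

definition nonresonant :: "('h::chilbert_space \<times> 'k::chilbert_space) set \<Rightarrow> (real \<Rightarrow> ('h \<times> 'h) set)
    \<Rightarrow> real \<Rightarrow> real \<Rightarrow> bool" where
  "nonresonant F H lam r \<longleftrightarrow> lam \<in> Lambda F (H r)"

definition resonance_point :: "('h::chilbert_space \<times> 'k::chilbert_space) set \<Rightarrow> (real \<Rightarrow> ('h \<times> 'h) set)
    \<Rightarrow> real \<Rightarrow> real \<Rightarrow> bool" where
  "resonance_point F H lam r \<longleftrightarrow> \<not> nonresonant F H lam r"

definition A_op :: "('h::chilbert_space \<times> 'k::chilbert_space) set \<Rightarrow> ('k \<Rightarrow>\<^sub>L 'k)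
    \<Rightarrow> (real \<Rightarrow> ('h \<times> 'h) set) \<Rightarrow> real \<Rightarrow> real \<Rightarrow> real \<Rightarrow> ('k \<Rightarrow>\<^sub>L 'k)" where
  "A_op F J H lam \<sigma> s = sandwich_bdry F (H s) lam \<sigma> o\<^sub>L J"

text \<open>The operator \<open>1 + (r - s) A\<^sub>z(s)\<close> depends on the non-resonant point \<open>s\<close>, but the kernels of its
  powers do not; a non-resonant \<open>s\<close> exists because the line is assumed to be regular.\<close>

definition Upsilon_k :: "('h::chilbert_space \<times> 'k::chilbert_space) set \<Rightarrow> ('k \<Rightarrow>\<^sub>L 'k)
    \<Rightarrow> (real \<Rightarrow> ('h \<times> 'h) set) \<Rightarrow> real \<Rightarrow> real \<Rightarrow> real \<Rightarrow> nat \<Rightarrow> 'k set" where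
  "Upsilon_k F J H lam \<sigma> r k =
     {u. \<forall>s. nonresonant F H lam s \<longrightarrow> ((\<lambda>v. v + (r - s) *\<^sub>R A_op F J H lam \<sigma> s v) ^^ k) u = 0}"

definition Upsilon :: "('h::chilbert_space \<times> 'k::chilbert_space) set \<Rightarrow> ('k \<Rightarrow>\<^sub>L 'k)
    \<Rightarrow> (real \<Rightarrow> ('h \<times> 'h) set) \<Rightarrow> real \<Rightarrow> real \<Rightarrow> real \<Rightarrow> 'k set" where
  "Upsilon F J H lam \<sigma> r = (\<Union>k. Upsilon_k F J H lam \<sigma> r k)"

text \<open>The meromorphic continuation of \<open>A\<^sub>z\<close>.  Any two choices agree off a discrete set.\<close>

definition A_ext :: "('h::chilbert_space \<times> 'k::chilbert_space) set \<Rightarrow> ('k \<Rightarrow>\<^sub>L 'k)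
    \<Rightarrow> (real \<Rightarrow> ('h \<times> 'h) set) \<Rightarrow> real \<Rightarrow> real \<Rightarrow> complex \<Rightarrow> ('k \<Rightarrow>\<^sub>L 'k)" where
  "A_ext F J H lam \<sigma> = (SOME M. vmeromorphic M \<and>
     (\<forall>s. nonresonant F H lam s \<longrightarrow> M (complex_of_real s) = A_op F J H lam \<sigma> s))"

text \<open>The integral over a circle of radius \<open>\<epsilon>\<close> does not depend on \<open>\<epsilon>\<close> once the circle encloses no
  pole other than \<open>r\<close>.\<close>

definition P_res :: "('h::chilbert_space \<times> 'k::chilbert_space) set \<Rightarrow> ('k \<Rightarrow>\<^sub>L 'k)
    \<Rightarrow> (real \<Rightarrow> ('h \<times> 'h) set) \<Rightarrow> real \<Rightarrow> real \<Rightarrow> real \<Rightarrow> ('k \<Rightarrow>\<^sub>L 'k)" where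
  "P_res F J H lam \<sigma> r = (THE P. \<forall>\<^sub>F \<epsilon> in at_right 0.
     P = (1 / (2 * of_real pi * \<i>)) *\<^sub>C
           vcontour_integral (circlepath (complex_of_real r) \<epsilon>) (A_ext F J H lam \<sigma>))"


section \<open>Linear isomorphisms between subspaces\<close>

definition csubspace :: "'a::complex_normed_vector set \<Rightarrow> bool" where
  "csubspace U \<longleftrightarrow> 0 \<in> U \<and> (\<forall>x\<in>U. \<forall>y\<in>U. x + y \<in> U) \<and> (\<forall>c. \<forall>x\<in>U. c *\<^sub>C x \<in> U)"

definition linear_iso_betw :: "('a::complex_normed_vector \<Rightarrow> 'b::complex_normed_vector)
    \<Rightarrow> 'a set \<Rightarrow> 'b set \<Rightarrow> bool" where
  "linear_iso_betw f U W \<longleftrightarrow> csubspace U \<and> csubspace W \<and>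
     (\<forall>x\<in>U. \<forall>y\<in>U. f (x + y) = f x + f y) \<and> (\<forall>c. \<forall>x\<in>U. f (c *\<^sub>C x) = c *\<^sub>C f x) \<and>
     bij_betw f U W"

end

theory Submission
  imports Defs
begin

text \<open>Fix a non-resonant \<open>s\<close> and put \<open>A\<^sub>\<plusminus> = T\<^sub>\<plusminus> J\<close> at \<open>s\<close>.  By Riesz theory for the compact operators
  \<open>A\<^sub>\<plusminus>\<close>, the continuation of \<open>A\<close> is \<open>w \<mapsto> (1 + (w - s) A\<^sub>\<plusminus>)\<^sup>-\<^sup>1 A\<^sub>\<plusminus>\<close>, and its residue \<open>P\<^sub>\<plusminus>\<close> at \<open>r\<close> is
  the projection onto the root space \<open>\<Upsilon>\<^sub>\<plusminus>\<close> of \<open>1 + (r - s) A\<^sub>\<plusminus>\<close> along the complementary range.  Since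
  \<open>T\<^sub>-\<close> is the adjoint of \<open>T\<^sub>+\<close>, \<open>J P\<^sub>-\<close> is the adjoint of \<open>P\<^sub>+\<close> followed by \<open>J\<close>.  If \<open>u\<close> lies in \<open>\<Upsilon>\<^sub>-\<close> and
  \<open>P\<^sub>+ u = 0\<close>, then \<open>\<langle>J u, T\<^sub>- J u\<rangle> = \<langle>P\<^sub>+ u, J A\<^sub>- u\<rangle> = 0\<close>; as the imaginary part of \<open>T\<^sub>+\<close> is nonnegative,
  this forces \<open>A\<^sub>+ u = A\<^sub>- u\<close>.  Hence \<open>\<Upsilon>\<^sub>- \<inter> ker P\<^sub>+\<close> is invariant under \<open>A\<^sub>- = A\<^sub>+\<close>, so it lies in
  \<open>\<Upsilon>\<^sub>+\<close> and vanishes.  Thus \<open>P\<^sub>+\<close> and, by symmetry, \<open>P\<^sub>-\<close> are injective, and bijectivity follows by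
  compactness.\<close>

section \<open>Riesz theory of compact operators\<close>

text \<open>The form \<open>cinner x (J y)\<close> intertwines the two projections, but
  \<open>J\<close> may be indefinite or have a kernel, so orthogonality to a root space in this form
  does not force a vector to vanish. The sign of the imaginary part supplies the missing
  information. The residue is defined through an arbitrary meromorphic continuation, prescribed only
  at non-resonant reals. To identify it, these reals must accumulate somewhere. They form an open
  set, because a norm limit that exists at \<open>s\<close> persists for nearby couplings. The
  identity theorem then gives agreement with the pencil resolvent on punctured neighbourhoods, which
  is enough for small circles. The operator type contains merely real linear maps, and Riesz theory
  is carried out over the reals. Complex linearity of the projections is recovered afterwards, since
  they commute with every additive map that commutes with the operator. Non-resonance includes both
  boundary limits, so a single reference point \<open>s\<close> serves both sides.\<close>

lemma quadratic_nonneg_imp_zero: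
  fixes b c :: real
  assumes "\<And>t. 0 \<le> t * b + t\<^sup>2 * c"
  shows "b = 0"
proof (rule ccontr)
  assume b: "b \<noteq> 0"
  \<comment> \<open>Any \<open>k > 0\<close> above \<open>c\<close> serves: at
    \<open>t = - b / k\<close> the quadratic takes the negative value
    \<open>(b / k)\<^sup>2 * (c - k)\<close>.\<close>
  define k where "k = \<bar>c\<bar> + 1"
  have k: "k > 0" "c < k" by (auto simp: k_def)
  have "0 \<le> (- b / k) * b + (- b / k)\<^sup>2 * c" by (rule assms)
  also have "\<dots> = (b\<^sup>2 / k\<^sup>2) * (c - k)"
    using k by (simp add: power2_eq_square field_simps)
  also have "\<dots> < 0"
    using k b by (intro mult_pos_neg) auto
  finally show False by simp
qed

section \<open>Orthogonal projection onto closed subspaces\<close>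

lemma closed_subspace_projection:
  fixes M :: "'a::{real_inner,complete_space} set"
  assumes "closed M" "subspace M"
  obtains p where "p \<in> M" "\<And>y. y \<in> M \<Longrightarrow> inner (x - p) y = 0"
proof -
  define Q where "Q = (\<lambda>y. (norm (x - y))\<^sup>2) ` M"
  define d where "d = Inf Q"
  have Qne: "Q \<noteq> {}" using subspace_0[OF assms(2)] by (auto simp: Q_def)
  have Qbdd: "bdd_below Q" by (auto simp: Q_def intro!: bdd_belowI[of _ 0])
  have lower: "d \<le> (norm (x - y))\<^sup>2" if "y \<in> M" for y
    unfolding d_def by (rule cInf_lower) (use that Qbdd in \<open>auto simp: Q_def\<close>)
  have "\<exists>y\<in>M. (norm (x - y))\<^sup>2 < d + 1 / real (Suc n)" for n
  proof -
    have "d < d + 1 / real (Suc n)" by simp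
    then show ?thesis
      using cInf_lessD[OF Qne] unfolding d_def by (auto simp: Q_def)
  qed
  then obtain p where p: "\<And>n. p n \<in> M" "\<And>n. (norm (x - p n))\<^sup>2 < d + 1 / real (Suc n)"
    by metis
  have par: "(norm (p m - p n))\<^sup>2 \<le> 2 / real (Suc m) + 2 / real (Suc n)" for m n
  proof -
    \<comment> \<open>The midpoint of two nearly optimal points is again in \<open>M\<close>, so its
      squared distance is at least \<open>d\<close>; the parallelogram law turns this into a Cauchy
      estimate.\<close>
    have mid: "(1/2) *\<^sub>R (p m + p n) \<in> M"
      using p(1) assms(2) by (meson subspace_add subspace_scale)
    have "(norm (p m - p n))\<^sup>2 = 2 * (norm (x - p m))\<^sup>2 + 2 * (norm (x - p n))\<^sup>2
        - 4 * (norm (x - (1/2) *\<^sub>R (p m + p n)))\<^sup>2"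
      by (simp add: power2_norm_eq_inner algebra_simps inner_commute)
    moreover have "2 / real (Suc k) = 2 * (1 / real (Suc k))" for k by simp
    ultimately show ?thesis using p(2)[of m] p(2)[of n] lower[OF mid] by linarith
  qed
  have "Cauchy p"
  proof (rule metric_CauchyI)
    fix e :: real assume "0 < e"
    then obtain N where N: "4 / e\<^sup>2 < real N" using reals_Archimedean2 by blast
    have "dist (p m) (p n) < e" if "m \<ge> N" "n \<ge> N" for m n
    proof -
      have "2 / real (Suc k) < e\<^sup>2 / 2" if "k \<ge> N" for k
      proof -
        have "4 / e\<^sup>2 < real (Suc k)" using N that by linarith
        then show ?thesis using \<open>0 < e\<close> by (simp add: field_simps)
      qed
      then have "(norm (p m - p n))\<^sup>2 < e\<^sup>2"
        using par[of m n] that by (smt (verit) field_sum_of_halves)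
      then show ?thesis using \<open>0 < e\<close> by (simp add: dist_norm power2_less_imp_less)
    qed
    then show "\<exists>N. \<forall>m\<ge>N. \<forall>n\<ge>N. dist (p m) (p n) < e" by blast
  qed
  then obtain q where q: "p \<longlonglongrightarrow> q" using Cauchy_convergent_iff convergent_def by blast
  have qM: "q \<in> M" using closed_sequentially[OF assms(1)] p(1) q by blast
  have "(norm (x - q))\<^sup>2 \<le> d"
  proof (rule tendsto_le)
    show "(\<lambda>n. (norm (x - p n))\<^sup>2) \<longlonglongrightarrow> (norm (x - q))\<^sup>2" using q by (intro tendsto_intros)
    show "(\<lambda>n. d + 1 / real (Suc n)) \<longlonglongrightarrow> d"
      using tendsto_add[OF tendsto_const[of d] LIMSEQ_inverse_real_of_nat] by (simp add: divide_inverse)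
    show "\<forall>\<^sub>F n in sequentially. (norm (x - p n))\<^sup>2 \<le> d + 1 / real (Suc n)"
      using p(2) by (auto intro!: always_eventually less_imp_le)
  qed simp
  have "inner (x - q) y = 0" if y: "y \<in> M" for y
  proof -
    \<comment> \<open>Minimality of \<open>q\<close> along the line
      \<open>q + t *\<^sub>R y\<close>; orthogonality is the vanishing of the linear
      coefficient.\<close>
    have "0 \<le> t * (- 2 * inner (x - q) y) + t\<^sup>2 * (norm y)\<^sup>2" for t
    proof -
      have "q + t *\<^sub>R y \<in> M" using qM y assms(2) by (meson subspace_add subspace_scale)
      from lower[OF this] \<open>(norm (x - q))\<^sup>2 \<le> d\<close>
      have "(norm (x - q))\<^sup>2 \<le> (norm (x - q - t *\<^sub>R y))\<^sup>2"
        unfolding diff_diff_eq by (rule order.trans[rotated])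
      then show ?thesis
        unfolding power2_norm_eq_inner
        by (simp add: algebra_simps inner_commute power2_eq_square)
    qed
    from quadratic_nonneg_imp_zero[OF this] show ?thesis by simp
  qed
  with qM that show ?thesis by blast
qed

lemma closed_subspace_eq_UNIV:
  fixes M :: "'a::{real_inner,complete_space} set"
  assumes "closed M" "subspace M" "\<And>x. (\<And>y. y \<in> M \<Longrightarrow> inner x y = 0) \<Longrightarrow> x = 0"
  shows "M = UNIV"
proof -
  have "x \<in> M" for x
  proof -
    obtain p where "p \<in> M" "\<And>y. y \<in> M \<Longrightarrow> inner (x - p) y = 0"
      using closed_subspace_projection[OF assms(1,2)] by blast
    with assms(3)[of "x - p"] show ?thesis by simp
  qed
  then show ?thesis by auto
qed

text \<open>Riesz's lemma in its Hilbert space form: orthogonality gives the constant 1 itself, so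
  the sequences of the ascent and descent arguments are exactly 1-separated.\<close>

lemma exists_unit_orthogonal:
  fixes M N :: "'a::{real_inner,complete_space} set"
  assumes "closed M" "subspace M" "subspace N" "M \<subset> N"
  obtains x where "x \<in> N" "norm x = 1" "\<And>y. y \<in> M \<Longrightarrow> 1 \<le> norm (x - y)"
proof -
  from assms(4) obtain v where v: "v \<in> N" "v \<notin> M" by blast
  obtain p where p: "p \<in> M" "\<And>y. y \<in> M \<Longrightarrow> inner (v - p) y = 0"
    using closed_subspace_projection[OF assms(1,2)] by blast
  define x where "x = (1 / norm (v - p)) *\<^sub>R (v - p)"
  have ne: "v - p \<noteq> 0" using v p by auto
  have xN: "x \<in> N" unfolding x_def
    using v p assms(3,4) by (meson subspace_scale subspace_diff psubsetD)
  have n1: "norm x = 1" using ne by (simp add: x_def)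
  have "1 \<le> norm (x - y)" if "y \<in> M" for y
  proof -
    have o: "inner x y = 0" using p(2)[OF that] by (simp add: x_def)
    have "(norm (x - y))\<^sup>2 = 1 + (norm y)\<^sup>2"
      using n1 o unfolding power2_norm_eq_inner
      by (simp add: algebra_simps inner_commute norm_eq_1)
    then have "1\<^sup>2 \<le> (norm (x - y))\<^sup>2" by simp
    then show ?thesis by (rule power2_le_imp_le) simp
  qed
  with xN n1 that show ?thesis by blast
qed

section \<open>Compact operators over the reals\<close>

definition compact_blinfun :: "('a::real_normed_vector \<Rightarrow>\<^sub>L 'b::real_normed_vector) \<Rightarrow> bool" where
  "compact_blinfun C \<longleftrightarrow> compact (closure (blinfun_apply C ` cball 0 1))"

lemma compact_blinfun_subseq:
  fixes C :: "'a::real_normed_vector \<Rightarrow>\<^sub>L 'b::real_normed_vector"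
  assumes "compact_blinfun C" "\<And>n. norm (x n) \<le> b"
  obtains l r where "strict_mono (r :: nat \<Rightarrow> nat)" "(\<lambda>n. C (x (r n))) \<longlonglongrightarrow> l"
proof -
  \<comment> \<open>The maximum with 1 keeps the rescaling into the unit ball meaningful when
    \<open>b = 0\<close>.\<close>
  define m where "m = max b 1"
  have m: "m > 0" "b \<le> m" by (auto simp: m_def)
  have "C ((1/m) *\<^sub>R x n) \<in> closure (blinfun_apply C ` cball 0 1)" for n
  proof (rule subsetD[OF closure_subset], rule imageI)
    have "norm (x n) \<le> m" using assms(2)[of n] m by linarith
    then show "(1/m) *\<^sub>R x n \<in> cball 0 1" using m by (simp add: field_simps)
  qed
  then obtain l r where "strict_mono (r :: nat \<Rightarrow> nat)"
    "((\<lambda>n. C ((1/m) *\<^sub>R x n)) \<circ> r) \<longlonglongrightarrow> l"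
    using assms(1) unfolding compact_blinfun_def compact_def by metis
  moreover from this(2) have "(\<lambda>n. m *\<^sub>R C ((1/m) *\<^sub>R x (r n))) \<longlonglongrightarrow> m *\<^sub>R l"
    by (intro tendsto_intros) (simp add: o_def)
  ultimately show ?thesis using that m by (simp add: blinfun.scaleR_right)
qed


text \<open>A sequence in the closure can be replaced by one in \<open>S\<close> at distances below
  \<open>1 / (n + 1)\<close>, which does not affect limits of subsequences.\<close>

lemma compact_closureI_seq:
  fixes S :: "'a::real_normed_vector set"
  assumes "\<And>x. (\<And>n. x n \<in> S) \<Longrightarrow> \<exists>l r. strict_mono (r :: nat \<Rightarrow> nat) \<and> (\<lambda>n. x (r n)) \<longlonglongrightarrow> l"
  shows "compact (closure S)"
  unfolding compact_def
proof (intro allI impI)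
  fix y :: "nat \<Rightarrow> 'a" assume y: "\<forall>n. y n \<in> closure S"
  have "\<exists>x\<in>S. dist x (y n) < 1 / real (Suc n)" for n
    using y closure_approachable[of "y n" S] by simp
  then obtain x where x: "\<And>n. x n \<in> S" "\<And>n. dist (x n) (y n) < 1 / real (Suc n)"
    by metis
  obtain l r where r: "strict_mono (r :: nat \<Rightarrow> nat)" "(\<lambda>n. x (r n)) \<longlonglongrightarrow> l"
    using assms[of x, OF x(1)] by blast
  have "(\<lambda>n. x n - y n) \<longlonglongrightarrow> 0"
  proof (rule Lim_null_comparison)
    show "(\<lambda>n. 1 / real (Suc n)) \<longlonglongrightarrow> 0"
      using LIMSEQ_inverse_real_of_nat by (simp add: divide_inverse)
  qed (use x(2) in \<open>auto intro!: always_eventually less_imp_le simp: dist_norm\<close>)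
  from LIMSEQ_subseq_LIMSEQ[OF this r(1)] have "(\<lambda>n. x (r n) - y (r n)) \<longlonglongrightarrow> 0"
    by (simp add: o_def)
  from tendsto_diff[OF r(2) this] have "(\<lambda>n. y (r n)) \<longlonglongrightarrow> l" by simp
  moreover have "l \<in> closure S"
    using closed_sequentially[of "closure S" "\<lambda>n. y (r n)" l] y calculation by simp
  ultimately show "\<exists>l\<in>closure S. \<exists>r. strict_mono r \<and> (y \<circ> r) \<longlonglongrightarrow> l"
    using r(1) by (auto simp: o_def)
qed

lemma compact_blinfunI:
  fixes C :: "'a::real_normed_vector \<Rightarrow>\<^sub>L 'b::real_normed_vector"
  assumes "\<And>x. (\<And>n. norm (x n) \<le> 1) \<Longrightarrow>
    \<exists>l r. strict_mono (r :: nat \<Rightarrow> nat) \<and> (\<lambda>n. C (x (r n))) \<longlonglongrightarrow> l"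
  shows "compact_blinfun C"
  unfolding compact_blinfun_def
proof (rule compact_closureI_seq)
  fix y assume "\<And>n::nat. y n \<in> blinfun_apply C ` cball 0 1"
  then have "\<forall>n. \<exists>v. norm v \<le> 1 \<and> y n = C v"
    by (fastforce simp: image_iff)
  from choice[OF this] obtain x where x: "\<And>n. norm (x n) \<le> 1" "\<And>n. y n = C (x n)" by blast
  from assms[of x, OF x(1)] show "\<exists>l r. strict_mono (r :: nat \<Rightarrow> nat) \<and> (\<lambda>n. y (r n)) \<longlonglongrightarrow> l"
    by (simp only: x(2))
qed

lemma compact_blinfun_compose_left:
  fixes B :: "'b::real_normed_vector \<Rightarrow>\<^sub>L 'c::real_normed_vector"
  assumes "compact_blinfun C"
  shows "compact_blinfun (B o\<^sub>L C)"
proof (rule compact_blinfunI)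
  fix x :: "nat \<Rightarrow> 'a" assume x: "\<And>n. norm (x n) \<le> 1"
  obtain l r where "strict_mono (r :: nat \<Rightarrow> nat)" "(\<lambda>n. C (x (r n))) \<longlonglongrightarrow> l"
    by (rule compact_blinfun_subseq[OF assms x])
  moreover from this(2) have "(\<lambda>n. B (C (x (r n)))) \<longlonglongrightarrow> B l" by (intro tendsto_intros)
  ultimately show "\<exists>l r. strict_mono (r :: nat \<Rightarrow> nat) \<and> (\<lambda>n. (B o\<^sub>L C) (x (r n))) \<longlonglongrightarrow> l"
    unfolding blinfun_apply_blinfun_compose by (intro exI[of _ "B l"] exI[of _ r] conjI)
qed

lemma compact_blinfun_compose_right:
  fixes B :: "'a::real_normed_vector \<Rightarrow>\<^sub>L 'b::real_normed_vector"
  assumes "compact_blinfun C"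
  shows "compact_blinfun (C o\<^sub>L B)"
proof (rule compact_blinfunI)
  fix x :: "nat \<Rightarrow> 'a" assume x: "\<And>n. norm (x n) \<le> 1"
  have "norm (B (x n)) \<le> norm B" for n
    using norm_blinfun[of B "x n"] mult_left_mono[OF x[of n], of "norm B"] by simp
  then obtain l r where "strict_mono (r :: nat \<Rightarrow> nat)" "(\<lambda>n. C (B (x (r n)))) \<longlonglongrightarrow> l"
    by (rule compact_blinfun_subseq[OF assms, of "\<lambda>n. B (x n)" "norm B"])
  then show "\<exists>l r. strict_mono (r :: nat \<Rightarrow> nat) \<and> (\<lambda>n. (C o\<^sub>L B) (x (r n))) \<longlonglongrightarrow> l"
    unfolding blinfun_apply_blinfun_compose by (intro exI[of _ l] exI[of _ r] conjI)
qed

lemma compact_blinfun_diff: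
  fixes B C :: "'a::real_normed_vector \<Rightarrow>\<^sub>L 'b::real_normed_vector"
  assumes "compact_blinfun B" "compact_blinfun C"
  shows "compact_blinfun (B - C)"
proof (rule compact_blinfunI)
  fix x :: "nat \<Rightarrow> 'a" assume x: "\<And>n. norm (x n) \<le> 1"
  obtain l r where r: "strict_mono (r :: nat \<Rightarrow> nat)" "(\<lambda>n. B (x (r n))) \<longlonglongrightarrow> l"
    by (rule compact_blinfun_subseq[OF assms(1) x])
  obtain l' r' where r': "strict_mono (r' :: nat \<Rightarrow> nat)" "(\<lambda>n. C (x (r (r' n)))) \<longlonglongrightarrow> l'"
    by (rule compact_blinfun_subseq[OF assms(2), of "\<lambda>n. x (r n)", OF x])
  have "(\<lambda>n. B (x (r (r' n)))) \<longlonglongrightarrow> l" using LIMSEQ_subseq_LIMSEQ[OF r(2) r'(1)] by (simp add: o_def)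
  from tendsto_diff[OF this r'(2)] have "(\<lambda>n. (B - C) (x ((r \<circ> r') n))) \<longlonglongrightarrow> l - l'"
    by (simp add: blinfun.diff_left)
  moreover have "strict_mono (r \<circ> r')" using r(1) r'(1) by (rule strict_mono_o)
  ultimately show "\<exists>l r. strict_mono (r :: nat \<Rightarrow> nat) \<and> (\<lambda>n. (B - C) (x (r n))) \<longlonglongrightarrow> l"
    by (intro exI[of _ "l - l'"] exI[of _ "r \<circ> r'"] conjI)
qed

lemma compact_blinfun_add:
  fixes B C :: "'a::real_normed_vector \<Rightarrow>\<^sub>L 'b::real_normed_vector"
  assumes "compact_blinfun B" "compact_blinfun C"
  shows "compact_blinfun (B + C)"
proof -
  have "compact_blinfun (C - C)" using assms(2) assms(2) by (rule compact_blinfun_diff)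
  from compact_blinfun_diff[OF this assms(2)] have "compact_blinfun (- C)" by simp
  from compact_blinfun_diff[OF assms(1) this] show ?thesis by simp
qed

text \<open>The boundary values of the sandwiched resolvent are norm limits of compact operators,
  and this makes them compact. A finite net for a nearby compact \<open>B\<close> is also a net,
  with larger radius, for \<open>C\<close>.\<close>

lemma compact_blinfun_limit:
  fixes C :: "'a::real_normed_vector \<Rightarrow>\<^sub>L 'b::banach"
  assumes "\<And>e. e > 0 \<Longrightarrow> \<exists>B. compact_blinfun B \<and> norm (B - C) < e"
  shows "compact_blinfun C"
  unfolding compact_blinfun_def compact_eq_totally_bounded
proof (intro conjI allI impI)
  show "complete (closure (blinfun_apply C ` cball 0 1))"
    unfolding complete_eq_closed by (rule closed_closure)
  fix e :: real assume e: "e > 0"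
  obtain B where B: "compact_blinfun B" "norm (B - C) < e / 4"
    using assms[OF divide_pos_pos[OF e, of 4]] by (auto simp only: zero_less_numeral)
  have "\<exists>k. finite k \<and> closure (blinfun_apply B ` cball 0 1) \<subseteq> (\<Union>x\<in>k. ball x (e / 4))"
    using conjunct2[OF iffD1[OF compact_eq_totally_bounded B(1)[unfolded compact_blinfun_def]],
        rule_format, OF divide_pos_pos[OF e, of 4]] by (simp only: zero_less_numeral)
  then obtain k where k: "finite k"
    "closure (blinfun_apply B ` cball 0 1) \<subseteq> (\<Union>x\<in>k. ball x (e / 4))"
    by (elim exE conjE)
  \<comment> \<open>A net of radius \<open>e / 4\<close> and an error \<open>e / 4\<close> add up to
    \<open>e / 2\<close>. Closed balls are used because their finite union is closed and so also
    covers the closure; they lie in open balls of radius \<open>e\<close>.\<close>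
  have "blinfun_apply C ` cball 0 1 \<subseteq> (\<Union>x\<in>k. cball x (e / 2))"
  proof clarify
    fix x :: 'a assume x: "x \<in> cball 0 1"
    have "B x \<in> (\<Union>x\<in>k. ball x (e / 4))" by (rule subsetD[OF k(2) subsetD[OF closure_subset imageI[OF x]]])
    then obtain y where y: "y \<in> k" "dist y (B x) < e / 4" by auto
    have "norm ((B - C) x) \<le> norm (B - C)"
      using norm_blinfun[of "B - C" x] x mult_left_mono[of "norm x" 1 "norm (B - C)"] by simp
    then have "dist (B x) (C x) < e / 4"
      using B(2) by (simp add: dist_norm blinfun.diff_left)
    with y have "dist y (C x) \<le> e / 2"
      using dist_triangle[of y "C x" "B x"] by linarith
    with y(1) show "C x \<in> (\<Union>x\<in>k. cball x (e / 2))" by auto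
  qed
  then have "closure (blinfun_apply C ` cball 0 1) \<subseteq> (\<Union>x\<in>k. cball x (e / 2))"
    by (rule closure_minimal) (simp add: k(1) closed_UN)
  also have "\<dots> \<subseteq> (\<Union>x\<in>k. ball x e)" using e by (intro UN_mono) auto
  finally show "\<exists>k. finite k \<and> closure (blinfun_apply C ` cball 0 1) \<subseteq> (\<Union>x\<in>k. ball x e)"
    using k(1) by (intro exI[of _ k] conjI)
qed

section \<open>Powers of 1 minus a compact operator, ascent and descent\<close>

primrec blinfun_pow :: "('a::real_normed_vector \<Rightarrow>\<^sub>L 'a) \<Rightarrow> nat \<Rightarrow> ('a \<Rightarrow>\<^sub>L 'a)" where
  "blinfun_pow T 0 = id_blinfun"
| "blinfun_pow T (Suc k) = T o\<^sub>L blinfun_pow T k"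

lemma blinfun_pow_add: "blinfun_pow T (j + k) x = blinfun_pow T j (blinfun_pow T k x)"
  by (induction j) auto

lemma blinfun_pow_commute:
  fixes S :: "'a::real_normed_vector \<Rightarrow> 'a" and T :: "'a \<Rightarrow>\<^sub>L 'a"
  assumes "\<And>x. S (T x) = T (S x)"
  shows "S (blinfun_pow T k x) = blinfun_pow T k (S x)"
  by (induction k) (auto simp: assms)

lemma blinfun_pow_Suc_right: "blinfun_pow T (Suc k) x = blinfun_pow T k (T x)"
  using blinfun_pow_add[of T k 1 x] by simp

lemma funpow_blinfun: "(blinfun_apply T ^^ k) x = blinfun_pow T k x"
  by (induction k) auto

text \<open>From \<open>(1 - C) (1 - D) = 1 - (C + D - C D)\<close>: the powers stay of the form 1
  minus compact, so the estimates below apply to them as well.\<close>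

lemma blinfun_pow_one_minus_compact:
  fixes C :: "'a::real_normed_vector \<Rightarrow>\<^sub>L 'a"
  assumes "compact_blinfun C"
  shows "\<exists>D. compact_blinfun D \<and> blinfun_pow (id_blinfun - C) k = id_blinfun - D"
proof (induction k)
  case 0
  have "compact_blinfun (C - C)" using assms assms by (rule compact_blinfun_diff)
  then show ?case by (intro exI[of _ "C - C"]) simp
next
  case (Suc k)
  then obtain D where D: "compact_blinfun D" "blinfun_pow (id_blinfun - C) k = id_blinfun - D"
    by (elim exE conjE)
  have "blinfun_pow (id_blinfun - C) (Suc k) = id_blinfun - (C + D - (C o\<^sub>L D))"
    by (rule blinfun_eqI) (simp add: D(2) blinfun.diff_left blinfun.add_left blinfun.diff_right)
  moreover have "compact_blinfun (C + D - (C o\<^sub>L D))"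
    by (intro compact_blinfun_diff compact_blinfun_add compact_blinfun_compose_right assms D(1))
  ultimately show ?case by (intro exI conjI)
qed

text \<open>Otherwise there are unit vectors \<open>x n\<close> in \<open>M\<close> with
  \<open>x n - C (x n)\<close> tending to 0. Along a subsequence \<open>C (x n)\<close> converges,
  hence so does \<open>x n\<close>, and the limit is a unit vector of \<open>M\<close> annihilated
  by \<open>1 - C\<close>.\<close>

lemma compact_bounded_below:
  fixes C :: "'a::real_normed_vector \<Rightarrow>\<^sub>L 'a"
  assumes C: "compact_blinfun C" and M: "closed M" "subspace M"
    and inj: "\<And>x. x \<in> M \<Longrightarrow> x - C x = 0 \<Longrightarrow> x = 0"
  obtains c where "c > 0" "\<And>x. x \<in> M \<Longrightarrow> c * norm x \<le> norm (x - C x)"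
proof -
  have "\<exists>c>0. \<forall>x\<in>M. c * norm x \<le> norm (x - C x)"
  proof (rule ccontr)
    assume neg: "\<not> ?thesis"
    have "\<exists>x. x \<in> M \<and> norm x = 1 \<and> norm (x - C x) \<le> 1 / real (Suc n)" for n
    proof -
      have "\<not> (\<forall>x\<in>M. 1 / real (Suc n) * norm x \<le> norm (x - C x))"
        using neg by (metis of_nat_0_less_iff zero_less_Suc zero_less_divide_1_iff)
      then obtain v where v: "v \<in> M" "norm (v - C v) < 1 / real (Suc n) * norm v"
        by (auto simp: not_le)
      then have nz: "norm v > 0" by (cases "v = 0") auto
      let ?x = "(1 / norm v) *\<^sub>R v"
      have "?x - C ?x = (1 / norm v) *\<^sub>R (v - C v)"
        by (simp add: blinfun.scaleR_right scaleR_diff_right)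
      then have "norm (?x - C ?x) = norm (v - C v) / norm v" using nz by simp
      also have "\<dots> \<le> 1 / real (Suc n)"
        using v(2) nz by (simp add: pos_divide_le_eq)
      finally have "norm (?x - C ?x) \<le> 1 / real (Suc n)" .
      moreover have "?x \<in> M" by (rule subspace_scale[OF M(2) v(1)])
      moreover have "norm ?x = 1" using nz by simp
      ultimately show ?thesis by (intro exI[of _ ?x] conjI)
    qed
    then obtain x where x: "\<And>n. x n \<in> M" "\<And>n. norm (x n) = 1"
      "\<And>n. norm (x n - C (x n)) \<le> 1 / real (Suc n)" by metis
    have x1: "norm (x n) \<le> 1" for n by (simp add: x(2))
    obtain l r where r: "strict_mono (r :: nat \<Rightarrow> nat)" "(\<lambda>n. C (x (r n))) \<longlonglongrightarrow> l"
      by (rule compact_blinfun_subseq[OF C x1])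
    have "(\<lambda>n. x n - C (x n)) \<longlonglongrightarrow> 0"
    proof (rule Lim_null_comparison)
      show "(\<lambda>n. 1 / real (Suc n)) \<longlonglongrightarrow> 0"
        using LIMSEQ_inverse_real_of_nat by (simp add: divide_inverse)
    qed (use x(3) in \<open>simp add: always_eventually\<close>)
    from LIMSEQ_subseq_LIMSEQ[OF this r(1)]
    have d: "(\<lambda>n. x (r n) - C (x (r n))) \<longlonglongrightarrow> 0" by (simp add: o_def)
    from tendsto_add[OF this r(2)] have xl: "(\<lambda>n. x (r n)) \<longlonglongrightarrow> l" by simp
    have lM: "l \<in> M" by (rule closed_sequentially[OF M(1) _ xl]) (rule x(1))
    have "(\<lambda>n. x (r n) - C (x (r n))) \<longlonglongrightarrow> l - C l" by (intro tendsto_intros xl)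
    from LIMSEQ_unique[OF this d] have "l - C l = 0" .
    with inj lM have "l = 0" by blast
    moreover have "norm l = 1"
      using LIMSEQ_unique[OF tendsto_norm[OF xl], of 1] by (simp add: x(2))
    ultimately show False by simp
  qed
  with that show ?thesis by blast
qed

text \<open>The kernel contributes nothing to the range, so the range is the image of its orthogonal
  complement \<open>M\<close>. There the operator is bounded below, hence the image is
  complete.\<close>

lemma closed_range_one_minus_compact:
  fixes C :: "'a::{real_inner,banach} \<Rightarrow>\<^sub>L 'a"
  assumes C: "compact_blinfun C"
  shows "closed (range (\<lambda>x. x - C x))"
proof -
  define N where "N = {x. x - C x = 0}"
  define M where "M = {x. \<forall>y\<in>N. inner x y = 0}"
  have N: "subspace N" "closed N"
    unfolding N_def by (auto simp: subspace_def blinfun.add_right blinfun.scaleR_right blinfun.zero_right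
        scaleR_diff_right[symmetric] intro!: closed_Collect_eq continuous_intros)
  have "M = (\<Inter>y\<in>N. {x. inner x y = 0})" by (auto simp: M_def)
  then have M: "subspace M" "closed M"
    by (auto simp: subspace_def inner_add_left intro!: closed_INT closed_Collect_eq continuous_intros)
  have "x = 0" if "x \<in> M" "x - C x = 0" for x
    using that by (auto simp: M_def N_def)
  then obtain c where c: "c > 0" "\<And>x. x \<in> M \<Longrightarrow> c * norm x \<le> norm (x - C x)"
    using compact_bounded_below[OF C M(2,1)] by blast
  have "range (\<lambda>x. x - C x) \<subseteq> (\<lambda>x. x - C x) ` M"
  proof (rule image_subsetI)
    fix x
    obtain p where p: "p \<in> N" "\<And>y. y \<in> N \<Longrightarrow> inner (x - p) y = 0"
      using closed_subspace_projection[OF N(2,1)] by blast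
    have "x - C x = (x - p) - C (x - p)" using p(1) by (simp add: N_def blinfun.diff_right)
    moreover have "x - p \<in> M" using p(2) by (simp add: M_def)
    ultimately show "x - C x \<in> (\<lambda>x. x - C x) ` M" by blast
  qed
  then have "range (\<lambda>x. x - C x) = (\<lambda>x. x - C x) ` M" by blast
  moreover have "complete ((\<lambda>x. x - C x) ` M)"
  proof (rule complete_isometric_image[OF c(1) M(1)])
    show "bounded_linear (\<lambda>x. x - C x)"
      by (intro bounded_linear_sub bounded_linear_ident blinfun.bounded_linear_right)
  qed (use c(2) M(2) in \<open>auto simp: complete_eq_closed mult.commute\<close>)
  ultimately show ?thesis by (simp only: complete_eq_closed)
qed

lemma compact_no_separated_sequence:
  fixes C :: "'a::real_normed_vector \<Rightarrow>\<^sub>L 'b::real_normed_vector" and x :: "nat \<Rightarrow> 'a"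
  assumes "compact_blinfun C" "\<And>n. norm (x n) \<le> 1"
    "\<And>j k. j < k \<Longrightarrow> 1 \<le> norm (C (x k) - C (x j))"
  shows False
proof -
  obtain l r where r: "strict_mono (r :: nat \<Rightarrow> nat)" "(\<lambda>n. C (x (r n))) \<longlonglongrightarrow> l"
    by (rule compact_blinfun_subseq[OF assms(1,2)])
  from LIMSEQ_imp_Cauchy[OF r(2)] obtain N
    where N: "\<And>m n. m \<ge> N \<Longrightarrow> n \<ge> N \<Longrightarrow> norm (C (x (r m)) - C (x (r n))) < 1"
    using CauchyD zero_less_one by metis
  have "r N < r (Suc N)" using r(1) by (simp add: strict_mono_def)
  with assms(3) N[of "Suc N" N] show False by fastforce
qed

lemma closed_subspace_ker_blinfun:
  "subspace {x. blinfun_apply A x = 0}" "closed {x. blinfun_apply A x = 0}"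
  by (auto simp: subspace_def blinfun.add_right blinfun.scaleR_right blinfun.zero_right
      intro!: closed_Collect_eq continuous_intros)

lemma subspace_range_blinfun: "subspace (range (blinfun_apply A))"
  by (rule linear_subspace_image[OF bounded_linear.linear[OF blinfun.bounded_linear_right] subspace_UNIV])

text \<open>If the kernels grew forever, unit vectors of \<open>N (Suc p)\<close> orthogonal to
  \<open>N p\<close> would have 1-separated images under \<open>C\<close>.\<close>

lemma ascent_one_minus_compact:
  fixes C :: "'a::{real_inner,banach} \<Rightarrow>\<^sub>L 'a"
  assumes C: "compact_blinfun C"
  defines "T \<equiv> id_blinfun - C"
  shows "\<exists>p. \<forall>k x. blinfun_pow T k x = 0 \<longrightarrow> blinfun_pow T p x = 0"
proof -
  define N where "N = (\<lambda>k. {x. blinfun_pow T k x = 0})"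
  have N: "subspace (N k)" "closed (N k)" for k
    unfolding N_def by (rule closed_subspace_ker_blinfun)+
  have mono: "N j \<subseteq> N k" if jk: "j \<le> k" for j k
  proof -
    obtain i where "k = i + j" using le_add_diff_inverse2[OF jk, symmetric] by blast
    then show ?thesis by (auto simp: N_def blinfun_pow_add blinfun.zero_right)
  qed
  have Tx: "T x = x - C x" for x by (simp add: T_def blinfun.diff_left)
  have "\<exists>p. N (Suc p) \<subseteq> N p"
  proof (rule ccontr)
    assume "\<not> ?thesis"
    then have strict: "N p \<subset> N (Suc p)" for p using mono[of p "Suc p"] by auto
    have "\<exists>x. x \<in> N (Suc p) \<and> norm x = 1 \<and> (\<forall>y\<in>N p. 1 \<le> norm (x - y))" for p
    proof -
      obtain x where "x \<in> N (Suc p)" "norm x = 1" "\<And>y. y \<in> N p \<Longrightarrow> 1 \<le> norm (x - y)"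
        by (rule exists_unit_orthogonal[OF N(2,1) N(1) strict[of p]]) blast
      then show ?thesis by blast
    qed
    then obtain x where x: "\<And>p. x p \<in> N (Suc p)" "\<And>p. norm (x p) = 1"
      "\<And>p y. y \<in> N p \<Longrightarrow> 1 \<le> norm (x p - y)" by metis
    have "1 \<le> norm (C (x k) - C (x j))" if "j < k" for j k
    proof -
      have "T (x i) \<in> N i" for i
        using x(1)[of i] unfolding N_def mem_Collect_eq blinfun_pow_Suc_right .
      moreover have "x j \<in> N k" using x(1)[of j] mono[of "Suc j" k] that by auto
      moreover have "T (x j) \<in> N k" using calculation(1)[of j] mono[of j k] that by auto
      \<comment> \<open>Since \<open>C = 1 - T\<close>, the difference
        \<open>C (x k) - C (x j)\<close> is \<open>x k\<close> minus this vector of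
        \<open>N k\<close>.\<close>
      ultimately have "T (x k) + x j - T (x j) \<in> N k"
        by (simp add: N_def blinfun.add_right blinfun.diff_right)
      from x(3)[OF this] show ?thesis by (simp add: Tx algebra_simps)
    qed
    with compact_no_separated_sequence[OF C, of x] x(2) show False by simp
  qed
  then obtain p where p: "N (Suc p) \<subseteq> N p" by blast
  \<comment> \<open>One stationary step makes the chain stationary: if \<open>x\<close> lies in
    \<open>N (Suc i + p)\<close>, then \<open>T^i x\<close> lies in \<open>N (Suc p)\<close>, hence
    in \<open>N p\<close>, and \<open>x\<close> lies in \<open>N (i + p)\<close>.\<close>
  have "N (i + p) \<subseteq> N p" for i
  proof (induction i)
    case (Suc i)
    have "x \<in> N p" if "x \<in> N (Suc i + p)" for x
    proof -
      have "blinfun_pow T (Suc i + p) x = blinfun_pow T (Suc p) (blinfun_pow T i x)"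
        by (metis add.commute add_Suc_shift blinfun_pow_add)
      then have "blinfun_pow T i x \<in> N (Suc p)" using that by (simp add: N_def)
      then have "blinfun_pow T i x \<in> N p" using p by blast
      then have "x \<in> N (i + p)" by (simp add: N_def add.commute[of i] blinfun_pow_add)
      then show ?thesis using Suc by blast
    qed
    then show ?case by blast
  qed simp
  then have "N k \<subseteq> N p" for k using mono[of k "k + p"] by (meson le_add1 order.trans)
  then have "\<forall>k x. blinfun_pow T k x = 0 \<longrightarrow> blinfun_pow T p x = 0" unfolding N_def by blast
  then show ?thesis ..
qed

text \<open>The ascent argument with ranges in place of kernels: strictly shrinking ranges would
  yield unit vectors of \<open>R p\<close> orthogonal to \<open>R (Suc p)\<close> with 1-separated
  images under \<open>C\<close>.\<close>

lemma descent_one_minus_compact: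
  fixes C :: "'a::{real_inner,banach} \<Rightarrow>\<^sub>L 'a"
  assumes C: "compact_blinfun C"
  defines "T \<equiv> id_blinfun - C"
  shows "\<exists>p. \<forall>k. range (blinfun_pow T p) \<subseteq> range (blinfun_pow T k)"
proof -
  define R where "R = (\<lambda>k. range (blinfun_pow T k))"
  have mono: "R k \<subseteq> R j" if jk: "j \<le> k" for j k
  proof -
    obtain i where "k = j + i" using le_add_diff_inverse[OF jk, symmetric] by blast
    then show ?thesis by (auto simp: R_def blinfun_pow_add)
  qed
  have step: "T x \<in> R (Suc k)" if "x \<in> R k" for x k
    using that by (auto simp: R_def)
  \<comment> \<open>Unlike kernels, ranges are not closed automatically; here it matters that a
    power of \<open>T\<close> is again 1 minus a compact operator.\<close>
  have closed: "closed (R k)" for k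
  proof -
    obtain D where D: "compact_blinfun D" "blinfun_pow T k = id_blinfun - D"
      using blinfun_pow_one_minus_compact[OF C] unfolding T_def by blast
    from closed_range_one_minus_compact[OF D(1)] show ?thesis
      by (simp add: R_def D(2) blinfun.diff_left)
  qed
  have sub: "subspace (R k)" for k unfolding R_def by (rule subspace_range_blinfun)
  have Tx: "T x = x - C x" for x by (simp add: T_def blinfun.diff_left)
  have "\<exists>p. R p \<subseteq> R (Suc p)"
  proof (rule ccontr)
    assume "\<not> ?thesis"
    then have strict: "R (Suc p) \<subset> R p" for p using mono[of p "Suc p"] by auto
    have "\<exists>x. x \<in> R p \<and> norm x = 1 \<and> (\<forall>y\<in>R (Suc p). 1 \<le> norm (x - y))" for p
    proof -
      obtain x where "x \<in> R p" "norm x = 1" "\<And>y. y \<in> R (Suc p) \<Longrightarrow> 1 \<le> norm (x - y)"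
        by (rule exists_unit_orthogonal[OF closed sub sub strict[of p]]) blast
      then show ?thesis by blast
    qed
    then obtain x where x: "\<And>p. x p \<in> R p" "\<And>p. norm (x p) = 1"
      "\<And>p y. y \<in> R (Suc p) \<Longrightarrow> 1 \<le> norm (x p - y)" by metis
    have "1 \<le> norm (C (x k) - C (x j))" if "j < k" for j k
    proof -
      have "T (x j) \<in> R (Suc j)" by (rule step[OF x(1)])
      moreover have k: "x k \<in> R (Suc j)" using x(1)[of k] mono[of "Suc j" k] that by auto
      moreover have "T (x k) \<in> R (Suc j)"
        using step[OF x(1)[of k]] mono[of "Suc j" "Suc k"] that by auto
      \<comment> \<open>Now the smaller index leads: \<open>C (x j) - C (x k)\<close> is
        \<open>x j\<close> minus this vector of \<open>R (Suc j)\<close>.\<close>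
      ultimately have "T (x j) + x k - T (x k) \<in> R (Suc j)"
        using sub by (meson subspace_add subspace_diff)
      from x(3)[OF this] show ?thesis by (simp add: Tx algebra_simps norm_minus_commute)
    qed
    with compact_no_separated_sequence[OF C, of x] x(2) show False by simp
  qed
  then obtain p where p: "R p \<subseteq> R (Suc p)" by blast
  have "R p \<subseteq> R (i + p)" for i
  proof (induction i)
    case (Suc i)
    have "x \<in> R (Suc i + p)" if xp: "x \<in> R p" for x
    proof -
      obtain y where "x = blinfun_pow T (Suc p) y" using p xp by (auto simp: R_def)
      then have "x = T (blinfun_pow T p y)" by simp
      moreover have "blinfun_pow T p y \<in> R (i + p)" using Suc by (auto simp: R_def)
      ultimately show ?thesis using step by simp
    qed
    then show ?case by blast
  qed simp
  then have "R p \<subseteq> R k" for k using mono[of k "k + p"] by (meson le_add1 order.trans)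
  then show ?thesis unfolding R_def by blast
qed

section \<open>The Riesz projection as an algebraic object\<close>

text \<open>The spectral idempotent of \<open>T\<close> at the eigenvalue 0, characterised by the
  splitting into root space and iterated range instead of a contour integral. Idempotence and
  commutation properties are consequences.\<close>

definition riesz_projection :: "('a::real_normed_vector \<Rightarrow>\<^sub>L 'a) \<Rightarrow> nat \<Rightarrow> ('a \<Rightarrow>\<^sub>L 'a) \<Rightarrow> bool" where
  "riesz_projection T p P \<longleftrightarrow>
     (\<forall>k x. blinfun_pow T k x = 0 \<longrightarrow> blinfun_pow T p x = 0) \<and>
     (\<forall>x. blinfun_pow T p (P x) = 0) \<and>
     (\<forall>k x. \<exists>y. x - P x = blinfun_pow T k y)"

context
  fixes T P :: "'a::real_normed_vector \<Rightarrow>\<^sub>L 'a" and p :: nat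
  assumes P: "riesz_projection T p P"
begin

lemma riesz_projection_kernel: "blinfun_pow T k x = 0 \<Longrightarrow> blinfun_pow T p x = 0"
  using P unfolding riesz_projection_def by metis

lemma riesz_projection_in_kernel: "blinfun_pow T p (P x) = 0"
  using P unfolding riesz_projection_def by simp

lemma riesz_projection_range: obtains y where "x - P x = blinfun_pow T k y"
  using P unfolding riesz_projection_def by metis

text \<open>The difference \<open>x - P x\<close> lies in both the kernel and the range of
  \<open>T^p\<close>. A vector \<open>T^p y\<close> killed by \<open>T^p\<close> has
  \<open>y\<close> in the kernel of \<open>T^(2p)\<close>, which is already the kernel of
  \<open>T^p\<close>.\<close>

lemma riesz_projection_fixes:
  assumes "blinfun_pow T k x = 0"
  shows "P x = x"
proof -
  have x: "blinfun_pow T p x = 0" using assms by (rule riesz_projection_kernel)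
  obtain y where y: "x - P x = blinfun_pow T p y" by (rule riesz_projection_range)
  have "blinfun_pow T (p + p) y = 0"
    by (simp add: blinfun_pow_add blinfun.diff_right x riesz_projection_in_kernel flip: y)
  from riesz_projection_kernel[OF this] y show ?thesis by simp
qed

lemma riesz_projection_idem: "P (P x) = P x"
  by (rule riesz_projection_fixes[OF riesz_projection_in_kernel])

lemma riesz_projection_range_eq: "range (blinfun_apply P) = (\<Union>k. {x. blinfun_pow T k x = 0})"
  using riesz_projection_in_kernel riesz_projection_fixes by (auto simp: image_iff) metis

text \<open>The projected vector is again of the form \<open>T^p (w - y)\<close> and killed by
  \<open>T^p\<close>, so the stabilised kernels force it to be 0.\<close>

lemma riesz_projection_annihilates: "P (blinfun_pow T p w) = 0"
proof -
  obtain y where y: "blinfun_pow T p w - P (blinfun_pow T p w) = blinfun_pow T p y"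
    by (rule riesz_projection_range)
  have eq: "P (blinfun_pow T p w) = blinfun_pow T p (w - y)"
    using y by (simp add: blinfun.diff_right algebra_simps)
  have "blinfun_pow T (p + p) (w - y) = 0"
    unfolding blinfun_pow_add by (simp add: riesz_projection_in_kernel flip: eq)
  from riesz_projection_kernel[OF this] eq show ?thesis by simp
qed

text \<open>Such an \<open>S\<close> preserves both the root space and the range of
  \<open>T^p\<close>. Only additivity is assumed, so that \<open>S\<close> may be multiplication by
  a complex scalar; this is how complex linearity of \<open>P\<close> is obtained.\<close>

lemma riesz_projection_commute:
  assumes comm: "\<And>x. S (T x) = T (S x)" and add: "\<And>x y. S (x + y) = S x + S y"
  shows "P (S x) = S (P x)"
proof -
  have S0: "S 0 = 0" using add[of 0 0] by simp
  obtain y where y: "x - P x = blinfun_pow T p y" by (rule riesz_projection_range)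
  have "blinfun_pow T p (S (P x)) = S (blinfun_pow T p (P x))"
    using blinfun_pow_commute[of S T, OF comm] by simp
  then have "P (S (P x)) = S (P x)"
    by (intro riesz_projection_fixes[of p]) (simp add: riesz_projection_in_kernel S0)
  moreover have "P (S (x - P x)) = 0"
    unfolding y blinfun_pow_commute[of S T, OF comm] by (rule riesz_projection_annihilates)
  ultimately show ?thesis using add[of "P x" "x - P x"] by (simp add: blinfun.add_right)
qed

end

text \<open>With \<open>U = T^p\<close> past ascent and descent, \<open>U\<close> maps its range
  \<open>R\<close> bijectively onto itself. The projection onto \<open>R\<close> sends
  \<open>x\<close> to the unique \<open>q x\<close> in \<open>R\<close> with
  \<open>U (q x) = U x\<close>, and \<open>P\<close> is its complement.\<close>

lemma riesz_projection_exists: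
  fixes C :: "'a::{real_inner,banach} \<Rightarrow>\<^sub>L 'a"
  assumes C: "compact_blinfun C"
  defines "T \<equiv> id_blinfun - C"
  obtains p P where "riesz_projection T p P" "compact_blinfun P"
proof -
  obtain p1 where p1: "\<And>k x. blinfun_pow T k x = 0 \<Longrightarrow> blinfun_pow T p1 x = 0"
    using ascent_one_minus_compact[OF C] unfolding T_def by metis
  obtain p2 where p2: "\<And>k. range (blinfun_pow T p2) \<subseteq> range (blinfun_pow T k)"
    using descent_one_minus_compact[OF C] unfolding T_def by metis
  \<comment> \<open>The sum is one exponent beyond which both kernels and ranges are
    stationary.\<close>
  define p where "p = p1 + p2"
  define U where "U = blinfun_pow T p"
  have ker: "blinfun_pow T p x = 0" if "blinfun_pow T k x = 0" for k x
    using p1[OF that] by (simp add: p_def add.commute[of p1] blinfun_pow_add blinfun.zero_right)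
  have ran: "\<exists>y. blinfun_pow T p x = blinfun_pow T k y" for k x
  proof -
    have "blinfun_pow T p x = blinfun_pow T p2 (blinfun_pow T p1 x)"
      by (simp add: p_def add.commute[of p1] blinfun_pow_add)
    then show ?thesis using p2[of k] by auto
  qed
  obtain D where D: "compact_blinfun D" "U = id_blinfun - D"
    using blinfun_pow_one_minus_compact[OF C] unfolding U_def T_def by blast
  have UD: "U x = x - D x" for x by (simp add: D(2) blinfun.diff_left)
  define R where "R = range (blinfun_apply U)"
  have R: "closed R" "subspace R"
    using closed_range_one_minus_compact[OF D(1)] subspace_range_blinfun[of U]
    by (simp_all add: R_def UD)
  have inj: "x = 0" if xR: "x \<in> R" and Ux: "U x = 0" for x
  proof -
    obtain y where y: "x = U y" using xR by (auto simp: R_def)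
    then have "blinfun_pow T (p + p) y = 0" using Ux by (simp add: U_def blinfun_pow_add)
    from ker[OF this] show ?thesis by (simp add: y U_def)
  qed
  obtain c where c: "c > 0" "\<And>x. x \<in> R \<Longrightarrow> c * norm x \<le> norm (U x)"
    using compact_bounded_below[OF D(1) R] inj unfolding UD by metis
  \<comment> \<open>The range of \<open>T^p\<close> is that of \<open>T^(2p)\<close>, so
    \<open>U x = U (U y)\<close> for some \<open>y\<close>, and \<open>U y\<close> is the required
    element of \<open>R\<close>.\<close>
  have ex: "\<exists>r\<in>R. U r = U x" for x
  proof -
    obtain y where "U x = blinfun_pow T (p + p) y" using ran[of x "p + p"] U_def by auto
    then have "U (U y) = U x" by (simp add: U_def blinfun_pow_add)
    then show ?thesis by (auto simp: R_def)
  qed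
  then obtain q where q: "\<And>x. q x \<in> R" "\<And>x. U (q x) = U x" by metis
  have uniq: "r = q x" if "r \<in> R" "U r = U x" for r x
    using inj[OF subspace_diff[OF R(2) that(1) q(1)[of x]]] that(2) q(2)[of x]
    by (simp add: blinfun.diff_right)
  have bl: "bounded_linear q"
  proof (rule bounded_linear_intro[where K = "norm U / c"])
    show "q (x + y) = q x + q y" for x y
      by (rule uniq[symmetric]) (auto simp: q blinfun.add_right intro: subspace_add[OF R(2)])
    show "q (a *\<^sub>R x) = a *\<^sub>R q x" for a x
      by (rule uniq[symmetric]) (auto simp: q blinfun.scaleR_right intro: subspace_scale[OF R(2)])
    show "norm (q x) \<le> norm x * (norm U / c)" for x
    proof -
      have "c * norm (q x) \<le> norm U * norm x"
        using c(2)[OF q(1)[of x]] norm_blinfun[of U x] by (simp add: q(2))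
      then show ?thesis using c(1) by (simp add: field_simps)
    qed
  qed
  define P where "P = id_blinfun - Blinfun q"
  have Px: "P x = x - q x" for x
    by (simp add: P_def blinfun.diff_left bounded_linear_Blinfun_apply[OF bl])
  have PU: "U (P x) = 0" for x by (simp add: Px blinfun.diff_right q(2))
  have rp: "riesz_projection T p P"
    unfolding riesz_projection_def
  proof (intro conjI allI impI)
    show "blinfun_pow T p (P x) = 0" for x using PU by (simp add: U_def)
    show "\<exists>y. x - P x = blinfun_pow T k y" for k x
      using q(1)[of x] ran[of _ k] unfolding Px R_def U_def by auto
  qed (rule ker)
  \<comment> \<open>From \<open>U = 1 - D\<close> and \<open>U P = 0\<close>; this exhibits
    \<open>P\<close> as a compact operator.\<close>
  have "P = D o\<^sub>L P"
    by (rule blinfun_eqI) (use PU in \<open>simp add: UD\<close>)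
  then have "compact_blinfun P" using compact_blinfun_compose_right[OF D(1), of P] by simp
  with rp that show ?thesis by blast
qed

text \<open>Injectivity passes to all powers, so the root space and with it \<open>P\<close> vanish;
  then every \<open>x = x - P x\<close> is in the range of \<open>1 - C\<close>. Boundedness of the
  inverse is the lower bound for \<open>1 - C\<close>.\<close>

lemma fredholm_alternative:
  fixes C :: "'a::{real_inner,banach} \<Rightarrow>\<^sub>L 'a"
  assumes C: "compact_blinfun C" and inj: "\<And>x. x - C x = 0 \<Longrightarrow> x = 0"
  obtains S where "S o\<^sub>L (id_blinfun - C) = id_blinfun" "(id_blinfun - C) o\<^sub>L S = id_blinfun"
proof -
  define T where "T = id_blinfun - C"
  have Tx: "T x = x - C x" for x by (simp add: T_def blinfun.diff_left)
  obtain p P where P: "riesz_projection T p P"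
    using riesz_projection_exists[OF C] unfolding T_def by blast
  have Tinj: "T x = 0 \<Longrightarrow> x = 0" for x using inj by (simp add: Tx)
  have "blinfun_pow T k x = 0 \<Longrightarrow> x = 0" for k x
    by (induction k) (auto dest: Tinj)
  then have "P x = 0" for x using riesz_projection_in_kernel[OF P] by blast
  then have surj: "\<exists>y. T y = x" for x
    using riesz_projection_range[OF P, of x 1] by (metis One_nat_def blinfun_apply_blinfun_compose
        blinfun_apply_id_blinfun blinfun_pow.simps diff_zero)
  have Teq: "x = y" if "T x = T y" for x y
    using Tinj[of "x - y"] that by (simp add: blinfun.diff_right)
  obtain c where c: "c > 0" "\<And>x. x \<in> UNIV \<Longrightarrow> c * norm x \<le> norm (x - C x)"
    by (rule compact_bounded_below[OF C closed_UNIV subspace_UNIV]) (use inj in auto)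
  obtain s where s: "\<And>x. T (s x) = x" using surj by metis
  have bl: "bounded_linear s"
  proof (rule bounded_linear_intro[where K = "1 / c"])
    show "s (x + y) = s x + s y" for x y by (rule Teq) (simp add: s blinfun.add_right)
    show "s (a *\<^sub>R x) = a *\<^sub>R s x" for a x by (rule Teq) (simp add: s blinfun.scaleR_right)
    show "norm (s x) \<le> norm x * (1 / c)" for x
      using c(2)[of "s x"] c(1) unfolding Tx[symmetric] s by (simp add: field_simps)
  qed
  have sx: "Blinfun s x = s x" for x by (simp add: bounded_linear_Blinfun_apply[OF bl])
  show ?thesis
  proof
    show "Blinfun s o\<^sub>L (id_blinfun - C) = id_blinfun"
      by (rule blinfun_eqI) (simp add: sx Teq s flip: T_def)
    show "(id_blinfun - C) o\<^sub>L Blinfun s = id_blinfun"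
      by (rule blinfun_eqI) (simp add: sx s flip: T_def)
  qed
qed

section \<open>Vector-valued holomorphic functions\<close>

lemma scaleC_one [simp]: "1 *\<^sub>C x = (x :: 'a::complex_normed_vector)"
  using scaleC_of_real[of 1 x] by simp

lemma scaleC_zero_left [simp]: "0 *\<^sub>C x = (0 :: 'a::complex_normed_vector)"
  using scaleC_of_real[of 0 x] by simp

lemma scaleC_zero_right [simp]: "c *\<^sub>C (0 :: 'a::complex_normed_vector) = 0"
  using norm_scaleC[of c 0] by simp

lemma scaleC_minus_left: "(- c) *\<^sub>C x = - (c *\<^sub>C (x :: 'a::complex_normed_vector))"
  using scaleC_add_left[of c "- c" x] by (simp add: eq_neg_iff_add_eq_0 add.commute)

lemma scaleC_minus_right: "c *\<^sub>C (- x) = - (c *\<^sub>C (x :: 'a::complex_normed_vector))"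
  using scaleC_add_right[of c x "- x"] by (simp add: eq_neg_iff_add_eq_0 add.commute)

lemma scaleC_diff_left: "(c - d) *\<^sub>C x = c *\<^sub>C x - d *\<^sub>C (x :: 'a::complex_normed_vector)"
  using scaleC_add_left[of c "- d" x] by (simp add: scaleC_minus_left)

lemma scaleC_diff_right: "c *\<^sub>C (x - y) = c *\<^sub>C x - c *\<^sub>C (y :: 'a::complex_normed_vector)"
  using scaleC_add_right[of c x "- y"] by (simp add: scaleC_minus_right)

lemma scaleC_sum_right: "c *\<^sub>C (\<Sum>i\<in>I. f i) = (\<Sum>i\<in>I. c *\<^sub>C (f i :: 'a::complex_normed_vector))"
  by (induction I rule: infinite_finite_induct) (auto simp: scaleC_add_right)

lemma scaleC_eq_0_iff [simp]: "c *\<^sub>C x = 0 \<longleftrightarrow> c = 0 \<or> x = (0 :: 'a::complex_normed_vector)"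
  using norm_scaleC[of c x] by (metis mult_eq_0_iff norm_eq_zero)

lemma scaleC_blinfun_apply [simp]: "blinfun_apply (c *\<^sub>C A) x = c *\<^sub>C blinfun_apply A x"
  by transfer simp

definition clinear_blinfun :: "('a::complex_normed_vector \<Rightarrow>\<^sub>L 'b::complex_normed_vector) \<Rightarrow> bool" where
  "clinear_blinfun A \<longleftrightarrow> (\<forall>c x. A (c *\<^sub>C x) = c *\<^sub>C A x)"

lemma clinear_blinfunD: "clinear_blinfun A \<Longrightarrow> A (c *\<^sub>C x) = c *\<^sub>C A x"
  by (simp add: clinear_blinfun_def)

lemma compact_blinfun_scaleC:
  fixes B :: "'a::real_normed_vector \<Rightarrow>\<^sub>L 'b::complex_normed_vector"
  assumes "compact_blinfun B"
  shows "compact_blinfun (c *\<^sub>C B)"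
proof -
  have "c *\<^sub>C B = (c *\<^sub>C id_blinfun) o\<^sub>L B" by (rule blinfun_eqI) simp
  then show ?thesis using compact_blinfun_compose_left[OF assms] by simp
qed

section \<open>Bounded inverses and their stability\<close>

definition blinfun_inverse_pair :: "('a::real_normed_vector \<Rightarrow>\<^sub>L 'a) \<Rightarrow> ('a \<Rightarrow>\<^sub>L 'a) \<Rightarrow> bool" where
  "blinfun_inverse_pair T S \<longleftrightarrow> (\<forall>x. S (T x) = x \<and> T (S x) = x)"

definition blinfun_inverse :: "('a::real_normed_vector \<Rightarrow>\<^sub>L 'a) \<Rightarrow> ('a \<Rightarrow>\<^sub>L 'a)" where
  "blinfun_inverse T = (SOME S. blinfun_inverse_pair T S)"

lemma blinfun_inverse_pair_unique:
  "blinfun_inverse_pair T S \<Longrightarrow> blinfun_inverse_pair T S' \<Longrightarrow> S = S'"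
  by (rule blinfun_eqI) (metis blinfun_inverse_pair_def)

lemma blinfun_inverse_eq: "blinfun_inverse_pair T S \<Longrightarrow> blinfun_inverse T = S"
  unfolding blinfun_inverse_def by (rule some_equality) (auto intro: blinfun_inverse_pair_unique)

lemma fredholm_inverse_pair:
  fixes C :: "'a::{real_inner,banach} \<Rightarrow>\<^sub>L 'a"
  assumes "compact_blinfun C" and "T = id_blinfun - C" and "\<And>x. T x = 0 \<Longrightarrow> x = 0"
  obtains S where "blinfun_inverse_pair T S"
proof -
  have inj: "x = 0" if "x - C x = 0" for x
    using assms(3)[of x] that by (simp add: assms(2) blinfun.diff_left)
  obtain S where "S o\<^sub>L T = id_blinfun" "T o\<^sub>L S = id_blinfun"
    using fredholm_alternative[OF assms(1) inj] unfolding assms(2) by blast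
  then have "blinfun_inverse_pair T S"
    unfolding blinfun_inverse_pair_def
    by (metis blinfun_apply_blinfun_compose blinfun_apply_id_blinfun)
  then show ?thesis by (rule that)
qed

text \<open>Solving \<open>(T + E) x = y\<close> means finding a fixed point of the map taking
  \<open>x\<close> to \<open>S y - S (E x)\<close>, a contraction with factor \<open>1 / 2\<close>.
  The fixed point equation also gives the bound \<open>2 * norm S\<close>, uniform over all
  admissible \<open>E\<close>, as needed for holomorphy of the inverse.\<close>

lemma blinfun_inverse_pair_perturb:
  fixes T :: "'a::banach \<Rightarrow>\<^sub>L 'a"
  assumes S: "blinfun_inverse_pair T S" and E: "norm S * norm E \<le> 1 / 2"
  obtains S' where "blinfun_inverse_pair (T + E) S'" "norm S' \<le> 2 * norm S"
proof -
  have TS: "S (T x) = x" "T (S x) = x" for x using S by (auto simp: blinfun_inverse_pair_def)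
  have SE: "norm (S (E v)) \<le> 1 / 2 * norm v" for v
  proof -
    have "norm (S (E v)) \<le> norm S * (norm E * norm v)"
      by (meson mult_left_mono norm_blinfun norm_ge_zero order.trans)
    also have "\<dots> \<le> 1 / 2 * norm v"
      using mult_right_mono[OF E, of "norm v"] by (simp add: mult.assoc)
    finally show ?thesis .
  qed
  have "dist (S y - S (E x)) (S y - S (E x')) \<le> 1 / 2 * dist x x'" for x x' y
    using SE[of "x' - x"] by (simp add: dist_norm norm_minus_commute blinfun.diff_right)
  then have "\<exists>!x. S y - S (E x) = x" for y
    by (intro banach_fix_type[of "1 / 2"]) auto
  moreover have eq: "S y - S (E x) = x \<longleftrightarrow> (T + E) x = y" for x y
  proof -
    have "S y - S (E x) = x \<longleftrightarrow> S (y - E x) = S (T x)" by (simp add: blinfun.diff_right TS)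
    also have "\<dots> \<longleftrightarrow> y - E x = T x" by (metis TS)
    finally show ?thesis by (auto simp: blinfun.add_left algebra_simps)
  qed
  ultimately have ex: "\<exists>!x. (T + E) x = y" for y by simp
  then obtain s where s: "\<And>y. (T + E) (s y) = y" by metis
  have uniq: "x = x'" if "(T + E) x = (T + E) x'" for x x' using ex that by blast
  have bound: "norm (s y) \<le> 2 * norm S * norm y" for y
  proof -
    have "s y = S y - S (E (s y))" using eq[of y "s y"] s by simp
    then have "norm (s y) \<le> norm (S y) + norm (S (E (s y)))" by (metis norm_triangle_ineq4)
    also have "\<dots> \<le> norm S * norm y + 1 / 2 * norm (s y)"
      by (intro add_mono norm_blinfun SE)
    finally show ?thesis by simp
  qed
  have bl: "bounded_linear s"
  proof (rule bounded_linear_intro[where K = "2 * norm S"])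
    show "s (x + y) = s x + s y" for x y by (rule uniq) (simp add: s blinfun.add_right)
    show "s (a *\<^sub>R x) = a *\<^sub>R s x" for a x by (rule uniq) (simp add: s blinfun.scaleR_right)
  qed (use bound in \<open>simp add: mult_ac\<close>)
  have "blinfun_inverse_pair (T + E) (Blinfun s)"
    unfolding blinfun_inverse_pair_def bounded_linear_Blinfun_apply[OF bl]
    by (auto simp: s intro: uniq)
  moreover have "norm (Blinfun s) \<le> 2 * norm S"
    by (rule norm_blinfun_bound) (use bound in \<open>simp_all add: bounded_linear_Blinfun_apply[OF bl]\<close>)
  ultimately show ?thesis by (rule that)
qed

lemma clinear_blinfun_inverse:
  assumes "blinfun_inverse_pair T S" "clinear_blinfun T"
  shows "clinear_blinfun S"
  using assms unfolding blinfun_inverse_pair_def clinear_blinfun_def by metis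

section \<open>Matrix elements of operators\<close>

lemma Im_cinner: "Im (cinner x y) = inner x ((- \<i>) *\<^sub>C y)"
proof -
  have "inner x ((- \<i>) *\<^sub>C y) = Re ((- \<i>) * cinner x y)"
    by (simp only: cinner_scaleC_right flip: Re_cinner)
  then show ?thesis by simp
qed

lemma bounded_linear_cinner_right: "bounded_linear (cinner (k :: 'a::chilbert_space))"
proof -
  have eq: "cinner k = (\<lambda>y. of_real (inner k y) + \<i> * of_real (inner k ((- \<i>) *\<^sub>C y)))"
    by (rule ext) (simp add: complex_eq_iff Re_cinner Im_cinner)
  show ?thesis
    unfolding eq
    by (intro bounded_linear_add bounded_linear_of_real[THEN bounded_linear_compose]
        bounded_linear_mult_right[THEN bounded_linear_compose] bounded_linear_inner_right
        bounded_linear_inner_right_comp bounded_linear_scaleC)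
qed

lemma cinner_eq_0_right: "(\<And>k. cinner k v = 0) \<Longrightarrow> v = 0"
  by (metis Re_cinner inner_eq_zero_iff zero_complex.sel(1))

text \<open>Matrix elements are bounded complex linear functionals of the operator that together
  determine it; through them Cauchy's theorem and analytic continuation are only applied to scalar
  functions.\<close>

lemma matrix_element:
  fixes k :: "'b::chilbert_space" and x :: "'a::complex_normed_vector"
  defines "\<phi> \<equiv> (\<lambda>X :: 'a \<Rightarrow>\<^sub>L 'b. cinner k (X x))"
  shows "bounded_linear \<phi>" "\<phi> (c *\<^sub>C X) = c * \<phi> X"
proof -
  show "bounded_linear \<phi>"
    unfolding \<phi>_def
    by (intro bounded_linear_compose[OF bounded_linear_cinner_right] blinfun.bounded_linear_left)
  show "\<phi> (c *\<^sub>C X) = c * \<phi> X" by (simp add: \<phi>_def cinner_scaleC_right)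
qed

lemma matrix_element_eqI:
  fixes X Y :: "'a::complex_normed_vector \<Rightarrow>\<^sub>L 'b::chilbert_space"
  assumes "\<And>k x. cinner k (X x) = cinner k (Y x)"
  shows "X = Y"
proof (rule blinfun_eqI)
  fix x
  have "cinner k (X x - Y x) = 0" for k
    using assms linear_diff[OF bounded_linear.linear, OF bounded_linear_cinner_right] by (metis diff_self)
  then show "X x = Y x" using cinner_eq_0_right[of "X x - Y x"] by simp
qed

section \<open>Calculus of vector-valued holomorphic functions\<close>

lemma vholomorphic_on_subset: "vholomorphic_on f S \<Longrightarrow> T \<subseteq> S \<Longrightarrow> vholomorphic_on f T"
  unfolding vholomorphic_on_def by (meson subsetD tendsto_within_subset)

lemma tendsto_scaleC:
  fixes f :: "'b \<Rightarrow> complex" and g :: "'b \<Rightarrow> 'a::complex_normed_vector"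
  assumes f: "(f \<longlongrightarrow> c) F" and g: "(g \<longlongrightarrow> l) F"
  shows "((\<lambda>x. f x *\<^sub>C g x) \<longlongrightarrow> c *\<^sub>C l) F"
proof -
  have n: "((\<lambda>x. norm (f x) * norm (g x - l) + norm (f x - c) * norm l) \<longlongrightarrow> norm c * 0 + 0 * norm l) F"
    by (intro tendsto_intros f tendsto_norm_zero LIM_zero g)
  have "((\<lambda>x. f x *\<^sub>C g x - c *\<^sub>C l) \<longlongrightarrow> 0) F"
  proof (rule Lim_null_comparison)
    show "\<forall>\<^sub>F x in F. norm (f x *\<^sub>C g x - c *\<^sub>C l) \<le> norm (f x) * norm (g x - l) + norm (f x - c) * norm l"
    proof (rule always_eventually, rule allI)
      fix x
      have "f x *\<^sub>C g x - c *\<^sub>C l = f x *\<^sub>C (g x - l) + (f x - c) *\<^sub>C l"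
        by (simp add: scaleC_diff_left scaleC_diff_right)
      then show "norm (f x *\<^sub>C g x - c *\<^sub>C l) \<le> norm (f x) * norm (g x - l) + norm (f x - c) * norm l"
        by (metis norm_scaleC norm_triangle_ineq)
    qed
    show "((\<lambda>x. norm (f x) * norm (g x - l) + norm (f x - c) * norm l) \<longlongrightarrow> 0) F" using n by simp
  qed
  then show ?thesis by (simp add: LIM_zero_iff)
qed

lemma vholomorphic_on_continuous:
  assumes "vholomorphic_on f S"
  shows "continuous_on S f"
  unfolding continuous_on_def
proof
  fix s assume "s \<in> S"
  then obtain D where D: "((\<lambda>w. inverse (w - s) *\<^sub>C (f w - f s)) \<longlongrightarrow> D) (at s within S)"
    using assms unfolding vholomorphic_on_def by blast
  have "((\<lambda>w. (w - s) *\<^sub>C (inverse (w - s) *\<^sub>C (f w - f s)) + f s) \<longlongrightarrow> (s - s) *\<^sub>C D + f s) (at s within S)"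
    by (intro tendsto_intros tendsto_scaleC D)
  then have "((\<lambda>w. (w - s) *\<^sub>C (inverse (w - s) *\<^sub>C (f w - f s)) + f s) \<longlongrightarrow> f s) (at s within S)"
    by simp
  then show "(f \<longlongrightarrow> f s) (at s within S)"
  proof (rule Lim_transform_eventually)
    show "\<forall>\<^sub>F w in at s within S. (w - s) *\<^sub>C (inverse (w - s) *\<^sub>C (f w - f s)) + f s = f w"
      unfolding eventually_at_topological
      by (intro exI[of _ UNIV]) (auto simp: scaleC_scaleC)
  qed
qed

lemma vholomorphic_on_const: "vholomorphic_on (\<lambda>_. c) S"
  unfolding vholomorphic_on_def by (auto intro!: exI[of _ 0])

lemma vholomorphic_on_add:
  assumes "vholomorphic_on f S" "vholomorphic_on g S"
  shows "vholomorphic_on (\<lambda>w. f w + g w) S"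
  unfolding vholomorphic_on_def
proof
  fix s assume "s \<in> S"
  then obtain D E where "((\<lambda>w. inverse (w - s) *\<^sub>C (f w - f s)) \<longlongrightarrow> D) (at s within S)"
    "((\<lambda>w. inverse (w - s) *\<^sub>C (g w - g s)) \<longlongrightarrow> E) (at s within S)"
    using assms unfolding vholomorphic_on_def by blast
  from tendsto_add[OF this]
  have "((\<lambda>w. inverse (w - s) *\<^sub>C (f w + g w - (f s + g s))) \<longlongrightarrow> D + E) (at s within S)"
    by (simp add: scaleC_diff_right scaleC_add_right algebra_simps)
  then show "\<exists>D. ((\<lambda>w. inverse (w - s) *\<^sub>C (f w + g w - (f s + g s))) \<longlongrightarrow> D) (at s within S)" ..
qed

lemma vholomorphic_on_scaleC:
  assumes "c holomorphic_on S" "vholomorphic_on f S"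
  shows "vholomorphic_on (\<lambda>w. c w *\<^sub>C f w) S"
  unfolding vholomorphic_on_def
proof
  fix s assume s: "s \<in> S"
  then obtain D where D: "((\<lambda>w. inverse (w - s) *\<^sub>C (f w - f s)) \<longlongrightarrow> D) (at s within S)"
    using assms unfolding vholomorphic_on_def by blast
  obtain d where d: "(c has_field_derivative d) (at s within S)"
    using assms(1) s unfolding holomorphic_on_def field_differentiable_def by blast
  then have d': "((\<lambda>w. (c w - c s) / (w - s)) \<longlongrightarrow> d) (at s within S)"
    by (simp add: has_field_derivative_iff)
  have c: "(c \<longlongrightarrow> c s) (at s within S)"
    using d by (metis continuous_within has_field_derivative_imp_has_derivative has_derivative_continuous)
  have "((\<lambda>w. c w *\<^sub>C (inverse (w - s) *\<^sub>C (f w - f s)) + ((c w - c s) / (w - s)) *\<^sub>C f s)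
      \<longlongrightarrow> c s *\<^sub>C D + d *\<^sub>C f s) (at s within S)"
    by (intro tendsto_intros tendsto_scaleC c D d')
  moreover have "c w *\<^sub>C (inverse (w - s) *\<^sub>C (f w - f s)) + ((c w - c s) / (w - s)) *\<^sub>C f s
      = inverse (w - s) *\<^sub>C (c w *\<^sub>C f w - c s *\<^sub>C f s)" for w
    by (simp add: scaleC_scaleC scaleC_diff_right scaleC_diff_left divide_inverse algebra_simps)
  ultimately show "\<exists>D. ((\<lambda>w. inverse (w - s) *\<^sub>C (c w *\<^sub>C f w - c s *\<^sub>C f s)) \<longlongrightarrow> D) (at s within S)"
    by (simp only:) (rule exI)
qed

lemma vholomorphic_on_sum:
  assumes "\<And>i. i \<in> I \<Longrightarrow> vholomorphic_on (f i) S"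
  shows "vholomorphic_on (\<lambda>w. \<Sum>i\<in>I. f i w) S"
  using assms
  by (induction I rule: infinite_finite_induct) (auto intro: vholomorphic_on_const vholomorphic_on_add)

lemma vholomorphic_on_linear:
  fixes f :: "complex \<Rightarrow> 'a::complex_normed_vector" and L :: "'a \<Rightarrow> 'b::complex_normed_vector"
  assumes L: "bounded_linear L" "\<And>c x. L (c *\<^sub>C x) = c *\<^sub>C L x" and f: "vholomorphic_on f S"
  shows "vholomorphic_on (\<lambda>w. L (f w)) S"
  unfolding vholomorphic_on_def
proof
  fix s assume "s \<in> S"
  then obtain D where D: "((\<lambda>w. inverse (w - s) *\<^sub>C (f w - f s)) \<longlongrightarrow> D) (at s within S)"
    using f unfolding vholomorphic_on_def by blast
  from bounded_linear.tendsto[OF L(1) this]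
  show "\<exists>D. ((\<lambda>w. inverse (w - s) *\<^sub>C (L (f w) - L (f s))) \<longlongrightarrow> D) (at s within S)"
    by (simp only: L(2) linear_diff[OF bounded_linear.linear, OF L(1)]) (rule exI)
qed

lemma vholomorphic_on_complex:
  fixes f :: "complex \<Rightarrow> complex"
  assumes "vholomorphic_on f S"
  shows "f holomorphic_on S"
  unfolding holomorphic_on_def
proof
  fix s assume "s \<in> S"
  then obtain D where D: "((\<lambda>w. inverse (w - s) *\<^sub>C (f w - f s)) \<longlongrightarrow> D) (at s within S)"
    using assms unfolding vholomorphic_on_def by blast
  then have "(f has_field_derivative D) (at s within S)"
    by (simp add: has_field_derivative_iff scaleC_complex_def divide_inverse mult.commute)
  then show "f field_differentiable at s within S" by (auto simp: field_differentiable_def)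
qed

lemma matrix_element_holomorphic:
  fixes f :: "complex \<Rightarrow> ('a::complex_normed_vector \<Rightarrow>\<^sub>L 'b::chilbert_space)"
  assumes "vholomorphic_on f S"
  shows "(\<lambda>w. cinner k (f w x)) holomorphic_on S"
  by (rule vholomorphic_on_complex,
      rule vholomorphic_on_linear[OF matrix_element(1)[of k x] _ assms])
    (simp add: scaleC_complex_def cinner_scaleC_right)

lemma vholomorphic_on_compose_right:
  fixes f :: "complex \<Rightarrow> ('a::real_normed_vector \<Rightarrow>\<^sub>L 'b::complex_normed_vector)"
    and A :: "'c::real_normed_vector \<Rightarrow>\<^sub>L 'a"
  assumes "vholomorphic_on f S"
  shows "vholomorphic_on (\<lambda>w. f w o\<^sub>L A) S"
proof (rule vholomorphic_on_linear[OF _ _ assms])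
  show "bounded_linear (\<lambda>X :: 'a \<Rightarrow>\<^sub>L 'b. X o\<^sub>L A)"
    by (rule bounded_bilinear.bounded_linear_left[OF bounded_bilinear_blinfun_compose])
  show "(c *\<^sub>C X) o\<^sub>L A = c *\<^sub>C (X o\<^sub>L A)" for c and X :: "'a \<Rightarrow>\<^sub>L 'b"
    by (rule blinfun_eqI) simp
qed

text \<open>The resolvent identity \<open>S w - S s = (s - w) S w E S s\<close> gives both continuity and the
  derivative.\<close>

lemma vholomorphic_on_inverse:
  fixes T E :: "'a::{complex_normed_vector,banach} \<Rightarrow>\<^sub>L 'a"
  assumes S: "\<And>w. w \<in> U \<Longrightarrow> blinfun_inverse_pair (T + (w - z) *\<^sub>C E) (S w)"
    and bound: "\<And>w. w \<in> U \<Longrightarrow> norm (S w) \<le> K"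
    and T: "clinear_blinfun T" and E: "clinear_blinfun E"
  shows "vholomorphic_on S U"
  unfolding vholomorphic_on_def
proof
  fix s assume s: "s \<in> U"
  have clin: "clinear_blinfun (S w)" if "w \<in> U" for w
    by (rule clinear_blinfun_inverse[OF S[OF that]])
      (use T E in \<open>simp add: clinear_blinfun_def blinfun.add_left scaleC_add_right scaleC_scaleC mult.commute\<close>)
  have id: "S w - S s = (s - w) *\<^sub>C (S w o\<^sub>L (E o\<^sub>L S s))" if w: "w \<in> U" for w
  proof (rule blinfun_eqI)
    fix x
    have "S s x = S w ((T + (w - z) *\<^sub>C E) (S s x))"
      using S[OF w] by (simp add: blinfun_inverse_pair_def)
    also have "(T + (w - z) *\<^sub>C E) (S s x) = (T + (s - z) *\<^sub>C E) (S s x) + (w - s) *\<^sub>C E (S s x)"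
      by (simp add: blinfun.add_left blinfun.diff_left scaleC_diff_left)
    also have "(T + (s - z) *\<^sub>C E) (S s x) = x"
      using S[OF s] by (simp add: blinfun_inverse_pair_def)
    finally have "S s x = S w x + (w - s) *\<^sub>C S w (E (S s x))"
      using clin[OF w] by (simp add: blinfun.add_right clinear_blinfun_def)
    then show "(S w - S s) x = ((s - w) *\<^sub>C (S w o\<^sub>L (E o\<^sub>L S s))) x"
      by (simp add: blinfun.diff_left scaleC_diff_left algebra_simps)
  qed
  have "((\<lambda>w. S w - S s) \<longlongrightarrow> 0) (at s within U)"
  proof (rule Lim_null_comparison)
    show "((\<lambda>w. norm (s - w) * (K * (norm E * norm (S s)))) \<longlongrightarrow> 0) (at s within U)"
      by (auto intro!: tendsto_eq_intros)
    have "norm (S w - S s) \<le> norm (s - w) * (K * (norm E * norm (S s)))" if w: "w \<in> U" for w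
    proof -
      have "norm (S w o\<^sub>L (E o\<^sub>L S s)) \<le> norm (S w) * (norm E * norm (S s))"
        by (meson mult_left_mono norm_blinfun_compose norm_ge_zero order.trans)
      also have "\<dots> \<le> K * (norm E * norm (S s))"
        by (intro mult_right_mono bound w) simp
      finally show ?thesis unfolding id[OF w] norm_scaleC by (intro mult_left_mono) simp_all
    qed
    then show "\<forall>\<^sub>F w in at s within U. norm (S w - S s) \<le> norm (s - w) * (K * (norm E * norm (S s)))"
      by (simp add: eventually_at_topological) (intro exI[of _ UNIV], simp)
  qed
  then have lim: "(S \<longlongrightarrow> S s) (at s within U)" by (simp add: LIM_zero_iff)
  have "((\<lambda>w. - (S w o\<^sub>L (E o\<^sub>L S s))) \<longlongrightarrow> - (S s o\<^sub>L (E o\<^sub>L S s))) (at s within U)"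
    by (intro tendsto_minus bounded_bilinear.tendsto[OF bounded_bilinear_blinfun_compose] lim tendsto_const)
  then have "((\<lambda>w. inverse (w - s) *\<^sub>C (S w - S s)) \<longlongrightarrow> - (S s o\<^sub>L (E o\<^sub>L S s))) (at s within U)"
  proof (rule Lim_transform_eventually)
    have "- (S w o\<^sub>L (E o\<^sub>L S s)) = inverse (w - s) *\<^sub>C (S w - S s)" if "w \<in> U" "w \<noteq> s" for w
    proof -
      have "inverse (w - s) * (s - w) = -1" using that(2) by (simp add: field_simps)
      then show ?thesis unfolding id[OF that(1)] scaleC_scaleC by (simp add: scaleC_minus_left)
    qed
    then show "\<forall>\<^sub>F w in at s within U. - (S w o\<^sub>L (E o\<^sub>L S s)) = inverse (w - s) *\<^sub>C (S w - S s)"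
      by (simp add: eventually_at_topological) (intro exI[of _ UNIV], simp)
  qed
  then show "\<exists>D. ((\<lambda>w. inverse (w - s) *\<^sub>C (S w - S s)) \<longlongrightarrow> D) (at s within U)" ..
qed

section \<open>The resolvent of a compact operator pencil\<close>

text \<open>With \<open>B = A(s0)\<close> this is the factor in the resolvent identity
  \<open>(1 + (s - s0) A(s0)) A(s) = A(s0)\<close>.\<close>

definition pencil :: "('a::complex_normed_vector \<Rightarrow>\<^sub>L 'a) \<Rightarrow> complex \<Rightarrow> complex \<Rightarrow> ('a \<Rightarrow>\<^sub>L 'a)" where
  "pencil B s0 s = id_blinfun + (s - s0) *\<^sub>C B"

lemma pencil_apply: "pencil B s0 s x = x + (s - s0) *\<^sub>C B x"
  by (simp add: pencil_def blinfun.add_left)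

text \<open>The candidate for the continuation of \<open>A\<close>. Where the pencil is singular,
  \<open>blinfun_inverse\<close> is an arbitrary operator; those points turn out to be isolated, and
  values at poles do not matter.\<close>

definition pencil_resolvent ::
    "('a::complex_normed_vector \<Rightarrow>\<^sub>L 'a) \<Rightarrow> complex \<Rightarrow> complex \<Rightarrow> ('a \<Rightarrow>\<^sub>L 'a)" where
  "pencil_resolvent B s0 s = blinfun_inverse (pencil B s0 s) o\<^sub>L B"

context
  fixes B :: "'a::chilbert_space \<Rightarrow>\<^sub>L 'a" and s0 :: complex
  assumes compB: "compact_blinfun B" and clinB: "clinear_blinfun B"
begin

lemma pencil_eq: "pencil B s0 s = id_blinfun - (s0 - s) *\<^sub>C B"
  by (rule blinfun_eqI) (simp add: pencil_apply blinfun.diff_left scaleC_diff_left)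

lemma pencil_shift: "pencil B s0 w x = pencil B s0 s x + (w - s) *\<^sub>C B x"
  by (simp add: pencil_apply scaleC_diff_left)

text \<open>The pencil is affine in its parameter and equals 1 at \<open>s0\<close>, so its values
  at \<open>w\<close>, \<open>s\<close> and \<open>s0\<close> are linearly related. This eliminates
  \<open>B\<close> and expresses the pencil at \<open>w\<close> through the one at \<open>s\<close>,
  which is nilpotent on the root space.\<close>

lemma pencil_three_points:
  "(s - s0) *\<^sub>C pencil B s0 w x = (w - s0) *\<^sub>C pencil B s0 s x - (w - s) *\<^sub>C x"
proof -
  have "(w - s) *\<^sub>C x = (w - s0) *\<^sub>C x - (s - s0) *\<^sub>C x" by (simp flip: scaleC_diff_left)
  moreover have "(s - s0) * (w - s0) = (w - s0) * (s - s0)" by simp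
  ultimately show ?thesis
    by (simp only: pencil_apply scaleC_add_right scaleC_scaleC) simp
qed

lemma pencil_scaleC: "pencil B s0 s (c *\<^sub>C x) = c *\<^sub>C pencil B s0 s x"
  using clinB by (simp add: pencil_apply clinear_blinfun_def scaleC_add_right scaleC_scaleC mult.commute)

lemma pencil_inverse_pair:
  assumes "\<And>x. pencil B s0 s x = 0 \<Longrightarrow> x = 0"
  obtains S where "blinfun_inverse_pair (pencil B s0 s) S"
  by (rule fredholm_inverse_pair[OF compact_blinfun_scaleC[OF compB] pencil_eq assms], assumption)
    (rule that)

lemma pencil_riesz_projection_exists:
  obtains p P where "riesz_projection (pencil B s0 s) p P" "compact_blinfun P"
proof -
  obtain p P where "riesz_projection (id_blinfun - (s0 - s) *\<^sub>C B) p P" "compact_blinfun P"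
    by (rule riesz_projection_exists[OF compact_blinfun_scaleC[OF compB]])
  then show ?thesis by (rule that[unfolded pencil_eq])
qed

lemma pencil_resolvent_eqI:
  assumes "\<And>v. pencil B s0 s v = 0 \<Longrightarrow> v = 0" "pencil B s0 s y = B x"
  shows "pencil_resolvent B s0 s x = y"
proof -
  obtain S where S: "blinfun_inverse_pair (pencil B s0 s) S"
    by (rule pencil_inverse_pair[OF assms(1)])
  have "S (B x) = y" using S assms(2) unfolding blinfun_inverse_pair_def by metis
  then show ?thesis by (simp add: pencil_resolvent_def blinfun_inverse_eq[OF S])
qed

lemma B_scaleC: "B (c *\<^sub>C x) = c *\<^sub>C B x"
  by (rule clinear_blinfunD[OF clinB])

context
  fixes s :: complex and p :: nat and P :: "'a \<Rightarrow>\<^sub>L 'a"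
  assumes P: "riesz_projection (pencil B s0 s) p P"
begin

lemma riesz_projection_scaleC: "P (c *\<^sub>C x) = c *\<^sub>C P x"
  by (rule riesz_projection_commute[OF P]) (simp_all add: pencil_scaleC scaleC_add_right)

lemma riesz_projection_pencil: "P (pencil B s0 w x) = pencil B s0 w (P x)"
  by (rule riesz_projection_commute[OF P])
    (simp_all add: pencil_apply blinfun.add_right B_scaleC scaleC_add_right scaleC_scaleC mult.commute)

lemma riesz_projection_B: "P (B x) = B (P x)"
  by (rule riesz_projection_commute[OF P])
    (simp_all add: pencil_apply blinfun.add_right B_scaleC)

text \<open>The three-point relation turns the kernel equation at \<open>w\<close> into
  \<open>u = q T u\<close> with \<open>T\<close> the pencil at \<open>s\<close>; iterating
  \<open>p\<close> times kills \<open>u\<close>.\<close>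

lemma nilpotent_part_injective:
  assumes "w \<noteq> s" "pencil B s0 w u = 0" "P u = u"
  shows "u = 0"
proof -
  let ?T = "pencil B s0 s"
  have pk: "blinfun_pow ?T p u = 0" using riesz_projection_in_kernel[OF P, of u] assms(3) by simp
  have "0 = (s - s0) *\<^sub>C pencil B s0 w u" using assms(2) by simp
  also have "\<dots> = (w - s0) *\<^sub>C ?T u - (w - s) *\<^sub>C u"
    by (rule pencil_three_points)
  finally have eq: "(w - s) *\<^sub>C u = (w - s0) *\<^sub>C ?T u" by simp
  define q where "q = (w - s0) / (w - s)"
  have "inverse (w - s) *\<^sub>C (w - s) *\<^sub>C u = inverse (w - s) *\<^sub>C (w - s0) *\<^sub>C ?T u" using eq by simp
  then have u: "u = q *\<^sub>C ?T u"
    using assms(1) by (simp add: scaleC_scaleC q_def divide_inverse mult.commute)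
  have "u = q ^ k *\<^sub>C blinfun_pow ?T k u" for k
  proof (induction k)
    case (Suc k)
    have "u = q *\<^sub>C ?T (q ^ k *\<^sub>C blinfun_pow ?T k u)" using u Suc by simp
    then show ?case by (simp add: pencil_scaleC scaleC_scaleC)
  qed simp
  from this[of p] pk show ?thesis by simp
qed

text \<open>The vector \<open>y\<close> is a terminating Neumann series. With \<open>T\<close> the
  pencil at \<open>s\<close> and \<open>q = (w - s0) / (w - s)\<close>, elimination of
  \<open>B\<close> gives formally \<open>y = (1 - T) (1 - q T)^(-1) x / (w - s)\<close>. Expanding
  in powers of \<open>T\<close> leaves the coefficients \<open>q^j (q - 1) / (w - s)\<close>, and
  \<open>q - 1 = (s - s0) / (w - s)\<close>.\<close>

lemma nilpotent_part_resolvent: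
  assumes w: "w \<noteq> s" and x: "P x = x"
  defines "y \<equiv> (1 / (w - s)) *\<^sub>C x +
    (\<Sum>j<p. ((s - s0) * (w - s0) ^ j / (w - s) ^ (j + 2)) *\<^sub>C blinfun_pow (pencil B s0 s) (Suc j) x)"
  shows "pencil B s0 w y = B x"
proof (cases "s = s0")
  let ?T = "pencil B s0 s"
  \<comment> \<open>Elimination of \<open>B\<close> divides by \<open>s - s0\<close>. At
    \<open>s = s0\<close> the pencil is 1 and the root space is trivial.\<close>
  case True
  then have T1: "?T v = v" for v by (simp add: pencil_apply)
  have "blinfun_pow ?T k x = x" for k by (induction k) (simp_all add: T1)
  then have "x = 0" using riesz_projection_in_kernel[OF P, of x] x by simp
  moreover from this have "y = 0" by (simp add: y_def blinfun.zero_right)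
  ultimately show ?thesis by (simp add: blinfun.zero_right)
next
  let ?T = "pencil B s0 s"
  case False
  define b where "b = (\<lambda>j. (s - s0) * (w - s0) ^ j / (w - s) ^ (j + 2))"
  define f where "f = (\<lambda>j. ((w - s) * b j) *\<^sub>C blinfun_pow ?T (Suc j) x)"
  \<comment> \<open>This recursion makes the two sums below telescope; the upper boundary term
    \<open>f p\<close> vanishes by nilpotency.\<close>
  have b: "(w - s0) * b j = (w - s) * b (Suc j)" for j
  proof -
    have "x * (a * x ^ j / y ^ (j + 2)) = y * (a * x ^ Suc j / y ^ (Suc j + 2))"
      if "y \<noteq> 0" for x y a :: complex
      using that by (simp add: field_simps)
    then show ?thesis using w by (simp add: b_def)
  qed
  have pk: "blinfun_pow ?T p x = 0" using riesz_projection_in_kernel[OF P, of x] x by simp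
  have fp: "f p = 0" by (simp add: f_def pk blinfun.zero_right)
  have y: "y = (1 / (w - s)) *\<^sub>C x + (\<Sum>j<p. b j *\<^sub>C blinfun_pow ?T (Suc j) x)"
    by (simp only: y_def b_def)
  have zB: "(s - s0) *\<^sub>C B v = ?T v - v" for v by (simp add: pencil_apply)
  have "(s - s0) *\<^sub>C pencil B s0 w y = (w - s0) *\<^sub>C ?T y - (w - s) *\<^sub>C y"
    by (rule pencil_three_points)
  also have "(w - s0) *\<^sub>C ?T y = ((w - s0) / (w - s)) *\<^sub>C ?T x + (\<Sum>j<p. f (Suc j))"
    by (simp add: y f_def blinfun.add_right blinfun.sum_right pencil_scaleC scaleC_add_right
        scaleC_sum_right scaleC_scaleC b)
  also have "(w - s) *\<^sub>C y = x + (\<Sum>j<p. f j)"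
    using w by (simp add: y f_def scaleC_add_right scaleC_sum_right scaleC_scaleC)
  also have "((w - s0) / (w - s)) *\<^sub>C ?T x + (\<Sum>j<p. f (Suc j)) - (x + (\<Sum>j<p. f j))
      = ((w - s0) / (w - s)) *\<^sub>C ?T x + (f p - f 0) - x"
    by (simp add: sum_lessThan_telescope[symmetric] sum_subtractf)
  also have "\<dots> = ?T x - x"
  proof -
    have "f 0 = ((s - s0) / (w - s)) *\<^sub>C ?T x" using w by (simp add: f_def b_def power2_eq_square)
    moreover have "(w - s0) / (w - s) - (s - s0) / (w - s) = 1"
      using w by (simp add: diff_divide_distrib[symmetric])
    then have "((w - s0) / (w - s)) *\<^sub>C ?T x - ((s - s0) / (w - s)) *\<^sub>C ?T x = ?T x"
      by (simp flip: scaleC_diff_left)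
    ultimately show ?thesis by (simp add: fp algebra_simps)
  qed
  also have "\<dots> = (s - s0) *\<^sub>C B x" by (simp add: zB)
  finally have "(s - s0) *\<^sub>C (pencil B s0 w y - B x) = 0" by (simp add: scaleC_diff_right)
  with False show ?thesis by simp
qed

text \<open>On the kernel of \<open>P\<close> the operator \<open>pencil B s0 s\<close> agrees with the invertible operator
  \<open>1 + (s - s0) B (1 - P)\<close>, whose analytic perturbation gives the regular part.\<close>

lemma pencil_resolvent_laurent:
  obtains e W where "e > 0" "vholomorphic_on W (ball s e)"
    "\<And>w v. w \<in> ball s e - {s} \<Longrightarrow> pencil B s0 w v = 0 \<Longrightarrow> v = 0"
    "\<And>w. w \<in> ball s e - {s} \<Longrightarrow> pencil_resolvent B s0 w = W w + (1 / (w - s)) *\<^sub>C P +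
      (\<Sum>j<p. ((s - s0) * (w - s0) ^ j / (w - s) ^ (j + 2)) *\<^sub>C (blinfun_pow (pencil B s0 s) (Suc j) o\<^sub>L P))"
proof -
  let ?T = "pencil B s0 s"
  define Q where "Q = id_blinfun - P"
  have Qx: "Q x = x - P x" for x by (simp add: Q_def blinfun.diff_left)
  have PQ: "P (Q x) = 0" for x by (simp add: Qx blinfun.diff_right riesz_projection_idem[OF P])
  have clinP: "clinear_blinfun P" by (simp add: clinear_blinfun_def riesz_projection_scaleC)
  define T' where "T' = pencil (B o\<^sub>L Q) s0 s"
  have T'x: "T' x = x + (s - s0) *\<^sub>C B (x - P x)" for x by (simp add: T'_def pencil_apply Qx)
  have clinT': "clinear_blinfun T'"
    by (simp add: clinear_blinfun_def T'x B_scaleC riesz_projection_scaleC scaleC_scaleC mult.commute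
        scaleC_add_right flip: scaleC_diff_right)
  have PT': "P (T' x) = P x" for x
    by (simp add: T'x blinfun.add_right blinfun.diff_right riesz_projection_B
        riesz_projection_scaleC riesz_projection_idem[OF P])
  have T'T: "T' x = ?T x" if "P x = 0" for x using that by (simp add: T'x pencil_apply)
  have "x = 0" if "T' x = 0" for x
  proof -
    have "P x = 0" using PT'[of x] that by (simp add: blinfun.zero_right)
    moreover from this have "?T x = 0" using T'T that by simp
    then have "blinfun_pow ?T 1 x = 0" by simp
    ultimately show ?thesis using riesz_projection_fixes[OF P, of 1 x] by simp
  qed
  moreover have "T' = id_blinfun - (s0 - s) *\<^sub>C (B o\<^sub>L Q)"
    by (rule blinfun_eqI) (simp add: T'_def pencil_apply blinfun.diff_left scaleC_diff_left)
  ultimately obtain S where S: "blinfun_inverse_pair T' S"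
    using fredholm_inverse_pair[OF compact_blinfun_scaleC[OF compact_blinfun_compose_right[OF compB]]]
    by metis
  \<comment> \<open>Chosen so that \<open>(w - s) *\<^sub>C B\<close> stays below the threshold
    \<open>1 / 2\<close> of the perturbation lemma for \<open>w\<close> in the ball; the summand 1
    covers \<open>norm S * norm B = 0\<close>.\<close>
  define e where "e = 1 / (2 * (norm S * norm B + 1))"
  have pos: "norm S * norm B + 1 > 0" by (simp add: add_nonneg_pos)
  have e: "e > 0" using pos by (simp add: e_def)
  have "\<exists>V. blinfun_inverse_pair (T' + (w - s) *\<^sub>C B) V \<and> norm V \<le> 2 * norm S"
    if w: "w \<in> ball s e" for w
  proof -
    have "norm S * norm ((w - s) *\<^sub>C B) = cmod (w - s) * (norm S * norm B)"
      by (simp add: norm_scaleC)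
    also have "\<dots> \<le> e * (norm S * norm B + 1)"
      using w e by (intro mult_mono) (auto simp: dist_norm norm_minus_commute)
    also have "\<dots> = 1 / 2" using pos by (simp add: e_def field_simps)
    finally obtain V where "blinfun_inverse_pair (T' + (w - s) *\<^sub>C B) V" "norm V \<le> 2 * norm S"
      by (rule blinfun_inverse_pair_perturb[OF S])
    then show ?thesis by blast
  qed
  then obtain V where V: "\<And>w. w \<in> ball s e \<Longrightarrow> blinfun_inverse_pair (T' + (w - s) *\<^sub>C B) (V w)"
    "\<And>w. w \<in> ball s e \<Longrightarrow> norm (V w) \<le> 2 * norm S" by metis
  have Vhol: "vholomorphic_on V (ball s e)"
    by (rule vholomorphic_on_inverse[OF V clinT' clinB])
  define W where "W = (\<lambda>w. V w o\<^sub>L (B o\<^sub>L Q))"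
  have Whol: "vholomorphic_on W (ball s e)"
    unfolding W_def by (rule vholomorphic_on_compose_right[OF Vhol])
  have pen: "pencil B s0 w x = (T' + (w - s) *\<^sub>C B) x" if "P x = 0" for x w
    using that by (simp add: pencil_shift[of w x s] T'T blinfun.add_left)
  have Pcomm: "P ((T' + (w - s) *\<^sub>C B) x) = P x + (w - s) *\<^sub>C B (P x)" for w x
    by (simp add: blinfun.add_left blinfun.add_right PT' riesz_projection_scaleC riesz_projection_B)
  \<comment> \<open>The inverse preserves the kernel of \<open>P\<close>: as \<open>T'\<close> is
    the identity on the range of \<open>P\<close>, the vector \<open>P (V w x)\<close> solves the
    homogeneous equation.\<close>
  have V0: "P (V w x) = 0" if w: "w \<in> ball s e" and x: "P x = 0" for w x
  proof -
    have "P (V w x) + (w - s) *\<^sub>C B (P (V w x)) = 0"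
      using Pcomm[of w "V w x"] V(1)[OF w] x by (simp add: blinfun_inverse_pair_def)
    moreover have "T' (P v) = P v" for v by (simp add: T'x riesz_projection_idem[OF P] blinfun.zero_right)
    ultimately have "(T' + (w - s) *\<^sub>C B) (P (V w x)) = 0" by (simp add: blinfun.add_left)
    then show ?thesis using V(1)[OF w] by (metis blinfun_inverse_pair_def blinfun.zero_right)
  qed
  have inj: "v = 0" if w: "w \<in> ball s e - {s}" and v: "pencil B s0 w v = 0" for w v
  proof -
    have wb: "w \<in> ball s e" "w \<noteq> s" using w by auto
    have Pv: "pencil B s0 w (P v) = 0"
      using riesz_projection_pencil[of w v] v by (simp add: blinfun.zero_right)
    have P0: "P v = 0"
      by (rule nilpotent_part_injective[OF wb(2) Pv riesz_projection_idem[OF P]])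
    then have "(T' + (w - s) *\<^sub>C B) v = 0" using pen[OF P0, of w] v by simp
    then show ?thesis using V(1)[OF wb(1)] by (metis blinfun_inverse_pair_def blinfun.zero_right)
  qed
  have exp: "pencil_resolvent B s0 w = W w + (1 / (w - s)) *\<^sub>C P +
      (\<Sum>j<p. ((s - s0) * (w - s0) ^ j / (w - s) ^ (j + 2)) *\<^sub>C (blinfun_pow ?T (Suc j) o\<^sub>L P))"
    if w: "w \<in> ball s e - {s}" for w
  proof (rule blinfun_eqI)
    fix x
    have wb: "w \<in> ball s e" "w \<noteq> s" using w by auto
    let ?y = "(1 / (w - s)) *\<^sub>C P x +
      (\<Sum>j<p. ((s - s0) * (w - s0) ^ j / (w - s) ^ (j + 2)) *\<^sub>C blinfun_pow ?T (Suc j) (P x))"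
    have PBQ: "P (B (Q x)) = 0" by (simp add: riesz_projection_B PQ blinfun.zero_right)
    have "P (W w x) = 0" unfolding W_def using V0[OF wb(1) PBQ] by simp
    from pen[OF this, of w] have 1: "pencil B s0 w (W w x) = B (Q x)"
      using V(1)[OF wb(1)] by (simp add: W_def blinfun_inverse_pair_def)
    have 2: "pencil B s0 w ?y = B (P x)"
      by (rule nilpotent_part_resolvent[OF wb(2) riesz_projection_idem[OF P]])
    \<comment> \<open>The regular part solves the equation with right side \<open>B (Q x)\<close>
      and the nilpotent part the one with \<open>B (P x)\<close>; their sum has right side
      \<open>B x\<close>.\<close>
    have "pencil B s0 w (W w x + ?y) = B x"
      unfolding blinfun.add_right[of "pencil B s0 w" "W w x"] 1 2
      by (simp add: Qx blinfun.diff_right)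
    from pencil_resolvent_eqI[OF inj[OF w] this]
    show "pencil_resolvent B s0 w x = (W w + (1 / (w - s)) *\<^sub>C P +
      (\<Sum>j<p. ((s - s0) * (w - s0) ^ j / (w - s) ^ (j + 2)) *\<^sub>C (blinfun_pow ?T (Suc j) o\<^sub>L P))) x"
      by (simp add: blinfun.add_left blinfun.sum_left)
  qed
  show ?thesis by (rule that[OF e Whol inj exp])
qed

end

lemma vmeromorphic_pencil_resolvent: "vmeromorphic (pencil_resolvent B s0)"
  unfolding vmeromorphic_def
proof
  fix s
  obtain p P where P: "riesz_projection (pencil B s0 s) p P"
    using pencil_riesz_projection_exists by blast
  let ?T = "pencil B s0 s"
  obtain e W where e: "e > 0" and W: "vholomorphic_on W (ball s e)" and
    "\<And>w v. w \<in> ball s e - {s} \<Longrightarrow> pencil B s0 w v = 0 \<Longrightarrow> v = 0" and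
    exp: "\<And>w. w \<in> ball s e - {s} \<Longrightarrow> pencil_resolvent B s0 w = W w + (1 / (w - s)) *\<^sub>C P +
      (\<Sum>j<p. ((s - s0) * (w - s0) ^ j / (w - s) ^ (j + 2)) *\<^sub>C (blinfun_pow ?T (Suc j) o\<^sub>L P))"
    by (rule pencil_resolvent_laurent[OF P]) blast
  \<comment> \<open>The last summand \<open>j = p - 1\<close> has the denominator
    \<open>(w - s) ^ (p + 1)\<close>; this exponent also clears the simple pole when
    \<open>p = 0\<close>.\<close>
  define g where "g = (\<lambda>w. (w - s) ^ (p + 1) *\<^sub>C W w + (w - s) ^ p *\<^sub>C P +
    (\<Sum>j<p. ((s - s0) * (w - s0) ^ j * (w - s) ^ (p - 1 - j)) *\<^sub>C (blinfun_pow ?T (Suc j) o\<^sub>L P)))"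
  have "vholomorphic_on g (ball s e)"
    unfolding g_def
    by (intro vholomorphic_on_add vholomorphic_on_sum vholomorphic_on_scaleC W vholomorphic_on_const
        holomorphic_intros)
  moreover have "(w - s) ^ (p + 1) *\<^sub>C pencil_resolvent B s0 w = g w" if w: "w \<in> ball s e - {s}" for w
  proof -
    have ws: "w - s \<noteq> 0" using w by auto
    have "(w - s) ^ (p + 1) * (1 / (w - s)) = (w - s) ^ p" using ws by simp
    moreover have "(w - s) ^ (p + 1) * ((s - s0) * (w - s0) ^ j / (w - s) ^ (j + 2))
        = (s - s0) * (w - s0) ^ j * (w - s) ^ (p - 1 - j)" if "j < p" for j
    proof -
      have "p + 1 = (p - 1 - j) + (j + 2)" using that by simp
      then have "(w - s) ^ (p + 1) = (w - s) ^ (p - 1 - j) * (w - s) ^ (j + 2)"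
        by (metis power_add)
      then show ?thesis using ws by simp
    qed
    ultimately show ?thesis
      unfolding exp[OF w] g_def scaleC_add_right scaleC_sum_right scaleC_scaleC by simp
  qed
  ultimately show "\<exists>n g \<epsilon>. 0 < \<epsilon> \<and> vholomorphic_on g (ball s \<epsilon>) \<and>
      (\<forall>w\<in>ball s \<epsilon> - {s}. (w - s) ^ n *\<^sub>C pencil_resolvent B s0 w = g w)"
    using e by (intro exI[of _ "p + 1"] exI[of _ g] exI[of _ e]) blast
qed

text \<open>Apart from \<open>(1 / (w - s)) *\<^sub>C P\<close>, every term of the expansion is
  holomorphic or has a primitive on the circle. \<open>M\<close> only has to agree with the pencil
  resolvent near \<open>s\<close> off \<open>s\<close> itself, since that is all that is known about
  an abstract continuation.\<close>

lemma pencil_resolvent_residue: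
  assumes P: "riesz_projection (pencil B s0 s) p P"
    and M: "\<forall>\<^sub>F w in at s. M w = pencil_resolvent B s0 w"
  shows "\<forall>\<^sub>F r in at_right 0. (1 / (2 * of_real pi * \<i>)) *\<^sub>C vcontour_integral (circlepath s r) M = P"
proof -
  let ?T = "pencil B s0 s"
  obtain e W where e: "e > 0" and W: "vholomorphic_on W (ball s e)" and
    "\<And>w v. w \<in> ball s e - {s} \<Longrightarrow> pencil B s0 w v = 0 \<Longrightarrow> v = 0" and
    exp: "\<And>w. w \<in> ball s e - {s} \<Longrightarrow> pencil_resolvent B s0 w = W w + (1 / (w - s)) *\<^sub>C P +
      (\<Sum>j<p. ((s - s0) * (w - s0) ^ j / (w - s) ^ (j + 2)) *\<^sub>C (blinfun_pow ?T (Suc j) o\<^sub>L P))"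
    by (rule pencil_resolvent_laurent[OF P]) blast
  obtain d where d: "d > 0" "\<And>w. w \<noteq> s \<Longrightarrow> dist w s < d \<Longrightarrow> M w = pencil_resolvent B s0 w"
    using M unfolding eventually_at by auto
  have "(1 / (2 * of_real pi * \<i>)) *\<^sub>C vcontour_integral (circlepath s r) M = P"
    if r: "0 < r" "r < min e d" for r
  proof (rule matrix_element_eqI)
    fix k x
    \<comment> \<open>A bounded functional passes through the vector-valued integral and leaves a
      scalar contour integral.\<close>
    define \<phi> where "\<phi> = (\<lambda>X :: 'a \<Rightarrow>\<^sub>L 'a. cinner k (X x))"
    have \<phi>: "bounded_linear \<phi>" "\<And>c X. \<phi> (c *\<^sub>C X) = c * \<phi> X"
      unfolding \<phi>_def by (rule matrix_element(1)) (simp add: cinner_scaleC_right)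
    have on_circle: "w \<in> ball s e - {s}" "w \<noteq> s" "M w = pencil_resolvent B s0 w"
      if "w \<in> sphere s r" for w
      using that r d(2)[of w] by (auto simp: dist_commute)
    let ?R = "\<lambda>w. W w + (1 / (w - s)) *\<^sub>C P +
      (\<Sum>j<p. ((s - s0) * (w - s0) ^ j / (w - s) ^ (j + 2)) *\<^sub>C (blinfun_pow ?T (Suc j) o\<^sub>L P))"
    have MR: "M w = ?R w" if "w \<in> sphere s r" for w
      using on_circle[OF that] exp by simp
    have Mcont: "continuous_on (sphere s r) M"
    proof -
      have "vholomorphic_on ?R (ball s e - {s})"
        by (intro vholomorphic_on_add vholomorphic_on_sum vholomorphic_on_scaleC vholomorphic_on_const
            vholomorphic_on_subset[OF W] holomorphic_intros) auto
      from vholomorphic_on_continuous[OF this] have "continuous_on (sphere s r) ?R"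
        by (rule continuous_on_subset) (use on_circle in blast)
      then show ?thesis by (rule continuous_on_eq) (simp add: MR)
    qed
    have circ: "circlepath s r t \<in> sphere s r" for t
      using r(1) by (simp add: circlepath dist_norm norm_mult)
    have cont: "continuous_on {0..1} (\<lambda>t. vector_derivative (circlepath s r) (at t) *\<^sub>C M (circlepath s r t))"
    proof -
      have c1: "continuous_on {0..1} (circlepath s r)"
        using path_circlepath[of s r] by (simp add: path_def)
      have "continuous_on {0..1} (\<lambda>t. M (circlepath s r t))"
        by (rule continuous_on_compose2[OF Mcont c1]) (use circ in blast)
      moreover have "continuous_on {0..1} (\<lambda>t::real. vector_derivative (circlepath s r) (at t))"
        unfolding vector_derivative_circlepath by (intro continuous_intros)
      ultimately show ?thesis unfolding continuous_on_def by (intro ballI tendsto_scaleC) auto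
    qed
    have "\<phi> (vcontour_integral (circlepath s r) M) =
        integral {0..1} (\<phi> \<circ> (\<lambda>t. vector_derivative (circlepath s r) (at t) *\<^sub>C M (circlepath s r t)))"
      unfolding vcontour_integral_def
      by (rule integral_linear[OF integrable_continuous_real[OF cont] \<phi>(1), symmetric])
    also have "\<dots> = contour_integral (circlepath s r) (\<lambda>w. \<phi> (M w))"
      by (simp add: contour_integral_integral o_def \<phi>(2) mult.commute)
    also have "\<dots> = 2 * of_real pi * \<i> * \<phi> P"
    proof (rule contour_integral_unique)
      define b where "b = (\<lambda>j w. (s - s0) * (w - s0) ^ j / (w - s) ^ (j + 2))"
      have "((\<lambda>w. \<phi> (W w) + \<phi> P / (w - s) + (\<Sum>j<p. b j w * \<phi> (blinfun_pow ?T (Suc j) o\<^sub>L P)))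
          has_contour_integral (0 + 2 * of_real pi * \<i> * \<phi> P + (\<Sum>j<p. 0))) (circlepath s r)"
      proof (intro has_contour_integral_add has_contour_integral_sum)
        have "(\<lambda>w. \<phi> (W w)) holomorphic_on ball s e"
          unfolding \<phi>_def by (rule matrix_element_holomorphic[OF W])
        then show "((\<lambda>w. \<phi> (W w)) has_contour_integral 0) (circlepath s r)"
          by (rule Cauchy_theorem_convex_simple) (use r circ in \<open>auto simp: path_image_circlepath\<close>)
        show "((\<lambda>w. \<phi> P / (w - s)) has_contour_integral 2 * of_real pi * \<i> * \<phi> P) (circlepath s r)"
          by (rule Cauchy_integral_circlepath_simple) (use r in auto)
        fix j
        show "((\<lambda>w. b j w * \<phi> (blinfun_pow ?T (Suc j) o\<^sub>L P)) has_contour_integral 0) (circlepath s r)"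
        proof -
          \<comment> \<open>A primitive of \<open>b j\<close>: the derivative of
            \<open>(w - s0) / (w - s)\<close> is \<open>- (s - s0) / (w - s)\<^sup>2\<close>, so
            \<open>b j\<close> is a multiple of the derivative of the power \<open>Suc j\<close> of
            this quotient.\<close>
          define G where "G = (\<lambda>w. - (1 / of_nat (Suc j)) * ((w - s0) / (w - s)) ^ Suc j)"
          have "(G has_field_derivative b j w) (at w within sphere s r)" if "w \<in> sphere s r" for w
          proof -
            have ws: "w - s \<noteq> 0" using on_circle(2)[OF that] by simp
            have q: "((\<lambda>w. (w - s0) / (w - s)) has_field_derivative (- (s - s0) / (w - s)\<^sup>2)) (at w within sphere s r)"
              using ws by (auto intro!: derivative_eq_intros simp: power2_eq_square) 
            have "((\<lambda>w. ((w - s0) / (w - s)) ^ Suc j) has_field_derivative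
                of_nat (Suc j) * ((- (s - s0) / (w - s)\<^sup>2) * ((w - s0) / (w - s)) ^ j)) (at w within sphere s r)"
              using DERIV_power[OF q, of "Suc j"] by simp
            from DERIV_cmult[OF this, of "- (1 / of_nat (Suc j))"]
            have "(G has_field_derivative - (1 / of_nat (Suc j)) *
                (of_nat (Suc j) * ((- (s - s0) / (w - s)\<^sup>2) * ((w - s0) / (w - s)) ^ j))) (at w within sphere s r)"
              by (simp only: G_def)
            moreover have "- (1 / of_nat (Suc j)) *
                (of_nat (Suc j) * ((- (s - s0) / (w - s)\<^sup>2) * ((w - s0) / (w - s)) ^ j)) = b j w"
            proof -
              have gen: "- (1 / n) * (n * ((- a / d) * q)) = a / d * q" if "n \<noteq> 0" for n a d q :: complex
                using that by simp
              have "(s - s0) / (w - s)\<^sup>2 * ((w - s0) / (w - s)) ^ j = b j w"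
                by (simp add: b_def power_divide power_add power2_eq_square)
              then show ?thesis by (rule trans[OF gen[OF of_nat_neq_0]])
            qed
            ultimately show ?thesis by simp
          qed
          from contour_integral_primitive[OF this, of "circlepath s r"]
          have "(b j has_contour_integral 0) (circlepath s r)"
            using r(1) by (simp add: path_image_circlepath)
          from has_contour_integral_rmul[OF this] show ?thesis by simp
        qed
      qed simp
      then have "((\<lambda>w. \<phi> (W w) + \<phi> P / (w - s) + (\<Sum>j<p. b j w * \<phi> (blinfun_pow ?T (Suc j) o\<^sub>L P)))
          has_contour_integral (2 * of_real pi * \<i> * \<phi> P)) (circlepath s r)" by simp
      then show "((\<lambda>w. \<phi> (M w)) has_contour_integral 2 * of_real pi * \<i> * \<phi> P) (circlepath s r)"
      proof (rule has_contour_integral_eq)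
        fix w assume "w \<in> path_image (circlepath s r)"
        then have w: "w \<in> sphere s r" using r(1) by (simp add: path_image_circlepath)
        show "\<phi> (W w) + \<phi> P / (w - s) + (\<Sum>j<p. b j w * \<phi> (blinfun_pow ?T (Suc j) o\<^sub>L P)) = \<phi> (M w)"
          unfolding MR[OF w] b_def
          by (simp add: \<phi>(2) linear_add[OF bounded_linear.linear[OF \<phi>(1)]]
              linear_sum[OF bounded_linear.linear[OF \<phi>(1)]])
      qed
    qed
    finally show "cinner k (((1 / (2 * of_real pi * \<i>)) *\<^sub>C vcontour_integral (circlepath s r) M) x)
        = cinner k (P x)"
      unfolding \<phi>_def by (simp add: cinner_scaleC_right)
  qed
  then show ?thesis
    unfolding eventually_at_right_field using e d(1) by (intro exI[of _ "min e d"]) auto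
qed

end

section \<open>Identity theorem for meromorphic operator functions\<close>

lemma vmeromorphic_diff:
  assumes "vmeromorphic f" "vmeromorphic g"
  shows "vmeromorphic (\<lambda>w. f w - g w)"
  unfolding vmeromorphic_def
proof
  fix s
  obtain n1 g1 e1 where 1: "0 < e1" "vholomorphic_on g1 (ball s e1)"
    "\<And>w. w \<in> ball s e1 - {s} \<Longrightarrow> (w - s) ^ n1 *\<^sub>C f w = g1 w"
    using assms(1) unfolding vmeromorphic_def by metis
  obtain n2 g2 e2 where 2: "0 < e2" "vholomorphic_on g2 (ball s e2)"
    "\<And>w. w \<in> ball s e2 - {s} \<Longrightarrow> (w - s) ^ n2 *\<^sub>C g w = g2 w"
    using assms(2) unfolding vmeromorphic_def by metis
  define h where "h = (\<lambda>w. (w - s) ^ n2 *\<^sub>C g1 w + (- ((w - s) ^ n1)) *\<^sub>C g2 w)"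
  have "vholomorphic_on h (ball s (min e1 e2))"
    unfolding h_def
    by (intro vholomorphic_on_add vholomorphic_on_scaleC holomorphic_intros
        vholomorphic_on_subset[OF 1(2)] vholomorphic_on_subset[OF 2(2)]) auto
  moreover have "(w - s) ^ (n1 + n2) *\<^sub>C (f w - g w) = h w" if "w \<in> ball s (min e1 e2) - {s}" for w
  proof -
    have "w \<in> ball s e1 - {s}" "w \<in> ball s e2 - {s}" using that by auto
    then have "h w = (w - s) ^ n2 *\<^sub>C (w - s) ^ n1 *\<^sub>C f w - (w - s) ^ n1 *\<^sub>C (w - s) ^ n2 *\<^sub>C g w"
      by (simp add: h_def 1(3) 2(3) scaleC_minus_left)
    then show ?thesis
      by (simp add: scaleC_scaleC scaleC_diff_right power_add mult.commute)
  qed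
  ultimately show "\<exists>n h \<epsilon>. 0 < \<epsilon> \<and> vholomorphic_on h (ball s \<epsilon>) \<and>
      (\<forall>w\<in>ball s \<epsilon> - {s}. (w - s) ^ n *\<^sub>C (f w - g w) = h w)"
    using 1(1) 2(1) by (intro exI[of _ "n1 + n2"] exI[of _ h] exI[of _ "min e1 e2"]) simp
qed

text \<open>After the pole is cleared, every matrix element is a scalar holomorphic function whose
  zeros accumulate at the centre of the ball, hence is identically zero.\<close>

lemma vmeromorphic_zero_local:
  fixes f :: "complex \<Rightarrow> ('a::complex_normed_vector \<Rightarrow>\<^sub>L 'b::chilbert_space)"
  assumes f: "vmeromorphic f" and s: "s islimpt {w. f w = 0}"
  shows "\<forall>\<^sub>F w in at s. f w = 0"
proof -
  obtain n g e where g: "0 < e" "vholomorphic_on g (ball s e)"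
    "\<And>w. w \<in> ball s e - {s} \<Longrightarrow> (w - s) ^ n *\<^sub>C f w = g w"
    using f unfolding vmeromorphic_def by metis
  define U where "U = {w \<in> ball s e - {s}. f w = 0}"
  have "s islimpt U"
    unfolding islimpt_approachable
  proof (intro allI impI)
    fix d :: real assume "0 < d"
    then have "0 < min d e" using g(1) by simp
    then obtain w where "w \<in> {w. f w = 0}" "w \<noteq> s" "dist w s < min d e"
      using s unfolding islimpt_approachable by metis
    then show "\<exists>w\<in>U. w \<noteq> s \<and> dist w s < d"
      by (intro bexI[of _ w]) (auto simp: U_def dist_commute)
  qed
  have "g w = 0" if w: "w \<in> ball s e" for w
  proof (rule matrix_element_eqI)
    fix k x
    have "cinner k (g w x) = 0"
    proof (rule analytic_continuation[of "\<lambda>w. cinner k (g w x)" "ball s e" U s])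
      show "(\<lambda>w. cinner k (g w x)) holomorphic_on ball s e"
        by (rule matrix_element_holomorphic[OF g(2)])
      show "cinner k (g z x) = 0" if "z \<in> U" for z
      proof -
        have "z \<in> ball s e - {s}" "f z = 0" using that by (auto simp: U_def)
        from g(3)[OF this(1)] this(2) have "g z = 0" by simp
        then show ?thesis
          using linear_0[OF bounded_linear.linear[OF bounded_linear_cinner_right]] by simp
      qed
    qed (use g(1) w \<open>s islimpt U\<close> in \<open>auto simp: U_def\<close>)
    then show "cinner k (g w x) = cinner k ((0 :: 'a \<Rightarrow>\<^sub>L 'b) x)"
      using linear_0[OF bounded_linear.linear[OF bounded_linear_cinner_right]] by simp
  qed
  then have "f w = 0" if "w \<in> ball s e - {s}" for w
    using g(3)[OF that] that by auto
  then show ?thesis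
    unfolding eventually_at using g(1) by (intro exI[of _ e]) (auto simp: dist_commute)
qed

lemma vmeromorphic_identity:
  fixes f g :: "complex \<Rightarrow> ('a::complex_normed_vector \<Rightarrow>\<^sub>L 'b::chilbert_space)"
  assumes "vmeromorphic f" "vmeromorphic g" "s0 islimpt {w. f w = g w}"
  shows "\<forall>\<^sub>F w in at s. f w = g w"
proof -
  define h where "h = (\<lambda>w. f w - g w)"
  have h: "vmeromorphic h" unfolding h_def by (rule vmeromorphic_diff[OF assms(1,2)])
  \<comment> \<open>Punctured neighbourhoods, because values at poles are arbitrary. The set is open
    and closed, so connectedness of the plane makes it everything.\<close>
  define Z where "Z = {s. \<forall>\<^sub>F w in at s. h w = 0}"
  have "s0 islimpt {w. h w = 0}" using assms(3) by (simp add: h_def)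
  from vmeromorphic_zero_local[OF h this] have "s0 \<in> Z" by (simp add: Z_def)
  have Zball: "\<exists>d>0. ball z d \<subseteq> Z" if zZ: "z \<in> Z" for z
  proof -
    obtain d where d: "d > 0" "\<And>w. w \<noteq> z \<Longrightarrow> dist w z < d \<Longrightarrow> h w = 0"
      using zZ unfolding Z_def eventually_at by auto
    have "w \<in> Z" if w: "w \<in> ball z d" for w
    proof (cases "w = z")
      case False
      have "open (ball z d - {z})" by (intro open_Diff open_ball closed_singleton)
      moreover have "w \<in> ball z d - {z}" using w False by simp
      ultimately have "\<forall>\<^sub>F v in at w. v \<in> ball z d - {z}" by (rule eventually_at_in_open')
      then have "\<forall>\<^sub>F v in at w. h v = 0"
        by (rule eventually_mono) (auto intro: d(2) simp: dist_commute)
      then show ?thesis by (simp add: Z_def)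
    qed (use zZ in simp)
    with d(1) show ?thesis by blast
  qed
  then have "open Z" unfolding open_contains_ball by blast
  moreover have "closed Z"
    unfolding closed_limpt
  proof (intro allI impI)
    fix z assume z: "z islimpt Z"
    have "z islimpt {w. h w = 0}"
      unfolding islimpt_approachable
    proof (intro allI impI)
      fix e :: real assume "0 < e"
      then obtain y where y: "y \<in> Z" "y \<noteq> z" "dist y z < e"
        using z unfolding islimpt_approachable by metis
      have "\<forall>\<^sub>F w in at y. w \<in> ball z e - {z}"
        by (rule eventually_at_in_open') (use y in \<open>auto simp: dist_commute open_Diff\<close>)
      moreover have "\<forall>\<^sub>F w in at y. h w = 0" using y(1) by (simp add: Z_def)
      ultimately have "\<forall>\<^sub>F w in at y. w \<in> ball z e - {z} \<and> h w = 0" by (rule eventually_conj)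
      from eventually_happens'[OF at_neq_bot this] obtain w where "w \<in> ball z e - {z} \<and> h w = 0" ..
      then show "\<exists>w\<in>{w. h w = 0}. w \<noteq> z \<and> dist w z < e"
        by (intro bexI[of _ w]) (auto simp: dist_commute)
    qed
    from vmeromorphic_zero_local[OF h this] show "z \<in> Z" by (simp add: Z_def)
  qed
  ultimately have "Z = UNIV" using \<open>s0 \<in> Z\<close> clopen[of Z] by blast
  then show ?thesis by (auto simp: Z_def h_def)
qed

section \<open>Sandwiched resolvents\<close>

lemma cinner_add_left: "cinner (x + y) z = cinner x z + cinner y (z :: 'a::chilbert_space)"
  by (metis cinner_add_right cinner_commute complex_cnj_add)

lemma cinner_scaleC_left: "cinner (c *\<^sub>C x) y = cnj c * cinner x (y :: 'a::chilbert_space)"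
  by (metis cinner_commute cinner_scaleC_right complex_cnj_mult)

lemma cinner_scaleR_right: "cinner x (t *\<^sub>R y) = of_real t * cinner x (y :: 'a::chilbert_space)"
  by (simp add: cinner_scaleC_right flip: scaleC_of_real)

lemma cinner_scaleR_left: "cinner (t *\<^sub>R x) y = of_real t * cinner x (y :: 'a::chilbert_space)"
  by (simp add: cinner_scaleC_left flip: scaleC_of_real)

lemma cinner_zero_right [simp]: "cinner x (0 :: 'a::chilbert_space) = 0"
  using cinner_add_right[of x 0 0] by simp

lemma cinner_zero_left [simp]: "cinner 0 (x :: 'a::chilbert_space) = 0"
  using cinner_add_left[of 0 0 x] by simp

lemma cinner_diff_right: "cinner x (y - z) = cinner x y - cinner x (z :: 'a::chilbert_space)"
  using cinner_add_right[of x "y - z" z] by simp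

lemma cinner_diff_left: "cinner (x - y) z = cinner x z - cinner y (z :: 'a::chilbert_space)"
  using cinner_add_left[of "x - y" y z] by simp

lemma cinner_self: "cinner x x = of_real ((norm (x :: 'a::chilbert_space))\<^sup>2)"
proof -
  have "Im (cinner x x) = 0" using cinner_commute[of x x] by (simp add: complex_eq_iff)
  then show ?thesis by (simp add: complex_eq_iff Re_cinner power2_norm_eq_inner)
qed

lemma cinner_eq_0_if_inner_eq_0:
  assumes "inner u v = 0" "inner u ((- \<i>) *\<^sub>C v) = 0"
  shows "cinner u v = 0"
  using assms by (simp add: complex_eq_iff Re_cinner Im_cinner)

lemma tendsto_cinner:
  fixes f g :: "'b \<Rightarrow> 'a::chilbert_space"
  assumes "(f \<longlongrightarrow> a) F" "(g \<longlongrightarrow> b) F"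
  shows "((\<lambda>x. cinner (f x) (g x)) \<longlongrightarrow> cinner a b) F"
proof -
  have eq: "cinner x y = of_real (inner x y) + \<i> * of_real (inner x ((- \<i>) *\<^sub>C y))" for x y :: 'a
    by (simp add: complex_eq_iff Re_cinner Im_cinner)
  show ?thesis unfolding eq
    by (intro tendsto_intros assms bounded_linear.tendsto[OF bounded_linear_scaleC])
qed

lemma blinfun_dense_induct:
  fixes S :: "'a::metric_space set"
  assumes "closure S = UNIV" "closed {x. Q x}" "\<And>x. x \<in> S \<Longrightarrow> Q x"
  shows "Q x"
proof -
  have "closure S \<subseteq> {x. Q x}" using assms(2,3) by (intro closure_minimal) auto
  then show ?thesis using assms(1) by auto
qed

lemma linear_op_add: "linear_op G \<Longrightarrow> (x, y) \<in> G \<Longrightarrow> (x', y') \<in> G \<Longrightarrow> (x + x', y + y') \<in> G"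
  unfolding linear_op_def by blast

lemma linear_op_scaleC: "linear_op G \<Longrightarrow> (x, y) \<in> G \<Longrightarrow> (c *\<^sub>C x, c *\<^sub>C y) \<in> G"
  unfolding linear_op_def by blast

lemma linear_op_scaleR: "linear_op G \<Longrightarrow> (x, y) \<in> G \<Longrightarrow> (a *\<^sub>R x, a *\<^sub>R y) \<in> G"
  using linear_op_scaleC[of G x y "complex_of_real a"] by (simp only: scaleC_of_real)

lemma linear_op_diff: "linear_op G \<Longrightarrow> (x, y) \<in> G \<Longrightarrow> (x', y') \<in> G \<Longrightarrow> (x - x', y - y') \<in> G"
  using linear_op_add[of G x y "- x'" "- y'"] linear_op_scaleR[of G x' y' "-1"] by simp

lemma linear_op_unique: "linear_op G \<Longrightarrow> (x, y) \<in> G \<Longrightarrow> (x, y') \<in> G \<Longrightarrow> y = y'"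
  unfolding linear_op_def single_valued_def by blast

lemma linear_op_zero: "linear_op G \<Longrightarrow> (0, 0) \<in> G"
  unfolding linear_op_def by blast

lemma linear_op_subspace: "linear_op G \<Longrightarrow> subspace G"
  unfolding subspace_def
  by (auto simp: zero_prod_def linear_op_zero linear_op_scaleR intro: linear_op_add)

lemma op_adjointD: "(u, w) \<in> op_adjoint G \<Longrightarrow> (x, y) \<in> G \<Longrightarrow> cinner u y = cinner w x"
  unfolding op_adjoint_def by blast

lemma op_adjointI: "(\<And>x y. (x, y) \<in> G \<Longrightarrow> cinner u y = cinner w x) \<Longrightarrow> (u, w) \<in> op_adjoint G"
  unfolding op_adjoint_def by blast

lemma subspace_closure:
  fixes S :: "'a::real_normed_vector set"
  assumes "subspace S"
  shows "subspace (closure S)"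
  unfolding subspace_def
proof (intro conjI ballI allI)
  show "0 \<in> closure S" using subspace_0[OF assms] closure_subset by blast
next
  fix x y assume "x \<in> closure S" "y \<in> closure S"
  then obtain f g where f: "\<And>n. f n \<in> S" "f \<longlonglongrightarrow> x" and g: "\<And>n. g n \<in> S" "g \<longlonglongrightarrow> y"
    unfolding closure_sequential by metis
  have "f n + g n \<in> S" for n using f(1) g(1) assms by (simp add: subspace_add)
  then show "x + y \<in> closure S"
    unfolding closure_sequential using tendsto_add[OF f(2) g(2)]
    by (intro exI[of _ "\<lambda>n. f n + g n"] conjI allI)
next
  fix c x assume "x \<in> closure S"
  then obtain f where f: "\<And>n. f n \<in> S" "f \<longlonglongrightarrow> x"
    unfolding closure_sequential by metis
  have "c *\<^sub>R f n \<in> S" for n using f(1) assms by (simp add: subspace_scale)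
  then show "c *\<^sub>R x \<in> closure S"
    unfolding closure_sequential using tendsto_scaleR[OF tendsto_const f(2)]
    by (intro exI[of _ "\<lambda>n. c *\<^sub>R f n"] conjI allI)
qed

lemma subspace_Domain_op_adjoint: "subspace (Domain (op_adjoint G))"
  unfolding subspace_def
proof (intro conjI ballI allI)
  show "0 \<in> Domain (op_adjoint G)" by (rule DomainI[of 0 0]) (simp add: op_adjoint_def case_prod_beta)
next
  fix x y assume "x \<in> Domain (op_adjoint G)" "y \<in> Domain (op_adjoint G)"
  then obtain a b where "(x, a) \<in> op_adjoint G" "(y, b) \<in> op_adjoint G" by blast
  then have "(x + y, a + b) \<in> op_adjoint G"
    by (intro op_adjointI) (simp add: cinner_add_left op_adjointD)
  then show "x + y \<in> Domain (op_adjoint G)" by blast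
next
  fix c x assume "x \<in> Domain (op_adjoint G)"
  then obtain a where "(x, a) \<in> op_adjoint G" by blast
  then have "(c *\<^sub>R x, c *\<^sub>R a) \<in> op_adjoint G"
    by (intro op_adjointI) (simp add: cinner_scaleC_left op_adjointD flip: scaleC_of_real)
  then show "c *\<^sub>R x \<in> Domain (op_adjoint G)" by blast
qed

text \<open>A vector \<open>k\<close> orthogonal to the domain of the adjoint makes \<open>(0, k)\<close> orthogonal to the
  orthogonal complement of the graph.\<close>

lemma densely_defined_op_adjoint:
  fixes G :: "('a::chilbert_space \<times> 'b::chilbert_space) set"
  assumes lin: "linear_op G" and cl: "closed G"
  shows "closure (Domain (op_adjoint G)) = UNIV"
proof (rule closed_subspace_eq_UNIV)
  fix k :: 'b assume k: "\<And>y. y \<in> closure (Domain (op_adjoint G)) \<Longrightarrow> inner k y = 0"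
  obtain p where p: "p \<in> G" "\<And>g. g \<in> G \<Longrightarrow> inner ((0, k) - p) g = 0"
    using closed_subspace_projection[OF cl linear_op_subspace[OF lin]] by blast
  obtain a b where ab: "p = (a, b)" by (cases p)
  have o: "inner (k - b) y = inner a x" if "(x, y) \<in> G" for x y
    using p(2)[OF that] by (simp add: ab inner_Pair)
  have "(k - b, a) \<in> op_adjoint G"
  proof (rule op_adjointI)
    fix x y assume xy: "(x, y) \<in> G"
    show "cinner (k - b) y = cinner a x"
      using o[OF xy] o[OF linear_op_scaleC[OF lin xy, of "- \<i>"]]
      by (simp add: complex_eq_iff Re_cinner Im_cinner)
  qed
  then have "inner k (k - b) = 0" using k closure_subset by blast
  moreover have "inner (k - b) b = inner a a" using o p(1) ab by blast
  ultimately have "(norm (k - b))\<^sup>2 + (norm a)\<^sup>2 = 0"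
    by (simp add: power2_norm_eq_inner inner_diff_left inner_diff_right inner_commute)
  then have "k = b" "a = 0" by (simp_all add: sum_power2_eq_zero_iff)
  then have "(0, k) \<in> G" using p(1) ab by simp
  then show "k = 0" using linear_op_unique[OF lin _ linear_op_zero[OF lin]] by blast
qed (simp_all add: subspace_closure subspace_Domain_op_adjoint)

lemma self_adjoint_linear_op: "self_adjoint G \<Longrightarrow> linear_op G"
  by (simp add: self_adjoint_def)

lemma self_adjoint_symmetric:
  "self_adjoint G \<Longrightarrow> (x, y) \<in> G \<Longrightarrow> (x', y') \<in> G \<Longrightarrow> cinner x y' = cinner y x'"
  unfolding self_adjoint_def by (metis op_adjointD)

lemma self_adjoint_closed:
  assumes "self_adjoint G" "\<And>n. (x n, y n) \<in> G" "x \<longlonglongrightarrow> a" "y \<longlonglongrightarrow> b"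
  shows "(a, b) \<in> G"
proof -
  have "(a, b) \<in> op_adjoint G"
  proof (rule op_adjointI)
    fix x' y' assume g: "(x', y') \<in> G"
    have "(\<lambda>n. cinner (x n) y') \<longlonglongrightarrow> cinner a y'" by (intro tendsto_cinner assms tendsto_const)
    moreover have "(\<lambda>n. cinner (x n) y') \<longlonglongrightarrow> cinner b x'"
      unfolding self_adjoint_symmetric[OF assms(1,2) g] by (intro tendsto_cinner assms tendsto_const)
    ultimately show "cinner a y' = cinner b x'" by (rule LIMSEQ_unique)
  qed
  then show ?thesis using assms(1) by (simp add: self_adjoint_def)
qed

text \<open>By symmetry \<open>cinner y x\<close> is real, and conjugate linearity in the first
  argument turns \<open>- z\<close> into \<open>- cnj z\<close>, whence the positive sign. Both the
  resolvent bound and the positivity of the sandwiched resolvent rest on this identity.\<close>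

lemma self_adjoint_Im:
  assumes "self_adjoint G" "(x, y) \<in> G"
  shows "Im (cinner (y - z *\<^sub>C x) x) = Im z * (norm x)\<^sup>2"
proof -
  have "cinner x y = cinner y x" using self_adjoint_symmetric[OF assms(1,2,2)] .
  then have "Im (cinner y x) = 0" using cinner_commute[of x y] by (simp add: complex_eq_iff)
  then show ?thesis by (simp add: cinner_diff_left cinner_scaleC_left cinner_self)
qed

lemma self_adjoint_bounded_below:
  assumes "self_adjoint G" "(x, y) \<in> G"
  shows "\<bar>Im z\<bar> * norm x \<le> norm (y - z *\<^sub>C x)"
proof (cases "x = 0")
  case False
  let ?v = "y - z *\<^sub>C x"
  have "\<bar>Im z\<bar> * (norm x)\<^sup>2 = \<bar>Im (cinner ?v x)\<bar>"
    by (simp add: self_adjoint_Im[OF assms] abs_mult)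
  also have "\<dots> = \<bar>inner ?v ((- \<i>) *\<^sub>C x)\<bar>" by (simp only: Im_cinner)
  also have "\<dots> \<le> norm ?v * norm ((- \<i>) *\<^sub>C x)" by (rule Cauchy_Schwarz_ineq2)
  also have "\<dots> = norm ?v * norm x" by (simp add: norm_scaleC)
  finally show ?thesis using False by (simp add: power2_eq_square mult.assoc[symmetric])
qed simp

text \<open>The lower bound \<open>\<bar>Im z\<bar>\<close> makes the range of \<open>G - z\<close>
  closed, and a vector orthogonal to it is an eigenvector of \<open>G\<close> for the non-real
  number \<open>cnj z\<close>, hence 0.\<close>

lemma self_adjoint_resolvent_surj:
  assumes G: "self_adjoint G" and z: "Im z \<noteq> 0"
  obtains x y where "(x, y) \<in> G" "y - z *\<^sub>C x = v"
proof -
  note lin = self_adjoint_linear_op[OF G]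
  define R where "R = {y - z *\<^sub>C x | x y. (x, y) \<in> G}"
  have RI: "y - z *\<^sub>C x \<in> R" if "(x, y) \<in> G" for x y using that by (auto simp: R_def)
  have RC: "c *\<^sub>C v \<in> R" if vR: "v \<in> R" for c v
  proof -
    obtain x y where xy: "(x, y) \<in> G" "v = y - z *\<^sub>C x" using vR by (auto simp: R_def)
    have "c *\<^sub>C v = c *\<^sub>C y - z *\<^sub>C (c *\<^sub>C x)"
      by (simp add: xy(2) scaleC_diff_right scaleC_scaleC mult.commute)
    then show ?thesis using RI[OF linear_op_scaleC[OF lin xy(1)]] by simp
  qed
  have "R = UNIV"
  proof (rule closed_subspace_eq_UNIV)
    show "subspace R"
      unfolding subspace_def
    proof (intro conjI ballI allI)
      show "0 \<in> R" using RI[OF linear_op_zero[OF lin]] by simp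
    next
      fix v v' assume "v \<in> R" "v' \<in> R"
      then obtain x y x' y' where xy: "(x, y) \<in> G" "v = y - z *\<^sub>C x"
        and xy': "(x', y') \<in> G" "v' = y' - z *\<^sub>C x'"
        unfolding R_def by blast
      have "v + v' = y + y' - z *\<^sub>C (x + x')" by (simp add: xy(2) xy'(2) scaleC_add_right)
      then show "v + v' \<in> R" using RI[OF linear_op_add[OF lin xy(1) xy'(1)]] by simp
    next
      fix c v assume "v \<in> R"
      from RC[OF this, of "complex_of_real c"] show "c *\<^sub>R v \<in> R" by (simp only: scaleC_of_real)
    qed
    show "closed R"
      unfolding closed_sequential_limits
    proof (intro allI impI)
      fix v l assume vl: "(\<forall>n. v n \<in> R) \<and> v \<longlonglongrightarrow> l"
      then have "\<forall>n. \<exists>x y. (x, y) \<in> G \<and> v n = y - z *\<^sub>C x" unfolding R_def by blast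
      then obtain x y where xy: "\<And>n. (x n, y n) \<in> G" "\<And>n. v n = y n - z *\<^sub>C x n" by metis
      have "Cauchy x"
      proof (rule metric_CauchyI)
        fix e :: real assume "0 < e"
        then have "0 < \<bar>Im z\<bar> * e" using z by simp
        then obtain N where N: "\<And>m n. m \<ge> N \<Longrightarrow> n \<ge> N \<Longrightarrow> dist (v m) (v n) < \<bar>Im z\<bar> * e"
          using metric_CauchyD[OF LIMSEQ_imp_Cauchy[OF conjunct2[OF vl]]] by metis
        have "dist (x m) (x n) < e" if "m \<ge> N" "n \<ge> N" for m n
        proof -
          have "\<bar>Im z\<bar> * norm (x m - x n) \<le> norm (y m - y n - z *\<^sub>C (x m - x n))"
            by (rule self_adjoint_bounded_below[OF G linear_op_diff[OF lin xy(1) xy(1)]])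
          also have "y m - y n - z *\<^sub>C (x m - x n) = v m - v n"
            by (simp add: xy(2) scaleC_diff_right)
          finally have "\<bar>Im z\<bar> * norm (x m - x n) < \<bar>Im z\<bar> * e"
            using N[OF that] by (simp add: dist_norm)
          then show ?thesis using z by (simp add: dist_norm)
        qed
        then show "\<exists>N. \<forall>m\<ge>N. \<forall>n\<ge>N. dist (x m) (x n) < e" by blast
      qed
      then obtain a where a: "x \<longlonglongrightarrow> a" using Cauchy_convergent_iff convergent_def by blast
      have "(\<lambda>n. v n + z *\<^sub>C x n) \<longlonglongrightarrow> l + z *\<^sub>C a"
        by (intro tendsto_add conjunct2[OF vl] tendsto_scaleC tendsto_const a)
      then have "y \<longlonglongrightarrow> l + z *\<^sub>C a" by (simp add: xy(2))
      from RI[OF self_adjoint_closed[OF G xy(1) a this]] show "l \<in> R" by simp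
    qed
    fix u assume u: "\<And>v. v \<in> R \<Longrightarrow> inner u v = 0"
    \<comment> \<open>The range is closed under complex scalars, so real orthogonality to it is
      complex orthogonality.\<close>
    have "(u, cnj z *\<^sub>C u) \<in> op_adjoint G"
    proof (rule op_adjointI)
      fix x y assume "(x, y) \<in> G"
      from RI[OF this] have "cinner u (y - z *\<^sub>C x) = 0"
        by (intro cinner_eq_0_if_inner_eq_0 u RC)
      then show "cinner u y = cinner (cnj z *\<^sub>C u) x"
        by (simp add: cinner_diff_right cinner_scaleC_right cinner_scaleC_left)
    qed
    then have "(u, cnj z *\<^sub>C u) \<in> G" using G by (simp add: self_adjoint_def)
    from self_adjoint_bounded_below[OF G this, of "cnj z"] z show "u = 0"
      by (simp add: mult_le_0_iff)
  qed
  then have "v \<in> R" by simp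
  then show ?thesis using that unfolding R_def by blast
qed

lemma op_graph_iff: "(x, y) \<in> op_graph A \<longleftrightarrow> y = A x"
  by (auto simp: op_graph_def)

lemma linear_op_graph: "linear_op (op_graph A) \<Longrightarrow> clinear_blinfun A"
  unfolding clinear_blinfun_def using linear_op_scaleC[of "op_graph A"] by (metis op_graph_iff)

lemma compact_op_graph:
  assumes "compact_op (op_graph A)"
  shows "compact_blinfun A" "clinear_blinfun A"
proof -
  have "op_graph A `` cball 0 1 = blinfun_apply A ` cball 0 1" by (auto simp: op_graph_def)
  then show "compact_blinfun A" "clinear_blinfun A"
    using assms linear_op_graph by (auto simp: compact_op_def compact_blinfun_def)
qed

lemma closed_Collect_eq_tendsto:
  fixes f g :: "'x::t2_space \<Rightarrow> complex"
  assumes "\<And>x. (f \<longlongrightarrow> f x) (at x)" "\<And>x. (g \<longlongrightarrow> g x) (at x)"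
  shows "closed {x. f x = g x}"
  using assms by (intro closed_Collect_eq) (simp_all add: continuous_on_def tendsto_within_subset[OF _ subset_UNIV])

section \<open>The sandwiched resolvent off the real axis\<close>

context resonance_line
begin

lemma J_symmetric: "cinner x (J y) = cinner (J x) y"
  using self_adjoint_symmetric[OF J_self_adjoint] by (simp add: op_graph_iff)

lemma J_clinear: "clinear_blinfun J"
  by (rule linear_op_graph[OF self_adjoint_linear_op[OF J_self_adjoint]])

lemma adjoint_dense: "closure (Domain (op_adjoint F)) = UNIV"
  by (rule densely_defined_op_adjoint[OF F_linear F_closed])

lemma sandwich_composite:
  assumes z: "Im z \<noteq> 0" and u: "u \<in> Domain (op_adjoint F)"
  obtains w x y v where "(u, w) \<in> op_adjoint F" "(x, y) \<in> H r" "y - z *\<^sub>C x = w" "(x, v) \<in> F"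
    "(u, v) \<in> op_adjoint F O resolvent (H r) z O F"
proof -
  obtain w where w: "(u, w) \<in> op_adjoint F" using u by blast
  obtain x y where xy: "(x, y) \<in> H r" "y - z *\<^sub>C x = w"
    by (rule self_adjoint_resolvent_surj[OF H_self_adjoint z])
  have "x \<in> Domain F" using xy(1) H_domain[of r] D_subset by blast
  then obtain v where v: "(x, v) \<in> F" by blast
  have "(w, x) \<in> resolvent (H r) z" using xy by (auto simp: resolvent_def)
  with w v have "(u, v) \<in> op_adjoint F O resolvent (H r) z O F" by blast
  then show ?thesis by (rule that[OF w xy v])
qed

text \<open>The description defining \<open>sandwich\<close> is unique: the composite is defined on
  the whole domain of the adjoint of \<open>F\<close>, because the resolvent maps into
  \<open>D\<close>, and this domain is dense.\<close>

lemma sandwich_extends_sandwich: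
  assumes z: "Im z \<noteq> 0"
  shows "sandwich_extends F (H r) z (sandwich F (H r) z)"
proof -
  obtain T where T: "sandwich_extends F (H r) z T" using sandwich_compact[OF z] by blast
  have "T' = T" if T': "sandwich_extends F (H r) z T'" for T'
  proof (rule blinfun_eqI)
    fix u
    show "T' u = T u"
    proof (rule blinfun_dense_induct[OF adjoint_dense, where x = u and Q = "\<lambda>u. T' u = T u"])
      show "closed {u. T' u = T u}" by (intro closed_Collect_eq continuous_intros)
      fix u assume "u \<in> Domain (op_adjoint F)"
      then obtain v where "(u, v) \<in> op_adjoint F O resolvent (H r) z O F"
        by (rule sandwich_composite[OF z])
      then have "(u, v) \<in> op_graph T'" "(u, v) \<in> op_graph T"
        using T T' unfolding sandwich_extends_def by blast+
      then show "T' u = T u" by (simp add: op_graph_iff)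
    qed
  qed
  with T show ?thesis unfolding sandwich_def by (rule theI)
qed

lemma sandwich_apply:
  assumes z: "Im z \<noteq> 0"
    and "(u, w) \<in> op_adjoint F" "(x, y) \<in> H r" "y - z *\<^sub>C x = w" "(x, v) \<in> F"
  shows "sandwich F (H r) z u = v"
proof -
  have "(w, x) \<in> resolvent (H r) z" using assms(3,4) by (auto simp: resolvent_def)
  with assms(2,5) have "(u, v) \<in> op_adjoint F O resolvent (H r) z O F" by blast
  then have "(u, v) \<in> op_graph (sandwich F (H r) z)"
    using sandwich_extends_sandwich[OF z, of r] unfolding sandwich_extends_def by blast
  then show ?thesis by (simp add: op_graph_iff)
qed

lemma sandwich_applyE:
  assumes z: "Im z \<noteq> 0" and u: "u \<in> Domain (op_adjoint F)"
  obtains w x y where "(u, w) \<in> op_adjoint F" "(x, y) \<in> H r" "y - z *\<^sub>C x = w"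
    "(x, sandwich F (H r) z u) \<in> F"
proof -
  obtain w x y v where 1: "(u, w) \<in> op_adjoint F" "(x, y) \<in> H r" "y - z *\<^sub>C x = w" "(x, v) \<in> F"
    by (rule sandwich_composite[OF z u])
  show ?thesis by (rule that[OF 1(1-3)]) (use sandwich_apply[OF z 1] 1(4) in simp)
qed

lemma compact_sandwich: "Im z \<noteq> 0 \<Longrightarrow> compact_blinfun (sandwich F (H r) z)"
  and clinear_sandwich: "Im z \<noteq> 0 \<Longrightarrow> clinear_blinfun (sandwich F (H r) z)"
  using sandwich_extends_sandwich[of z r] compact_op_graph unfolding sandwich_extends_def by blast+

text \<open>On the domain of the adjoint of \<open>F\<close> the claim reduces to the symmetry of
  \<open>H r\<close> between the two resolvent vectors; density extends it in one argument at a
  time.\<close>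

lemma sandwich_adjoint:
  assumes z: "Im z \<noteq> 0"
  shows "cinner u' (sandwich F (H r) z u) = cinner (sandwich F (H r) (cnj z) u') u"
proof (rule blinfun_dense_induct[OF adjoint_dense, where x = u], goal_cases)
  case 1
  show ?case by (rule closed_Collect_eq_tendsto) (intro tendsto_cinner tendsto_intros)+
next
  case (2 u)
  show ?case
  proof (rule blinfun_dense_induct[OF adjoint_dense, where x = u'], goal_cases)
    case 1
    show ?case by (rule closed_Collect_eq_tendsto) (intro tendsto_cinner tendsto_intros)+
  next
    case (2 u')
    let ?v = "sandwich F (H r) z u" and ?v' = "sandwich F (H r) (cnj z) u'"
    obtain w x y where 1: "(u, w) \<in> op_adjoint F" "(x, y) \<in> H r" "y - z *\<^sub>C x = w" "(x, ?v) \<in> F"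
      by (rule sandwich_applyE[OF z \<open>u \<in> Domain (op_adjoint F)\<close>])
    have z': "Im (cnj z) \<noteq> 0" using z by simp
    obtain w' x' y' where 2: "(u', w') \<in> op_adjoint F" "(x', y') \<in> H r" "y' - cnj z *\<^sub>C x' = w'"
      "(x', ?v') \<in> F"
      by (rule sandwich_applyE[OF z' \<open>u' \<in> Domain (op_adjoint F)\<close>])
    have "cinner u' ?v = cinner w' x" by (rule op_adjointD[OF 2(1) 1(4)])
    also have "\<dots> = cinner y' x - z * cinner x' x"
      by (simp add: 2(3)[symmetric] cinner_diff_left cinner_scaleC_left)
    also have "cinner y' x = cinner x' y"
      by (rule self_adjoint_symmetric[OF H_self_adjoint 2(2) 1(2), symmetric])
    also have "cinner x' y - z * cinner x' x = cinner x' w"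
      by (simp add: 1(3)[symmetric] cinner_diff_right cinner_scaleC_right)
    also have "\<dots> = cnj (cinner u ?v')"
      unfolding op_adjointD[OF 1(1) 2(4)] by (rule cinner_commute)
    finally show ?case by (simp add: cinner_commute[of ?v' u])
  qed
qed

text \<open>For \<open>u\<close> in the domain of the adjoint of \<open>F\<close> the imaginary part
  is \<open>Im z * (norm x)\<^sup>2\<close>, where \<open>x\<close> is the resolvent applied to the
  image of \<open>u\<close>.\<close>

lemma sandwich_Im_nonneg:
  assumes z: "Im z > 0"
  shows "0 \<le> Im (cinner u (sandwich F (H r) z u))"
proof (rule blinfun_dense_induct[OF adjoint_dense, where x = u], goal_cases)
  case 1
  have "continuous_on UNIV (\<lambda>u. Im (cinner u (sandwich F (H r) z u)))"
    unfolding continuous_on_def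
    by (intro ballI tendsto_Im tendsto_cinner tendsto_intros)
  then show ?case by (intro closed_Collect_le continuous_on_const)
next
  case (2 u)
  let ?v = "sandwich F (H r) z u"
  have z0: "Im z \<noteq> 0" using z by simp
  obtain w x y where 1: "(u, w) \<in> op_adjoint F" "(x, y) \<in> H r" "y - z *\<^sub>C x = w" "(x, ?v) \<in> F"
    by (rule sandwich_applyE[OF z0 2])
  have "cinner u ?v = cinner (y - z *\<^sub>C x) x" unfolding 1(3) by (rule op_adjointD[OF 1(1,4)])
  then have "Im (cinner u ?v) = Im z * (norm x)\<^sup>2"
    using self_adjoint_Im[OF H_self_adjoint 1(2)] by simp
  then show ?case using z by simp
qed

lemma H_shift:
  assumes "(x, y) \<in> H s" "(x, q) \<in> perturbation F J"
  shows "(x, y + (r - s) *\<^sub>R q) \<in> H r"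
proof -
  have "(x, y) \<in> op_add (H 0) (op_scale (complex_of_real s) (perturbation F J))"
    using assms(1) H_line by blast
  then obtain y0 q' where y0: "(x, y0) \<in> H 0" "(x, q') \<in> perturbation F J" "y = y0 + s *\<^sub>R q'"
    unfolding op_add_def op_scale_def by (auto simp: scaleC_of_real)
  have "q' = q"
    by (rule linear_op_unique[OF self_adjoint_linear_op[OF V_self_adjoint] y0(2) assms(2)])
  then have "y + (r - s) *\<^sub>R q = y0 + complex_of_real r *\<^sub>C q"
    by (simp add: y0(3) scaleC_of_real algebra_simps)
  then have "(x, y + (r - s) *\<^sub>R q) \<in> op_add (H 0) (op_scale (complex_of_real r) (perturbation F J))"
    using y0(1) assms(2) unfolding op_add_def op_scale_def by auto
  then show ?thesis using H_line by blast
qed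

text \<open>The second resolvent identity between \<open>H r\<close> and \<open>H s\<close>, whose
  difference is \<open>(r - s) V\<close>, sandwiched by \<open>F\<close> and its adjoint; the
  factorisation \<open>V = F^* J F\<close> produces the middle \<open>J\<close>.\<close>

lemma sandwich_resolvent_identity:
  assumes z: "Im z \<noteq> 0"
  shows "sandwich F (H r) z u =
    sandwich F (H s) z u + (s - r) *\<^sub>R sandwich F (H r) z (J (sandwich F (H s) z u))"
proof (rule blinfun_dense_induct[OF adjoint_dense, where x = u], goal_cases)
  case 1
  show ?case by (intro closed_Collect_eq continuous_intros)
next
  case (2 u)
  let ?v = "sandwich F (H s) z u"
  obtain w x y where 1: "(u, w) \<in> op_adjoint F" "(x, y) \<in> H s" "y - z *\<^sub>C x = w" "(x, ?v) \<in> F"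
    by (rule sandwich_applyE[OF z 2])
  have "x \<in> Domain (perturbation F J)" using 1(2) H_domain[of s] D_subset by blast
  then obtain v' q where v': "(x, v') \<in> F" "(J v', q) \<in> op_adjoint F"
    unfolding perturbation_def by (auto simp: op_graph_iff)
  have "v' = ?v" by (rule linear_op_unique[OF F_linear v'(1) 1(4)])
  then have q: "(J ?v, q) \<in> op_adjoint F" using v'(2) by simp
  have xq: "(x, q) \<in> perturbation F J"
    unfolding perturbation_def by (rule relcompI[OF 1(4) relcompI[OF _ q]]) (simp add: op_graph_iff)
  \<comment> \<open>With \<open>x2\<close> the resolvent of \<open>H r\<close> applied to
    \<open>q = V x\<close>, the vector \<open>x + (s - r) *\<^sub>R x2\<close> is the resolvent of
    \<open>H r\<close> applied to \<open>w\<close>.\<close>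
  obtain x2 y2 where 2: "(x2, y2) \<in> H r" "y2 - z *\<^sub>C x2 = q"
    by (rule self_adjoint_resolvent_surj[OF H_self_adjoint z])
  have "x2 \<in> Domain F" using 2(1) H_domain[of r] D_subset by blast
  then obtain v2 where v2: "(x2, v2) \<in> F" by blast
  have v2': "sandwich F (H r) z (J ?v) = v2" by (rule sandwich_apply[OF z q 2 v2])
  show ?case
    unfolding v2'
  proof (rule sandwich_apply[OF z 1(1)])
    note lin = self_adjoint_linear_op[OF H_self_adjoint]
    show "(x + (s - r) *\<^sub>R x2, y + (r - s) *\<^sub>R q + (s - r) *\<^sub>R y2) \<in> H r"
      by (rule linear_op_add[OF lin H_shift[OF 1(2) xq] linear_op_scaleR[OF lin 2(1)]])
    show "(x + (s - r) *\<^sub>R x2, ?v + (s - r) *\<^sub>R v2) \<in> F"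
      by (rule linear_op_add[OF F_linear 1(4) linear_op_scaleR[OF F_linear v2]])
    show "y + (r - s) *\<^sub>R q + (s - r) *\<^sub>R y2 - z *\<^sub>C (x + (s - r) *\<^sub>R x2) = w"
      unfolding 1(3)[symmetric] 2(2)[symmetric]
      by (simp add: scaleC_add_right scaleC_scaleC mult.commute scaleC_diff_right flip: scaleC_of_real)
        (simp add: scaleC_diff_left scaleC_diff_right algebra_simps)
  qed
qed

end

text \<open>Rewriting the equation as \<open>(1 + c L J) X = T - c (T - L) J X\<close> and applying
  \<open>G\<close> bounds the error by a multiple of \<open>norm (T - L)\<close>, once
  \<open>X\<close> is known to stay bounded.\<close>

lemma tendsto_perturbed_inverse:
  fixes X T :: "'b \<Rightarrow> ('a::banach \<Rightarrow>\<^sub>L 'a)"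
  assumes T: "(T \<longlongrightarrow> L) F" and G: "blinfun_inverse_pair (id_blinfun + c *\<^sub>R (L o\<^sub>L J)) G"
    and X: "\<forall>\<^sub>F y in F. \<forall>u. X y u + c *\<^sub>R T y (J (X y u)) = T y u"
  shows "(X \<longlongrightarrow> G o\<^sub>L L) F"
proof -
  define K where "K = \<bar>c\<bar> * norm G * norm J"
  \<comment> \<open>An a priori bound for \<open>X\<close>: when \<open>T\<close> is close to
    \<open>L\<close>, the term containing \<open>X\<close> is at most half of
    \<open>norm (X y)\<close> and is absorbed, which leaves \<open>norm G + norm G * norm L\<close>,
    doubled.\<close>
  define M where "M = 2 * norm G * (norm L + 1)"
  have id: "X y - (G o\<^sub>L L) = (G o\<^sub>L (T y - L)) - c *\<^sub>R (G o\<^sub>L ((T y - L) o\<^sub>L (J o\<^sub>L X y)))"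
    if "\<forall>u. X y u + c *\<^sub>R T y (J (X y u)) = T y u" for y
  proof (rule blinfun_eqI)
    fix u
    have "X y u = G ((id_blinfun + c *\<^sub>R (L o\<^sub>L J)) (X y u))"
      using G by (simp add: blinfun_inverse_pair_def)
    also have "(id_blinfun + c *\<^sub>R (L o\<^sub>L J)) (X y u) = T y u - c *\<^sub>R (T y - L) (J (X y u))"
      by (simp add: blinfun.add_left blinfun.diff_left blinfun.scaleR_left scaleR_diff_right
          that[rule_format, of u, symmetric])
    finally have "X y u = G (T y u) - c *\<^sub>R G ((T y - L) (J (X y u)))"
      by (simp add: blinfun.diff_right blinfun.scaleR_right)
    then show "(X y - (G o\<^sub>L L)) u =
        ((G o\<^sub>L (T y - L)) - c *\<^sub>R (G o\<^sub>L ((T y - L) o\<^sub>L (J o\<^sub>L X y)))) u"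
      by (simp add: blinfun.diff_left blinfun.diff_right blinfun.scaleR_left)
  qed
  have le: "norm (X y - (G o\<^sub>L L)) \<le> norm G * norm (T y - L) + K * norm (T y - L) * norm (X y)"
    if "\<forall>u. X y u + c *\<^sub>R T y (J (X y u)) = T y u" for y
  proof -
    have "norm (G o\<^sub>L ((T y - L) o\<^sub>L (J o\<^sub>L X y))) \<le> norm G * (norm (T y - L) * (norm J * norm (X y)))"
      by (meson mult_left_mono norm_blinfun_compose norm_ge_zero order.trans)
    from mult_left_mono[OF this abs_ge_zero[of c]]
    have "norm (c *\<^sub>R (G o\<^sub>L ((T y - L) o\<^sub>L (J o\<^sub>L X y)))) \<le> K * norm (T y - L) * norm (X y)"
      by (simp add: K_def mult_ac)
    moreover have "norm (G o\<^sub>L (T y - L)) \<le> norm G * norm (T y - L)" by (rule norm_blinfun_compose)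
    ultimately show ?thesis unfolding id[OF that] by (meson add_mono norm_triangle_ineq4 order.trans)
  qed
  have small: "\<forall>\<^sub>F y in F. norm (T y - L) < d" if "d > 0" for d
    using tendstoD[OF T that] by (simp add: dist_norm)
  have K0: "K \<ge> 0" by (simp add: K_def)
  have d0: "1 / (2 * (K + 1)) > 0" using K0 by simp
  have bound: "\<forall>\<^sub>F y in F. norm (X y - (G o\<^sub>L L)) \<le> norm (T y - L) * (norm G + K * M)"
    using X small[OF zero_less_one] small[OF d0]
  proof (eventually_elim)
    fix y
    assume y: "\<forall>u. X y u + c *\<^sub>R T y (J (X y u)) = T y u" "norm (T y - L) < 1"
      "norm (T y - L) < 1 / (2 * (K + 1))"
    have "K * norm (T y - L) \<le> (K + 1) * norm (T y - L)" by (simp add: mult_right_mono)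
    also have "\<dots> \<le> 1 / 2" using y(3) K0 by (simp add: field_simps)
    finally have "K * norm (T y - L) * norm (X y) \<le> 1 / 2 * norm (X y)"
      by (rule mult_right_mono) simp
    moreover have "norm (X y) \<le> norm (X y - (G o\<^sub>L L)) + norm (G o\<^sub>L L)"
      using norm_triangle_ineq[of "X y - (G o\<^sub>L L)" "G o\<^sub>L L"] by simp
    moreover have "norm (G o\<^sub>L L) \<le> norm G * norm L" by (rule norm_blinfun_compose)
    moreover have "norm G * norm (T y - L) \<le> norm G" using y(2) by (simp add: mult_left_le)
    ultimately have XM: "norm (X y) \<le> M"
      using le[OF y(1)] unfolding M_def by (simp add: algebra_simps)
    have "K * norm (T y - L) * norm (X y) \<le> K * norm (T y - L) * M"
      using XM K0 by (intro mult_left_mono) simp_all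
    then show "norm (X y - (G o\<^sub>L L)) \<le> norm (T y - L) * (norm G + K * M)"
      using le[OF y(1)] by (simp add: algebra_simps)
  qed
  have "((\<lambda>y. norm (T y - L) * (norm G + K * M)) \<longlongrightarrow> 0 * (norm G + K * M)) F"
    by (intro tendsto_intros tendsto_norm_zero LIM_zero T)
  then have "((\<lambda>y. X y - (G o\<^sub>L L)) \<longlongrightarrow> 0) F"
    by (intro Lim_null_comparison[OF bound]) simp
  then show ?thesis by (simp add: LIM_zero_iff)
qed

section \<open>Comparison of the two sides\<close>

text \<open>Positivity enters only through \<open>definite\<close>, a condition insensitive to the
  sign of the imaginary part; the lemma can therefore be used with either side of the real axis in
  the first place.\<close>

lemma root_space_projection_injective:
  fixes T1 T2 J :: "'a::chilbert_space \<Rightarrow>\<^sub>L 'a" and s r :: real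
  assumes T1: "compact_blinfun T1" "clinear_blinfun T1"
    and T2: "compact_blinfun T2" "clinear_blinfun T2"
    and J: "clinear_blinfun J" "\<And>x y. cinner x (J y) = cinner (J x) y"
    and adj: "\<And>x y. cinner x (T2 y) = cinner (T1 x) y"
    and definite: "\<And>u. Im (cinner u (T2 u)) = 0 \<Longrightarrow> T1 u = T2 u"
    and P1: "riesz_projection (pencil (T1 o\<^sub>L J) (of_real s) (of_real r)) p1 P1"
    and P2: "riesz_projection (pencil (T2 o\<^sub>L J) (of_real s) (of_real r)) p2 P2"
    and u: "P2 u = u" "P1 u = 0"
  shows "u = 0"
proof -
  define A1 where "A1 = T1 o\<^sub>L J"
  define A2 where "A2 = T2 o\<^sub>L J"
  have A: "compact_blinfun A1" "clinear_blinfun A1" "compact_blinfun A2" "clinear_blinfun A2"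
    using T1 T2 J(1) unfolding A1_def A2_def
    by (auto intro: compact_blinfun_compose_right simp: clinear_blinfun_def)
  define G1 where "G1 = pencil A1 (of_real s) (of_real r)"
  define G2 where "G2 = pencil A2 (of_real s) (of_real r)"
  note P1 = P1[folded A1_def, folded G1_def] and P2 = P2[folded A2_def, folded G2_def]
  have G1x: "G1 x = x + (r - s) *\<^sub>R A1 x" and G2x: "G2 x = x + (r - s) *\<^sub>R A2 x" for x
    by (simp_all add: G1_def G2_def pencil_apply flip: scaleC_of_real)
  have JA: "cinner x (J (A2 y)) = cinner (A1 x) (J y)" for x y
    by (simp add: A1_def A2_def J(2)[of x] adj)
  have JG: "cinner x (J (G2 y)) = cinner (G1 x) (J y)" for x y
    by (simp add: G1x G2x blinfun.add_right cinner_add_left cinner_add_right JA cinner_scaleC_left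
        cinner_scaleC_right clinear_blinfunD[OF J(1)] flip: scaleC_of_real)
  have JGk: "cinner x (J (blinfun_pow G2 k y)) = cinner (blinfun_pow G1 k x) (J y)" for x y k
    by (induction k arbitrary: x) (simp_all add: JG flip: blinfun_pow_Suc_right)
  \<comment> \<open>Iterated ranges of one pencil are orthogonal to root spaces of the other for the
    form \<open>cinner x (J y)\<close>. The exponents are crossed: each range is taken at the power
    that kills the opposite root space.\<close>
  have JP: "cinner x (J (P2 y)) = cinner (P1 x) (J y)" for x y
  proof -
    obtain x' where x': "x - P1 x = blinfun_pow G1 p2 x'" by (rule riesz_projection_range[OF P1])
    obtain y' where y': "y - P2 y = blinfun_pow G2 p1 y'" by (rule riesz_projection_range[OF P2])
    have "cinner (x - P1 x) (J (P2 y)) = 0"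
      unfolding x' JGk[symmetric] by (simp add: riesz_projection_in_kernel[OF P2] blinfun.zero_right)
    moreover have "cinner (P1 x) (J (y - P2 y)) = 0"
      unfolding y' JGk by (simp add: riesz_projection_in_kernel[OF P1])
    ultimately show ?thesis by (simp add: cinner_diff_left cinner_diff_right blinfun.diff_right)
  qed
  have comm1: "P1 (A1 x) = A1 (P1 x)" and comm2: "P2 (A2 x) = A2 (P2 x)" for x
    using riesz_projection_B[OF A(1,2) P1[unfolded G1_def]]
      riesz_projection_B[OF A(3,4) P2[unfolded G2_def]] by auto
  text \<open>On the subspace annihilated by \<open>P1\<close> both operators coincide, by definiteness of the
    imaginary part.\<close>
  have eq: "A1 v = A2 v" if v: "P2 v = v" "P1 v = 0" for v
  proof -
    \<comment> \<open>As \<open>v\<close> is fixed by \<open>P2\<close>, so is \<open>A2 v\<close>;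
      the inserted \<open>P2\<close> can then be moved to the other side of the form, where it
      becomes \<open>P1 v = 0\<close>.\<close>
    have "cinner (J v) (T2 (J v)) = cinner v (J (P2 (A2 v)))"
      by (simp add: J(2) comm2 v(1)) (simp add: A2_def)
    also have "\<dots> = 0" by (simp add: JP v(2))
    finally have "T1 (J v) = T2 (J v)" by (intro definite) simp
    then show ?thesis by (simp add: A1_def A2_def)
  qed
  \<comment> \<open>The iterates never leave the subspace on which the two pencils agree, so
    nilpotency of \<open>G2\<close> at \<open>u\<close> becomes nilpotency of \<open>G1\<close> at
    \<open>u\<close>.\<close>
  have "P2 (blinfun_pow G2 k u) = blinfun_pow G2 k u \<and> P1 (blinfun_pow G2 k u) = 0
      \<and> blinfun_pow G1 k u = blinfun_pow G2 k u" for k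
  proof (induction k)
    case (Suc k)
    let ?v = "blinfun_pow G2 k u"
    have v: "P2 ?v = ?v" "P1 ?v = 0" "blinfun_pow G1 k u = ?v" using Suc by auto
    have G: "G1 ?v = G2 ?v" by (simp add: G1x G2x eq[OF v(1,2)])
    have "P2 (G2 ?v) = G2 ?v"
      by (simp add: G2x blinfun.add_right blinfun.scaleR_right comm2 v(1))
    moreover have "P1 (G2 ?v) = 0"
      unfolding G[symmetric]
      by (simp add: G1x blinfun.add_right blinfun.scaleR_right comm1 v(2) blinfun.zero_right)
    ultimately show ?case using v(3) G by simp
  qed (simp add: u)
  from this[of p2] have "blinfun_pow G1 p2 u = 0"
    using riesz_projection_in_kernel[OF P2, of u] u(1) by simp
  from riesz_projection_fixes[OF P1 this] show ?thesis using u(2) by simp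
qed

text \<open>Instead of comparing dimensions, the Fredholm alternative for \<open>1 - (P1 - P1 P2 P1)\<close> turns
  injectivity in both directions into surjectivity.\<close>

lemma idempotent_pair_surjective:
  fixes P1 P2 :: "'a::{real_inner,banach} \<Rightarrow>\<^sub>L 'a"
  assumes comp: "compact_blinfun P1"
    and idem: "\<And>x. P1 (P1 x) = P1 x" "\<And>x. P2 (P2 x) = P2 x"
    and inj1: "\<And>u. P2 u = u \<Longrightarrow> P1 u = 0 \<Longrightarrow> u = 0"
    and inj2: "\<And>u. P1 u = u \<Longrightarrow> P2 u = 0 \<Longrightarrow> u = 0"
    and v: "P1 v = v"
  obtains u where "P2 u = u" "P1 u = v"
proof -
  \<comment> \<open>Then \<open>1 - C\<close> is the identity on the kernel of \<open>P1\<close> and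
    acts as \<open>P1 P2 P1\<close> on its range.\<close>
  define C where "C = P1 - (P1 o\<^sub>L (P2 o\<^sub>L P1))"
  have C: "compact_blinfun C"
    unfolding C_def by (intro compact_blinfun_diff compact_blinfun_compose_right comp)
  have Cx: "x - C x = x - P1 x + P1 (P2 (P1 x))" for x
    by (simp add: C_def blinfun.diff_left)
  have P1C: "P1 (x - C x) = P1 (P2 (P1 x))" for x
    unfolding Cx by (simp add: blinfun.add_right blinfun.diff_right idem)
  have inj: "x = 0" if "x - C x = 0" for x
  proof -
    have "P1 (P2 (P1 x)) = 0" using P1C[of x] that by (simp add: blinfun.zero_right)
    with inj1[of "P2 (P1 x)"] idem have "P2 (P1 x) = 0" by simp
    with inj2[of "P1 x"] idem have "P1 x = 0" by simp
    then show ?thesis using that by (simp add: Cx blinfun.zero_right)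
  qed
  obtain S where "(id_blinfun - C) o\<^sub>L S = id_blinfun"
    by (rule fredholm_alternative[OF C inj]) auto
  then have "(id_blinfun - C) (S v) = v"
    by (metis blinfun_apply_blinfun_compose blinfun_apply_id_blinfun)
  then have "P1 (P2 (P1 (S v))) = v"
    using P1C[of "S v"] v by (simp add: blinfun.diff_left)
  with that[of "P2 (P1 (S v))"] idem show ?thesis by simp
qed

section \<open>Boundary values at a non-resonant point\<close>

context resonance_line
begin

context
  fixes lam s :: real
  assumes ns: "nonresonant F H lam s"
begin

context
  fixes \<sigma> :: real
  assumes \<sigma>: "\<sigma> \<in> {1, -1}"
begin

lemma sandwich_bdry_tendsto:
  "((\<lambda>y. sandwich F (H s) (Complex lam (\<sigma> * y))) \<longlongrightarrow> sandwich_bdry F (H s) lam \<sigma>) (at_right 0)"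
proof -
  obtain L where L: "((\<lambda>y. sandwich F (H s) (Complex lam (\<sigma> * y))) \<longlongrightarrow> L) (at_right 0)"
    using ns \<sigma> unfolding nonresonant_def Lambda_def by blast
  have "sandwich_bdry F (H s) lam \<sigma> = L"
    unfolding sandwich_bdry_def by (rule tendsto_Lim[OF trivial_limit_at_right_real L])
  with L show ?thesis by simp
qed

lemma sandwich_bdry_apply_tendsto:
  "((\<lambda>y. sandwich F (H s) (Complex lam (\<sigma> * y)) u) \<longlongrightarrow> sandwich_bdry F (H s) lam \<sigma> u) (at_right 0)"
  by (intro tendsto_intros sandwich_bdry_tendsto)

lemma eventually_nonreal: "\<forall>\<^sub>F y in at_right (0::real). Im (Complex lam (\<sigma> * y)) \<noteq> 0"
  using eventually_at_right_less[of "0::real"] by eventually_elim (use \<sigma> in auto)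

lemma compact_sandwich_bdry: "compact_blinfun (sandwich_bdry F (H s) lam \<sigma>)"
proof (rule compact_blinfun_limit)
  fix e :: real assume "e > 0"
  have "\<forall>\<^sub>F y in at_right 0. Im (Complex lam (\<sigma> * y)) \<noteq> 0 \<and>
      norm (sandwich F (H s) (Complex lam (\<sigma> * y)) - sandwich_bdry F (H s) lam \<sigma>) < e"
    using eventually_nonreal tendstoD[OF sandwich_bdry_tendsto \<open>e > 0\<close>]
    by (simp add: dist_norm eventually_conj_iff)
  from eventually_happens'[OF trivial_limit_at_right_real this]
  obtain y where "Im (Complex lam (\<sigma> * y)) \<noteq> 0"
    "norm (sandwich F (H s) (Complex lam (\<sigma> * y)) - sandwich_bdry F (H s) lam \<sigma>) < e" by blast
  then show "\<exists>B. compact_blinfun B \<and> norm (B - sandwich_bdry F (H s) lam \<sigma>) < e"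
    using compact_sandwich by blast
qed

lemma clinear_sandwich_bdry: "clinear_blinfun (sandwich_bdry F (H s) lam \<sigma>)"
  unfolding clinear_blinfun_def
proof (intro allI)
  fix c u
  have "((\<lambda>y. c *\<^sub>C sandwich F (H s) (Complex lam (\<sigma> * y)) u)
      \<longlongrightarrow> c *\<^sub>C sandwich_bdry F (H s) lam \<sigma> u) (at_right 0)"
    by (intro tendsto_scaleC tendsto_const sandwich_bdry_apply_tendsto)
  moreover have "\<forall>\<^sub>F y in at_right 0. c *\<^sub>C sandwich F (H s) (Complex lam (\<sigma> * y)) u
      = sandwich F (H s) (Complex lam (\<sigma> * y)) (c *\<^sub>C u)"
    using eventually_nonreal by eventually_elim (erule clinear_blinfunD[OF clinear_sandwich, symmetric])
  ultimately have "((\<lambda>y. sandwich F (H s) (Complex lam (\<sigma> * y)) (c *\<^sub>C u))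
      \<longlongrightarrow> c *\<^sub>C sandwich_bdry F (H s) lam \<sigma> u) (at_right 0)"
    by (rule Lim_transform_eventually)
  from tendsto_unique[OF trivial_limit_at_right_real sandwich_bdry_apply_tendsto this]
  show "sandwich_bdry F (H s) lam \<sigma> (c *\<^sub>C u) = c *\<^sub>C sandwich_bdry F (H s) lam \<sigma> u" .
qed

lemma compact_A_op: "compact_blinfun (A_op F J H lam \<sigma> s)"
  unfolding A_op_def by (rule compact_blinfun_compose_right[OF compact_sandwich_bdry])

lemma clinear_A_op: "clinear_blinfun (A_op F J H lam \<sigma> s)"
  using clinear_sandwich_bdry J_clinear by (simp add: A_op_def clinear_blinfun_def)

end

lemma sandwich_bdry_adjoint:
  assumes "\<sigma> \<in> {1, -1}"
  shows "cinner u' (sandwich_bdry F (H s) lam \<sigma> u) = cinner (sandwich_bdry F (H s) lam (- \<sigma>) u') u"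
proof -
  have \<sigma>': "- \<sigma> \<in> {1, -1}" using assms by auto
  have 1: "((\<lambda>y. cinner u' (sandwich F (H s) (Complex lam (\<sigma> * y)) u))
      \<longlongrightarrow> cinner u' (sandwich_bdry F (H s) lam \<sigma> u)) (at_right 0)"
    by (intro tendsto_cinner tendsto_const sandwich_bdry_apply_tendsto assms)
  have 2: "((\<lambda>y. cinner (sandwich F (H s) (Complex lam (- \<sigma> * y)) u') u)
      \<longlongrightarrow> cinner (sandwich_bdry F (H s) lam (- \<sigma>) u') u) (at_right 0)"
    by (intro tendsto_cinner tendsto_const sandwich_bdry_apply_tendsto \<sigma>')
  have "\<forall>\<^sub>F y in at_right 0. cinner (sandwich F (H s) (Complex lam (- \<sigma> * y)) u') u
      = cinner u' (sandwich F (H s) (Complex lam (\<sigma> * y)) u)"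
    using eventually_nonreal[OF assms]
  proof eventually_elim
    case (elim y)
    have "cnj (Complex lam (\<sigma> * y)) = Complex lam (- \<sigma> * y)" by (simp add: complex_eq_iff)
    then show ?case using sandwich_adjoint[OF elim, of u' s u] by simp
  qed
  from Lim_transform_eventually[OF 2 this] 1 show ?thesis
    using tendsto_unique[OF trivial_limit_at_right_real] by blast
qed

lemma sandwich_bdry_Im_nonneg: "0 \<le> Im (cinner u (sandwich_bdry F (H s) lam 1 u))"
proof (rule tendsto_lowerbound)
  show "((\<lambda>y. Im (cinner u (sandwich F (H s) (Complex lam (1 * y)) u)))
      \<longlongrightarrow> Im (cinner u (sandwich_bdry F (H s) lam 1 u))) (at_right 0)"
    by (intro tendsto_Im tendsto_cinner tendsto_const sandwich_bdry_apply_tendsto) simp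
  show "\<forall>\<^sub>F y in at_right 0. 0 \<le> Im (cinner u (sandwich F (H s) (Complex lam (1 * y)) u))"
    using eventually_at_right_less[of "0::real"]
    by eventually_elim (rule sandwich_Im_nonneg, simp)
qed simp

lemma Im_sandwich_bdry_minus:
  "Im (cinner u (sandwich_bdry F (H s) lam (-1) v)) = - Im (cinner v (sandwich_bdry F (H s) lam 1 u))"
proof -
  have "cinner u (sandwich_bdry F (H s) lam (-1) v) = cinner (sandwich_bdry F (H s) lam 1 u) v"
    using sandwich_bdry_adjoint[of "-1" u v] by simp
  also have "\<dots> = cnj (cinner v (sandwich_bdry F (H s) lam 1 u))" by (rule cinner_commute)
  finally show ?thesis by simp
qed

text \<open>A null vector of a nonnegative quadratic form is annihilated by its polar form. Here the
  polar form at \<open>u\<close> is \<open>Im (cinner v d)\<close>, with \<open>d\<close> the jump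
  of the boundary values across the axis.\<close>

lemma sandwich_bdry_definite_plus:
  assumes u: "Im (cinner u (sandwich_bdry F (H s) lam 1 u)) = 0"
  shows "sandwich_bdry F (H s) lam 1 u = sandwich_bdry F (H s) lam (-1) u"
proof -
  let ?T = "sandwich_bdry F (H s) lam 1" and ?S = "sandwich_bdry F (H s) lam (-1)"
  define d where "d = ?T u - ?S u"
  have "Im (cinner v d) = 0" for v
  proof -
    have "0 \<le> t * (Im (cinner u (?T v)) + Im (cinner v (?T u))) + t\<^sup>2 * Im (cinner v (?T v))" for t
    proof -
      have "0 \<le> Im (cinner (u + t *\<^sub>R v) (?T (u + t *\<^sub>R v)))" by (rule sandwich_bdry_Im_nonneg)
      also have "\<dots> = t * (Im (cinner u (?T v)) + Im (cinner v (?T u))) + t\<^sup>2 * Im (cinner v (?T v))"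
        using u
        by (simp add: blinfun.add_right blinfun.scaleR_right cinner_add_left cinner_add_right
            cinner_scaleR_left cinner_scaleR_right algebra_simps power2_eq_square)
      finally show ?thesis .
    qed
    then have "Im (cinner u (?T v)) + Im (cinner v (?T u)) = 0"
      by (rule quadratic_nonneg_imp_zero)
    then show ?thesis by (simp add: d_def cinner_diff_right Im_sandwich_bdry_minus)
  qed
  \<comment> \<open>The choice \<open>v = \<i> *\<^sub>C d\<close> turns the imaginary part into
    \<open>- (norm d)\<^sup>2\<close>.\<close>
  from this[of "\<i> *\<^sub>C d"] have "d = 0" by (simp add: cinner_scaleC_left cinner_self)
  then show ?thesis by (simp add: d_def)
qed

lemma sandwich_bdry_definite:
  assumes "\<sigma> \<in> {1, -1}" "Im (cinner u (sandwich_bdry F (H s) lam (- \<sigma>) u)) = 0"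
  shows "sandwich_bdry F (H s) lam \<sigma> u = sandwich_bdry F (H s) lam (- \<sigma>) u"
  using assms sandwich_bdry_definite_plus[of u] Im_sandwich_bdry_minus[of u u] by auto

text \<open>For small \<open>r - s\<close> the operator \<open>1 + (r - s) T J\<close> at the
  boundary is a small perturbation of 1, hence invertible, and the limit at \<open>r\<close> follows
  from that at \<open>s\<close>. It provides the accumulating set for the identity theorem.\<close>

lemma nonresonant_nearby: "\<exists>d>0. \<forall>r. \<bar>r - s\<bar> < d \<longrightarrow> nonresonant F H lam r"
proof -
  \<comment> \<open>One constant dominates both sides, as non-resonance asks for both limits; the
    summand 1 keeps it positive.\<close>
  define K where "K = norm (sandwich_bdry F (H s) lam 1 o\<^sub>L J) + norm (sandwich_bdry F (H s) lam (-1) o\<^sub>L J) + 1"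
  have K: "K > 0" by (simp add: K_def add_nonneg_pos)
  have "nonresonant F H lam r" if r: "\<bar>r - s\<bar> < 1 / (2 * K)" for r
    unfolding nonresonant_def Lambda_def mem_Collect_eq
  proof
    fix \<sigma> :: real assume \<sigma>: "\<sigma> \<in> {1, -1}"
    let ?L = "sandwich_bdry F (H s) lam \<sigma>"
    have "norm (?L o\<^sub>L J) \<le> K" using \<sigma> by (auto simp: K_def)
    then have "\<bar>r - s\<bar> * norm (?L o\<^sub>L J) \<le> 1 / (2 * K) * K"
      using r K by (intro mult_mono) auto
    also have "\<dots> = 1 / 2" using K by simp
    finally have "norm ((r - s) *\<^sub>R (?L o\<^sub>L J)) \<le> 1 / 2" by simp
    then have "norm (id_blinfun :: 'k \<Rightarrow>\<^sub>L 'k) * norm ((r - s) *\<^sub>R (?L o\<^sub>L J)) \<le> 1 * (1 / 2)"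
      by (intro mult_mono norm_blinfun_id_le) simp_all
    moreover have "blinfun_inverse_pair id_blinfun (id_blinfun :: 'k \<Rightarrow>\<^sub>L 'k)"
      by (simp add: blinfun_inverse_pair_def)
    ultimately obtain G where G: "blinfun_inverse_pair (id_blinfun + (r - s) *\<^sub>R (?L o\<^sub>L J)) G"
      by (metis blinfun_inverse_pair_perturb mult_1)
    have "\<forall>\<^sub>F y in at_right 0. \<forall>u. sandwich F (H r) (Complex lam (\<sigma> * y)) u + (r - s) *\<^sub>R
        sandwich F (H s) (Complex lam (\<sigma> * y)) (J (sandwich F (H r) (Complex lam (\<sigma> * y)) u))
        = sandwich F (H s) (Complex lam (\<sigma> * y)) u"
      using eventually_nonreal[OF \<sigma>]
      by eventually_elim (intro allI, erule sandwich_resolvent_identity[symmetric])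
    from tendsto_perturbed_inverse[OF sandwich_bdry_tendsto[OF \<sigma>] G this]
    show "\<exists>L. ((\<lambda>y. sandwich F (H r) (Complex lam (\<sigma> * y))) \<longlongrightarrow> L) (at_right 0)" ..
  qed
  then show ?thesis using K by (intro exI[of _ "1 / (2 * K)"]) simp
qed

end

section \<open>Dependence of the boundary operators on the coupling\<close>

lemma A_op_resolvent_identity:
  assumes ns: "nonresonant F H lam s" "nonresonant F H lam r" and \<sigma>: "\<sigma> \<in> {1, -1}"
  shows "A_op F J H lam \<sigma> r u =
    A_op F J H lam \<sigma> s u + (s - r) *\<^sub>R A_op F J H lam \<sigma> r (A_op F J H lam \<sigma> s u)"
proof -
  let ?Tr = "\<lambda>y. sandwich F (H r) (Complex lam (\<sigma> * y))"
  let ?Ts = "\<lambda>y. sandwich F (H s) (Complex lam (\<sigma> * y))"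
  let ?Lr = "sandwich_bdry F (H r) lam \<sigma>" and ?Ls = "sandwich_bdry F (H s) lam \<sigma>"
  have "?Lr v = ?Ls v + (s - r) *\<^sub>R ?Lr (J (?Ls v))" for v
  proof -
    have "((\<lambda>y. ?Ts y v + (s - r) *\<^sub>R ?Tr y (J (?Ts y v)))
        \<longlongrightarrow> ?Ls v + (s - r) *\<^sub>R ?Lr (J (?Ls v))) (at_right 0)"
      by (intro tendsto_intros sandwich_bdry_tendsto[OF ns(1) \<sigma>] sandwich_bdry_tendsto[OF ns(2) \<sigma>])
    moreover have "\<forall>\<^sub>F y in at_right 0. ?Ts y v + (s - r) *\<^sub>R ?Tr y (J (?Ts y v)) = ?Tr y v"
      using eventually_nonreal[OF ns(1) \<sigma>]
      by eventually_elim (erule sandwich_resolvent_identity[symmetric])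
    ultimately have "((\<lambda>y. ?Tr y v) \<longlongrightarrow> ?Ls v + (s - r) *\<^sub>R ?Lr (J (?Ls v))) (at_right 0)"
      by (rule Lim_transform_eventually)
    with sandwich_bdry_apply_tendsto[OF ns(2) \<sigma>] show ?thesis
      by (rule tendsto_unique[OF trivial_limit_at_right_real])
  qed
  from this[of "J u"] show ?thesis by (simp add: A_op_def)
qed

text \<open>Compare the resolvent identity with the one obtained by exchanging \<open>r\<close> and
  \<open>s\<close>: the two products carry the same nonzero factor.\<close>

lemma A_op_commute:
  assumes "nonresonant F H lam s" "nonresonant F H lam r" "\<sigma> \<in> {1, -1}"
  shows "A_op F J H lam \<sigma> r (A_op F J H lam \<sigma> s u) = A_op F J H lam \<sigma> s (A_op F J H lam \<sigma> r u)"
proof (cases "r = s")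
  case False
  have "(s - r) *\<^sub>R A_op F J H lam \<sigma> r (A_op F J H lam \<sigma> s u)
      = (s - r) *\<^sub>R A_op F J H lam \<sigma> s (A_op F J H lam \<sigma> r u)"
  proof -
    have "c *\<^sub>R x = c *\<^sub>R y" if "a = b + c *\<^sub>R x" "b = a + (- c) *\<^sub>R y" for a b x y :: 'k and c
      using that by simp
    from this[OF A_op_resolvent_identity[OF assms]] A_op_resolvent_identity[OF assms(2,1,3), of u]
    show ?thesis by simp
  qed
  with False show ?thesis by simp
qed simp

lemma pencil_of_real: "pencil B (of_real s) (of_real r) x = x + (r - s) *\<^sub>R B x"
  by (simp add: pencil_apply flip: scaleC_of_real)

text \<open>Applying the operator at \<open>r\<close> to the kernel equation gives, by the resolvent
  identity, that the operator at \<open>s\<close> annihilates \<open>v\<close>; the equation then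
  reads \<open>v = 0\<close>.\<close>

lemma pencil_A_op_injective:
  assumes ns: "nonresonant F H lam s" "nonresonant F H lam r" and \<sigma>: "\<sigma> \<in> {1, -1}"
    and v: "pencil (A_op F J H lam \<sigma> s) (of_real s) (of_real r) v = 0"
  shows "v = 0"
proof -
  let ?Ar = "A_op F J H lam \<sigma> r" and ?As = "A_op F J H lam \<sigma> s"
  have eq: "v + (r - s) *\<^sub>R ?As v = 0" using v by (simp add: pencil_of_real)
  then have "?Ar (v + (r - s) *\<^sub>R ?As v) = 0" by (simp add: blinfun.zero_right)
  then have "?Ar v + (r - s) *\<^sub>R ?Ar (?As v) = 0" by (simp add: blinfun.add_right blinfun.scaleR_right)
  moreover have "?As v = ?Ar v + (r - s) *\<^sub>R ?Ar (?As v)"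
    using A_op_resolvent_identity[OF ns \<sigma>, of v] by (simp add: algebra_simps)
  ultimately show ?thesis using eq by simp
qed

text \<open>With meromorphy this shows that a continuation exists, so the choice in
  \<open>A_ext\<close> is a genuine one.\<close>

lemma pencil_resolvent_A_op:
  assumes ns: "nonresonant F H lam s" "nonresonant F H lam r" and \<sigma>: "\<sigma> \<in> {1, -1}"
  shows "pencil_resolvent (A_op F J H lam \<sigma> s) (of_real s) (of_real r) = A_op F J H lam \<sigma> r"
proof (rule blinfun_eqI)
  fix u
  let ?Ar = "A_op F J H lam \<sigma> r" and ?As = "A_op F J H lam \<sigma> s"
  show "pencil_resolvent ?As (of_real s) (of_real r) u = ?Ar u"
  proof (rule pencil_resolvent_eqI[OF compact_A_op[OF ns(1) \<sigma>] clinear_A_op[OF ns(1) \<sigma>]])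
    show "pencil ?As (of_real s) (of_real r) v = 0 \<Longrightarrow> v = 0" for v
      by (rule pencil_A_op_injective[OF ns \<sigma>])
    show "pencil ?As (of_real s) (of_real r) (?Ar u) = ?As u"
      using A_op_resolvent_identity[OF ns(2,1) \<sigma>, of u] by (simp add: pencil_of_real)
  qed
qed

text \<open>The chosen continuation and the pencil resolvent agree at all non-resonant reals, which
  accumulate at \<open>s\<close>; the identity theorem carries the agreement to a punctured
  neighbourhood of every \<open>z\<close>, in particular of a resonance point.\<close>

lemma A_ext_eventually_eq:
  assumes s: "nonresonant F H lam s" and \<sigma>: "\<sigma> \<in> {1, -1}"
  shows "\<forall>\<^sub>F w in at z. A_ext F J H lam \<sigma> w = pencil_resolvent (A_op F J H lam \<sigma> s) (of_real s) w"
proof -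
  let ?M = "pencil_resolvent (A_op F J H lam \<sigma> s) (of_real s)"
  have mero: "vmeromorphic ?M"
    by (rule vmeromorphic_pencil_resolvent[OF compact_A_op[OF s \<sigma>] clinear_A_op[OF s \<sigma>]])
  have "vmeromorphic (A_ext F J H lam \<sigma>) \<and>
      (\<forall>r. nonresonant F H lam r \<longrightarrow> A_ext F J H lam \<sigma> (complex_of_real r) = A_op F J H lam \<sigma> r)"
    unfolding A_ext_def
    by (rule someI[of _ ?M]) (use mero pencil_resolvent_A_op[OF s _ \<sigma>] in blast)
  then have ext: "vmeromorphic (A_ext F J H lam \<sigma>)"
    "\<And>r. nonresonant F H lam r \<Longrightarrow> A_ext F J H lam \<sigma> (of_real r) = A_op F J H lam \<sigma> r"
    by blast+
  have "complex_of_real s islimpt {w. A_ext F J H lam \<sigma> w = ?M w}"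
    unfolding islimpt_approachable
  proof (intro allI impI)
    fix e :: real assume e: "0 < e"
    obtain d where d: "d > 0" "\<And>r. \<bar>r - s\<bar> < d \<Longrightarrow> nonresonant F H lam r"
      using nonresonant_nearby[OF s] by blast
    define r where "r = s + min d e / 2"
    have r: "r \<noteq> s" "\<bar>r - s\<bar> < d" "\<bar>r - s\<bar> < e" using d(1) e by (auto simp: r_def)
    have "A_ext F J H lam \<sigma> (of_real r) = ?M (of_real r)"
      using ext(2)[OF d(2)[OF r(2)]] pencil_resolvent_A_op[OF s d(2)[OF r(2)] \<sigma>] by simp
    moreover have "dist (complex_of_real r) (complex_of_real s) < e"
      using r(3) by (simp add: dist_norm flip: of_real_diff)
    ultimately show "\<exists>w\<in>{w. A_ext F J H lam \<sigma> w = ?M w}. w \<noteq> of_real s \<and> dist w (of_real s) < e"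
      using r(1) by (intro bexI[of _ "of_real r"]) simp_all
  qed
  from vmeromorphic_identity[OF ext(1) mero this] show ?thesis .
qed

lemma P_res_eq:
  assumes s: "nonresonant F H lam s" and \<sigma>: "\<sigma> \<in> {1, -1}"
    and P: "riesz_projection (pencil (A_op F J H lam \<sigma> s) (of_real s) (of_real r)) p P"
  shows "P_res F J H lam \<sigma> r = P"
proof -
  have ev: "\<forall>\<^sub>F \<epsilon> in at_right 0. (1 / (2 * of_real pi * \<i>)) *\<^sub>C
      vcontour_integral (circlepath (complex_of_real r) \<epsilon>) (A_ext F J H lam \<sigma>) = P"
    by (rule pencil_resolvent_residue[OF compact_A_op[OF s \<sigma>] clinear_A_op[OF s \<sigma>] P
          A_ext_eventually_eq[OF s \<sigma>]])
  show ?thesis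
    unfolding P_res_def
  proof (rule the_equality)
    show "\<forall>\<^sub>F \<epsilon> in at_right 0. P = (1 / (2 * of_real pi * \<i>)) *\<^sub>C
        vcontour_integral (circlepath (complex_of_real r) \<epsilon>) (A_ext F J H lam \<sigma>)"
      using ev by eventually_elim (rule sym)
    fix Q assume "\<forall>\<^sub>F \<epsilon> in at_right 0. Q = (1 / (2 * of_real pi * \<i>)) *\<^sub>C
        vcontour_integral (circlepath (complex_of_real r) \<epsilon>) (A_ext F J H lam \<sigma>)"
    then have "\<forall>\<^sub>F \<epsilon> in at_right (0::real). Q = P" using ev by eventually_elim (rule trans)
    then show "Q = P" by simp
  qed
qed

text \<open>Change of reference point: with \<open>E = 1 + (t - s) A(s)\<close> the resolvent
  identity gives \<open>G t E = G s\<close>. The factors commute and \<open>E\<close> is injective,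
  so the powers of \<open>G t\<close> and \<open>G s\<close> have the same kernels.\<close>

lemma Upsilon_eq:
  assumes s: "nonresonant F H lam s" and \<sigma>: "\<sigma> \<in> {1, -1}"
  shows "Upsilon F J H lam \<sigma> r =
    (\<Union>k. {u. blinfun_pow (pencil (A_op F J H lam \<sigma> s) (of_real s) (of_real r)) k u = 0})"
proof -
  define A where "A = A_op F J H lam \<sigma>"
  define G where "G = (\<lambda>t. pencil (A t) (of_real t) (of_real r))"
  have "(\<lambda>v. v + (r - t) *\<^sub>R A t v) = blinfun_apply (G t)" for t
    by (rule ext) (simp add: G_def pencil_of_real)
  then have Ups: "Upsilon_k F J H lam \<sigma> r k =
      {u. \<forall>t. nonresonant F H lam t \<longrightarrow> blinfun_pow (G t) k u = 0}" for k
    unfolding Upsilon_k_def A_def[symmetric] by (simp only: funpow_blinfun)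
  have "blinfun_pow (G t) k u = 0" if t: "nonresonant F H lam t" and u: "blinfun_pow (G s) k u = 0" for t k u
  proof -
    define E where "E = pencil (A s) (of_real s) (of_real t)"
    have Ex: "E x = x + (t - s) *\<^sub>R A s x" and Gx: "G t x = x + (r - t) *\<^sub>R A t x"
      and Gs: "G s x = x + (r - s) *\<^sub>R A s x" for x
      by (simp_all add: E_def G_def pencil_of_real)
    have comm: "A t (A s x) = A s (A t x)" for x
      unfolding A_def by (rule A_op_commute[OF s t \<sigma>])
    have id: "A s x = A t x + (t - s) *\<^sub>R A t (A s x)" for x
      using A_op_resolvent_identity[OF s t \<sigma>, of x] by (simp add: A_def algebra_simps)
    have GE: "G t (E x) = G s x" for x
    proof -
      have "G t (E x) = x + (t - s) *\<^sub>R A s x + (r - t) *\<^sub>R (A t x + (t - s) *\<^sub>R A t (A s x))"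
        by (simp add: Ex Gx blinfun.add_right blinfun.scaleR_right scaleR_add_right)
      also have "\<dots> = x + (t - s) *\<^sub>R A s x + (r - t) *\<^sub>R A s x" by (simp only: id[symmetric])
      also have "\<dots> = G s x" by (simp add: Gs flip: scaleR_add_left)
      finally show ?thesis .
    qed
    have EG: "E (G t x) = G t (E x)" for x
      by (simp add: Ex Gx blinfun.add_right blinfun.scaleR_right comm scaleR_add_right mult.commute add_ac)
    have inj: "x = 0" if "E x = 0" for x
      using pencil_A_op_injective[OF s t \<sigma>] that by (simp add: E_def A_def)
    have injk: "blinfun_pow E j x = 0 \<Longrightarrow> x = 0" for j x
      by (induction j) (auto dest: inj)
    have "blinfun_pow E j (blinfun_pow (G t) j x) = blinfun_pow (G s) j x" for j x
    proof (induction j)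
      case (Suc j)
      have "blinfun_pow E (Suc j) (blinfun_pow (G t) (Suc j) x)
          = E (G t (blinfun_pow E j (blinfun_pow (G t) j x)))"
        using blinfun_pow_commute[of "G t" E j] EG by simp
      then show ?case by (simp add: Suc EG GE)
    qed simp
    then have "blinfun_pow E k (blinfun_pow (G t) k u) = 0" using u by simp
    then show ?thesis by (rule injk)
  qed
  then have "Upsilon_k F J H lam \<sigma> r k = {u. blinfun_pow (G s) k u = 0}" for k
    unfolding Ups using s by blast
  then show ?thesis by (simp add: Upsilon_def G_def A_def)
qed

lemma P_res_iso:
  assumes s: "nonresonant F H lam s" and \<sigma>: "\<sigma> \<in> {1, -1}"
  shows "linear_iso_betw (blinfun_apply (P_res F J H lam \<sigma> r))
    (Upsilon F J H lam (- \<sigma>) r) (Upsilon F J H lam \<sigma> r)"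
proof -
  have \<sigma>': "- \<sigma> \<in> {1, -1}" using \<sigma> by auto
  let ?A = "\<lambda>\<tau>. A_op F J H lam \<tau> s" and ?T = "\<lambda>\<tau>. sandwich_bdry F (H s) lam \<tau>"
  let ?G = "\<lambda>\<tau>. pencil (?A \<tau>) (of_real s) (of_real r)"
  obtain p1 P1 where P1: "riesz_projection (?G \<sigma>) p1 P1" "compact_blinfun P1"
    by (rule pencil_riesz_projection_exists[OF compact_A_op[OF s \<sigma>] clinear_A_op[OF s \<sigma>]])
  obtain p2 P2 where P2: "riesz_projection (?G (- \<sigma>)) p2 P2"
    by (rule pencil_riesz_projection_exists[OF compact_A_op[OF s \<sigma>'] clinear_A_op[OF s \<sigma>']])
  have P: "P_res F J H lam \<sigma> r = P1" by (rule P_res_eq[OF s \<sigma> P1(1)])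
  have U1: "Upsilon F J H lam \<sigma> r = range P1"
    unfolding Upsilon_eq[OF s \<sigma>] by (rule riesz_projection_range_eq[OF P1(1), symmetric])
  have U2: "Upsilon F J H lam (- \<sigma>) r = range P2"
    unfolding Upsilon_eq[OF s \<sigma>'] by (rule riesz_projection_range_eq[OF P2, symmetric])
  note i1 = riesz_projection_idem[OF P1(1)] and i2 = riesz_projection_idem[OF P2]
  note c1 = riesz_projection_scaleC[OF compact_A_op[OF s \<sigma>] clinear_A_op[OF s \<sigma>] P1(1)]
    and c2 = riesz_projection_scaleC[OF compact_A_op[OF s \<sigma>'] clinear_A_op[OF s \<sigma>'] P2]
  have sub: "csubspace (range Q)" if "\<And>c x. Q (c *\<^sub>C x) = c *\<^sub>C Q x" for Q :: "'k \<Rightarrow>\<^sub>L 'k"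
    unfolding csubspace_def
    by (metis (no_types, lifting) blinfun.add_right blinfun.zero_right rangeE rangeI that)
  \<comment> \<open>Surjectivity of one projection rests on injectivity in both directions, so the
    comparison is made twice with the sides exchanged.\<close>
  have inj1: "u = 0" if "P2 u = u" "P1 u = 0" for u
    by (rule root_space_projection_injective[OF compact_sandwich_bdry[OF s \<sigma>] clinear_sandwich_bdry[OF s \<sigma>]
          compact_sandwich_bdry[OF s \<sigma>'] clinear_sandwich_bdry[OF s \<sigma>'] J_clinear J_symmetric
          _ _ P1(1)[unfolded A_op_def] P2[unfolded A_op_def] that])
      (use sandwich_bdry_adjoint[OF s \<sigma>'] sandwich_bdry_definite[OF s \<sigma>] in simp_all)
  have inj2: "u = 0" if "P1 u = u" "P2 u = 0" for u
    by (rule root_space_projection_injective[OF compact_sandwich_bdry[OF s \<sigma>'] clinear_sandwich_bdry[OF s \<sigma>']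
          compact_sandwich_bdry[OF s \<sigma>] clinear_sandwich_bdry[OF s \<sigma>] J_clinear J_symmetric
          _ _ P2[unfolded A_op_def] P1(1)[unfolded A_op_def] that])
      (use sandwich_bdry_adjoint[OF s \<sigma>] sandwich_bdry_definite[OF s \<sigma>'] in simp_all)
  have "bij_betw P1 (range P2) (range P1)"
    unfolding bij_betw_def
  proof
    show "inj_on P1 (range P2)"
    proof (rule inj_onI)
      fix x y assume "x \<in> range P2" "y \<in> range P2" "P1 x = P1 y"
      then have "P2 (x - y) = x - y" "P1 (x - y) = 0" by (auto simp: blinfun.diff_right i2)
      from inj1[OF this] show "x = y" by simp
    qed
    have "P1 v \<in> P1 ` range P2" for v
    proof -
      obtain u where "P2 u = u" "P1 u = P1 v"
        by (rule idempotent_pair_surjective[OF P1(2) i1 i2 inj1 inj2 i1[of v]])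
      then show ?thesis by (metis image_eqI rangeI)
    qed
    then show "P1 ` range P2 = range P1" by blast
  qed
  then show ?thesis
    unfolding linear_iso_betw_def P U1 U2
    using sub[OF c1] sub[OF c2] c1 by (simp add: blinfun.add_right)
qed

end

theorem theorem1p32:
  fixes F :: "('h::{chilbert_space, second_countable_topology}
                \<times> 'k::{chilbert_space, second_countable_topology}) set"
    and J :: "'k \<Rightarrow>\<^sub>L 'k"
    and H :: "real \<Rightarrow> ('h \<times> 'h) set"
    and D :: "'h set"
    and lam r_lam :: real
  assumes "resonance_line F J H D"
    and "regular_at F H lam"
    and "resonance_point F H lam r_lam"
  shows "linear_iso_betw (blinfun_apply (P_res F J H lam 1 r_lam))
           (Upsilon F J H lam (-1) r_lam) (Upsilon F J H lam 1 r_lam) \<and>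
         linear_iso_betw (blinfun_apply (P_res F J H lam (-1) r_lam))
           (Upsilon F J H lam 1 r_lam) (Upsilon F J H lam (-1) r_lam)"
proof -
  interpret resonance_line F J H D by fact
  obtain s where s: "nonresonant F H lam s"
    using assms(2) unfolding regular_at_def nonresonant_def by blast
  show ?thesis using P_res_iso[OF s, of 1 r_lam] P_res_iso[OF s, of "-1" r_lam] by simp
qed

end
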